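(* For all $T>0$ the following holds. (i) For all $d<x\le T$ we have $$\int_d^xK^\dagger(x,y)\,\Xi_\phi(x)^{-1}W^{(q)\prime}(y-d)\,dy<\infty,$$ and hence $$w^{(q)\prime}(x;d)=\Xi_\phi(x)^{-1}W^{(q)\prime}((x-d)+)+\int_d^xK^\dagger(x,y)\,\Xi_\phi(x)^{-1}W^{(q)\prime}(y-d)\,dy$$ is the unique solution of $$w^{(q)\prime}(x;d)=\Xi_\phi(x)^{-1}W^{(q)\prime}((x-d)+)+\int_d^x\Xi_\phi(x)^{-1}\phi(y)W^{(q)\prime}(x-y)\,w^{(q)\prime}(y;d)\,dy .$$ (ii) For $0\le x\le T$ we have $$\int_0^xK^\dagger(x,y)\,\Xi_\phi(x)^{-1}qW^{(q)}(y)\,dy<\infty,$$ and hence $$z^{(q)\prime}(x)=\Xi_\phi(x)^{-1}qW^{(q)}(x)+\int_0^xK^\dagger(x,y)\,\Xi_\phi(x)^{-1}qW^{(q)}(y)\,dy$$ is the unique solution of $$z^{(q)\prime}(x)=\Xi_\phi(x)^{-1}qW^{(q)}(x)+\int_0^x\Xi_\phi(x)^{-1}\phi(y)W^{(q)\prime}(x-y)\,z^{(q)\prime}(y)\,dy .$$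
   Context: $q\ge0$ and $d\in\mathbb R$. $X$ is a spectrally negative Lévy process without monotone paths, with Laplace exponent $\psi(\lambda)=\gamma\lambda+\frac12\sigma^2\lambda^2+\int_0^\infty(e^{-\lambda z}-1+\lambda z\mathbf 1_{(0,1)}(z))\,\Pi(dz)$, $\lambda\ge0$. $X$ has bounded variation paths iff $\sigma=0$ and $\int_0^1z\,\Pi(dz)<\infty$; then $c:=\gamma+\int_0^1z\,\Pi(dz)$ is its drift. $W^{(q)}$ is the scale function of $X$: continuous on $[0,\infty)$ with $\int_0^\infty e^{-\lambda y}W^{(q)}(y)\,dy=1/(\psi(\lambda)-q)$ for all large $\lambda$, and $W^{(q)}(x)=0$ for $x<0$. $W^{(q)\prime}$ denotes the right derivative of $W^{(q)}$ on $(0,\infty)$ (which always exists; this is also the meaning of the notation $W^{(q)\prime}(x+)$). The rate function $\phi:\mathbb R\to\mathbb R$ is non-decreasing, $\phi(x)=0$ for $x\le d'$ for some fixed $d'\in\mathbb R$, and $\phi$ is either locally Lipschitz continuous or of the form $\sum_{j=1}^k\delta_j\mathbf 1_{\{x>b_j\}}$ with $\delta_j>0$, $b_1<\dots<b_k$; in the bounded variation case $\phi(x)<c$ for all $x$. Put $\Xi_\phi(x)=1-W^{(q)}(0)\phi(x)$ (strictly positive). For $y<x$ let $K(x,y)=\Xi_\phi(x)^{-1}\phi(y)W^{(q)\prime}((x-y)+)$, $K^{(1)}=K$, $K^{(l+1)}(x,y)=\int_y^xK^{(l)}(x,w)K(w,y)\,dw$ for $l\ge1$, and $K^\dagger(x,y)=\sum_{l=1}^\infty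 K^{(l)}(x,y)$. Here $w^{(q)\prime}(\cdot;d)$ and $z^{(q)\prime}$ are the unknown functions of the two Volterra equations (measurable functions for which the integrals are well defined); the functions $w^{(q)}(\cdot;d)$ and $z^{(q)}$ themselves are then recovered through the boundary conditions $w^{(q)}(d;d)=W^{(q)}(0)$ and $z^{(q)}(0)=1$.
   Formalization: In both solution formulas the weight inside the K^† integral is Ξ_φ(y)^{-1} instead of the printed Ξ_φ(x)^{-1}, as the printed formula fails to solve the equation when W^{(q)}(0)>0 and φ is strictly increasing where positive; finiteness is shown for both weights. *)

theory Defs
  imports "HOL-Probability.Probability"
begin

definition levy_process :: "'a measure \<Rightarrow> (real \<Rightarrow> 'a \<Rightarrow> real) \<Rightarrow> bool" where
  "levy_process M X \<longleftrightarrow>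
     prob_space M \<and>
     (\<forall>t\<ge>0. X t \<in> borel_measurable M) \<and>
     (AE \<omega> in M. X 0 \<omega> = 0) \<and>
     (\<forall>(t::nat \<Rightarrow> real) n. 0 \<le> t 0 \<longrightarrow> mono t \<longrightarrow>
        prob_space.indep_vars M (\<lambda>_. borel) (\<lambda>i \<omega>. X (t (Suc i)) \<omega> - X (t i) \<omega>) {..<n}) \<and>
     (\<forall>s t. 0 \<le> s \<longrightarrow> s \<le> t \<longrightarrow>
        distr M borel (\<lambda>\<omega>. X t \<omega> - X s \<omega>) = distr M borel (X (t - s))) \<and>
     (AE \<omega> in M. (\<forall>t\<ge>0. ((\<lambda>s. X s \<omega>) \<longlongrightarrow> X t \<omega>) (at_right t)) \<and>
                  (\<forall>t>0. \<exists>l. ((\<lambda>s. X s \<omega>) \<longlongrightarrow> l) (at_left t)))"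

definition no_positive_jumps :: "'a measure \<Rightarrow> (real \<Rightarrow> 'a \<Rightarrow> real) \<Rightarrow> bool" where
  "no_positive_jumps M X \<longleftrightarrow>
     (AE \<omega> in M. \<forall>t>0. \<forall>l. ((\<lambda>s. X s \<omega>) \<longlongrightarrow> l) (at_left t) \<longrightarrow> X t \<omega> \<le> l)"

definition monotone_paths :: "'a measure \<Rightarrow> (real \<Rightarrow> 'a \<Rightarrow> real) \<Rightarrow> bool" where
  "monotone_paths M X \<longleftrightarrow>
     (AE \<omega> in M. mono_on {0..} (\<lambda>t. X t \<omega>)) \<or> (AE \<omega> in M. antimono_on {0..} (\<lambda>t. X t \<omega>))"

text \<open>The jumps of the process are negative; the Levy measure records their sizes, so that
  it lives on the positive half-line.\<close>

definition levy_measure :: "real measure \<Rightarrow> bool" where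
  "levy_measure \<nu> \<longleftrightarrow>
     sets \<nu> = sets borel \<and> emeasure \<nu> {..0} = 0 \<and>
     (\<integral>\<^sup>+ z. ennreal (min 1 (z^2)) \<partial>\<nu>) < \<infinity>"

definition laplace_exponent :: "real \<Rightarrow> real \<Rightarrow> real measure \<Rightarrow> real \<Rightarrow> real" where
  "laplace_exponent \<gamma> \<sigma> \<nu> \<beta> =
     \<gamma> * \<beta> + \<sigma>^2 * \<beta>^2 / 2 +
     (LINT z:{0<..}|\<nu>. (exp (- \<beta> * z) - 1 + \<beta> * z * indicator {0<..<1} z))"

definition spectrally_negative_levy ::
  "'a measure \<Rightarrow> (real \<Rightarrow> 'a \<Rightarrow> real) \<Rightarrow> real \<Rightarrow> real \<Rightarrow> real measure \<Rightarrow> bool" where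
  "spectrally_negative_levy M X \<gamma> \<sigma> \<nu> \<longleftrightarrow>
     levy_process M X \<and> no_positive_jumps M X \<and> \<not> monotone_paths M X \<and> levy_measure \<nu> \<and>
     (\<forall>t\<ge>0. \<forall>\<beta>\<ge>0. integrable M (\<lambda>\<omega>. exp (\<beta> * X t \<omega>)) \<and>
        prob_space.expectation M (\<lambda>\<omega>. exp (\<beta> * X t \<omega>)) = exp (t * laplace_exponent \<gamma> \<sigma> \<nu> \<beta>))"

text \<open>The standard criterion on the Levy triplet for paths of bounded variation.\<close>

definition bounded_variation_case :: "real \<Rightarrow> real measure \<Rightarrow> bool" where
  "bounded_variation_case \<sigma> \<nu> \<longleftrightarrow> \<sigma> = 0 \<and> (\<integral>\<^sup>+ z\<in>{0<..<1}. ennreal z \<partial>\<nu>) < \<infinity>"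

definition drift :: "real \<Rightarrow> real measure \<Rightarrow> real" where
  "drift \<gamma> \<nu> = \<gamma> + (LINT z:{0<..<1}|\<nu>. z)"

definition scale_function :: "(real \<Rightarrow> real) \<Rightarrow> real \<Rightarrow> (real \<Rightarrow> real) \<Rightarrow> bool" where
  "scale_function \<psi> q W \<longleftrightarrow>
     continuous_on {0..} W \<and> (\<forall>x<0. W x = 0) \<and>
     (\<forall>\<^sub>F \<beta> in at_top. set_integrable lborel {0..} (\<lambda>y. exp (- \<beta> * y) * W y) \<and>
        (LBINT y:{0..}. exp (- \<beta> * y) * W y) = 1 / (\<psi> \<beta> - q))"

text \<open>A scale function has a right derivative at every positive point, so the choice made by
  \<^const>\<open>vector_derivative\<close> is genuine there.\<close>

definition right_deriv :: "(real \<Rightarrow> real) \<Rightarrow> real \<Rightarrow> real" where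
  "right_deriv f x = vector_derivative f (at_right x)"

definition rate_function :: "(real \<Rightarrow> real) \<Rightarrow> bool" where
  "rate_function \<phi> \<longleftrightarrow>
     mono \<phi> \<and> (\<exists>d'. \<forall>x\<le>d'. \<phi> x = 0) \<and>
     ((\<forall>x. \<exists>u>0. \<exists>L. L-lipschitz_on (cball x u) \<phi>) \<or>
      (\<exists>(k::nat) (\<delta>::nat \<Rightarrow> real) (b::nat \<Rightarrow> real).
         1 \<le> k \<and> (\<forall>j\<in>{1..k}. 0 < \<delta> j) \<and> strict_mono_on {1..k} b \<and>
         \<phi> = (\<lambda>x. \<Sum>j=1..k. \<delta> j * indicator {b j<..} x)))"

definition Xi :: "(real \<Rightarrow> real) \<Rightarrow> (real \<Rightarrow> real) \<Rightarrow> real \<Rightarrow> real" where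
  "Xi W \<phi> x = 1 - W 0 * \<phi> x"

definition volterra_kernel :: "(real \<Rightarrow> real) \<Rightarrow> (real \<Rightarrow> real) \<Rightarrow> real \<Rightarrow> real \<Rightarrow> real" where
  "volterra_kernel W \<phi> x y = inverse (Xi W \<phi> x) * \<phi> y * right_deriv W (x - y)"

text \<open>The kernel is nonnegative for \<open>y < x\<close>, so the iterated kernels and their sum are taken in
  the extended nonnegative reals.  Iterates are counted from 0: \<open>iterated_kernel k l\<close> is the
  (l+1)-st iterate of \<open>k\<close>.\<close>

primrec iterated_kernel ::
  "(real \<Rightarrow> real \<Rightarrow> real) \<Rightarrow> nat \<Rightarrow> real \<Rightarrow> real \<Rightarrow> ennreal" where
  "iterated_kernel k 0 x y = ennreal (k x y)"
| "iterated_kernel k (Suc l) x y =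
     (\<integral>\<^sup>+ w\<in>{y<..<x}. (iterated_kernel k l x w * ennreal (k w y)) \<partial>lborel)"

definition resolvent_kernel :: "(real \<Rightarrow> real \<Rightarrow> real) \<Rightarrow> real \<Rightarrow> real \<Rightarrow> ennreal" where
  "resolvent_kernel k x y = (\<Sum>l. iterated_kernel k l x y)"

text \<open>Solutions on \<open>I\<close> of \<open>f(x) = g(x) + \<integral>\<^sub>a\<^sup>x k(x,y) f(y) dy\<close>.  With \<open>r\<close> the resolvent kernel of
  \<open>k\<close>, the Neumann series is \<open>g(x) + \<integral>\<^sub>a\<^sup>x r(x,y) g(y) dy\<close>: the forcing term is taken at the
  integration variable, including any weight that is a factor of \<open>g\<close>.  Integration over open
  intervals keeps the right derivative of the scale function away from 0.\<close>

definition volterra_solution ::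
  "real set \<Rightarrow> real \<Rightarrow> (real \<Rightarrow> real) \<Rightarrow> (real \<Rightarrow> real \<Rightarrow> real) \<Rightarrow> (real \<Rightarrow> real) \<Rightarrow> bool" where
  "volterra_solution I a g k f \<longleftrightarrow>
     set_borel_measurable borel I f \<and>
     (\<forall>x\<in>I. set_integrable lborel {a<..<x} (\<lambda>y. k x y * f y) \<and>
        f x = g x + (LBINT y:{a<..<x}. k x y * f y))"

definition unique_volterra_solution ::
  "real set \<Rightarrow> real \<Rightarrow> (real \<Rightarrow> real) \<Rightarrow> (real \<Rightarrow> real \<Rightarrow> real) \<Rightarrow> (real \<Rightarrow> real) \<Rightarrow> bool" where
  "unique_volterra_solution I a g k f \<longleftrightarrow>
     volterra_solution I a g k f \<and>
     (\<forall>h. volterra_solution I a g k h \<longrightarrow> (\<forall>x\<in>I. h x = f x))"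

end

theory Submission
  imports Defs "HOL-Complex_Analysis.Cauchy_Integral_Formula"
begin

text \<open>The kernel is dominated by \<open>C g(x - y)\<close> with \<open>g\<close> the right derivative of the scale function
  \<open>W\<close>. If \<open>g\<close> is integrable near \<open>0\<close> and \<open>t\<^sup>3 g(t)\<close> is bounded, then an exponential weight makes the
  Neumann series converge at every single point, not just almost everywhere. These properties of
  \<open>g\<close> follow from the fact that \<open>W\<close> is increasing and log-concave on the positive half-line, with
  \<open>W(x) \<ge> c x\<^sup>2\<close> near \<open>0\<close>.

  Log-concavity is read off the Laplace transform alone, without fluctuation theory. The numbers
  \<open>w\<^sub>n = \<integral> \<beta> e\<^sup>-\<^sup>\<beta>\<^sup>y (\<beta>y)\<^sup>n / n! W(y) dy\<close> solve the renewal equation of a skip-free random walk, for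
  which induction gives that \<open>w\<^sub>n\<close> increases and \<open>w\<^sub>n\<^sub>+\<^sub>1 / w\<^sub>n\<close> decreases; by the Post--Widder inversion
  formula, both properties pass to \<open>W\<close> as \<open>\<beta> \<rightarrow> \<infinity>\<close> and \<open>n / \<beta> \<rightarrow> x\<close>.\<close>

section \<open>Skip-free renewal sequences\<close>

text \<open>The kernel inherits from \<open>right_deriv W\<close> a possibly unbounded singularity
  on the diagonal. For a kernel that is merely integrable, a contraction argument in L1 yields a
  Neumann series that is finite almost everywhere only, whereas the claim concerns every point;
  hence the pointwise rate. The exponent 3 is 2 + 1: two powers from the lower bound on
  \<open>W\<close>, and one from bounding the derivative of \<open>ln W\<close> at \<open>x\<close>
  by its slope over \<open>(x / 2, x)\<close>. The rate does not imply integrability near 0, which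
  comes separately from monotonicity of \<open>W\<close>. The uniqueness claim ranges over all
  measurable functions for which the integrals exist, so a solution brings no integrability of its
  own. Log-concavity helps again: it keeps \<open>right_deriv W\<close> away from 0 at arguments
  below any point where it is positive. In the finiteness claims the weight
  \<open>inverse (Xi W \<phi> _)\<close> stands once at \<open>x\<close> and once at
  \<open>y\<close>. The solution formula has it at \<open>y\<close>; the other version follows since
  \<open>Xi\<close> is at most 1.\<close>

lemma renewal_sequence_mono:
  fixes a w :: "nat \<Rightarrow> real"
  assumes a0: "0 < a 0" and a: "\<And>i. 2 \<le> i \<Longrightarrow> 0 \<le> a i"
    and s: "\<And>n. 1 \<le> n \<Longrightarrow> (\<Sum>i\<le>n. a i) \<le> 0"
    and w0: "0 < w 0" and rec: "\<And>n. 1 \<le> n \<Longrightarrow> (\<Sum>i\<le>n. a i * w (n - i)) = 0"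
  shows "0 < w n \<and> w n \<le> w (Suc n)"
proof (induction n rule: less_induct)
  case (less n)
  have mono: "w i \<le> w n \<and> 0 < w i" if "i \<le> n" for i
  proof -
    have step: "w j \<le> w (Suc j)" if "Suc j \<le> n" for j
      using less[of j] that by simp
    have "j \<le> n \<Longrightarrow> w 0 \<le> w j" for j
      by (induction j) (use step in \<open>auto intro: order_trans\<close>)
    moreover have "i \<le> j \<Longrightarrow> j \<le> n \<Longrightarrow> w i \<le> w j" for j
      by (induction j rule: dec_induct) (use step in \<open>auto intro: order_trans\<close>)
    ultimately show ?thesis using w0 that by (meson dual_order.refl less_le_trans)
  qed
  have split: "(\<Sum>i\<le>Suc n. f i) = f 0 + f 1 + (\<Sum>i\<in>{2..Suc n}. f i)" for f :: "nat \<Rightarrow> real"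
  proof -
    have "{..Suc n} = {0,1} \<union> {2..Suc n}" by auto
    then show ?thesis by (simp add: sum.union_disjoint)
  qed
  \<comment> \<open>From index 2 on the coefficients are nonnegative, so replacing
    \<open>w (Suc n - i)\<close> by the larger \<open>w n\<close> loses in the right direction. The
    bound on the partial sums of \<open>a\<close> then leaves \<open>a 0\<close> as the coefficient
    of \<open>w n\<close>.\<close>
  have "(\<Sum>i\<in>{2..Suc n}. a i * w (Suc n - i)) \<le> (\<Sum>i\<in>{2..Suc n}. a i * w n)"
    by (intro sum_mono mult_left_mono) (use mono a in auto)
  also have "\<dots> = (\<Sum>i\<in>{2..Suc n}. a i) * w n" by (rule sum_distrib_right[symmetric])
  also have "\<dots> \<le> (- a 0 - a 1) * w n"
    using s[of "Suc n"] mono[of n] unfolding split by (intro mult_right_mono) auto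
  finally have "0 \<le> a 0 * w (Suc n) - a 0 * w n"
    using rec[of "Suc n"] unfolding split by (simp add: algebra_simps)
  then have "a 0 * w n \<le> a 0 * w (Suc n)" by simp
  then show ?case using a0 mono[of n] by simp
qed

text \<open>Divided by \<open>w n\<close>, the recurrence expresses
  \<open>a 0 * w (Suc n) / w n\<close> as \<open>- a 1\<close> minus a sum of backward ratios
  \<open>w (Suc n - i) / w n\<close> with weights \<open>a i \<ge> 0\<close>. If the earlier
  quotients decrease, raising \<open>n\<close> by one enlarges every backward ratio and adds a
  nonnegative term, so the next quotient is smaller.\<close>

lemma renewal_sequence_log_concave:
  fixes a w :: "nat \<Rightarrow> real"
  assumes a0: "0 < a 0" and a: "\<And>i. 2 \<le> i \<Longrightarrow> 0 \<le> a i"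
    and rec: "\<And>n. 1 \<le> n \<Longrightarrow> (\<Sum>i\<le>n. a i * w (n - i)) = 0"
    and pos: "\<And>n. 0 < w n"
  shows "w (Suc (Suc n)) / w (Suc n) \<le> w (Suc n) / w n"
proof (induction n rule: less_induct)
  case (less n)
  define \<rho> where "\<rho> n = w (Suc n) / w n" for n
  have dec: "\<rho> n \<le> \<rho> i" if "i \<le> n" for i
  proof -
    have step: "\<rho> (Suc j) \<le> \<rho> j" if "Suc j \<le> n" for j
      using less[of j] that by (simp add: \<rho>_def)
    have "i \<le> j \<Longrightarrow> j \<le> n \<Longrightarrow> \<rho> j \<le> \<rho> i" for j
      by (induction j rule: dec_induct) (use step in \<open>auto intro: order_trans\<close>)
    then show ?thesis using that by auto
  qed
  have split: "(\<Sum>i\<le>Suc k. f i) = f 0 + f 1 + (\<Sum>i\<in>{2..Suc k}. f i)" for f :: "nat \<Rightarrow> real" and k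
  proof -
    have "{..Suc k} = {0,1} \<union> {2..Suc k}" by auto
    then show ?thesis by (simp add: sum.union_disjoint)
  qed
  have ratio: "a 0 * \<rho> k = - a 1 - (\<Sum>i\<in>{2..Suc k}. a i * (w (Suc k - i) / w k))" for k
    using rec[of "Suc k"] pos[of k] unfolding split \<rho>_def
    by (simp add: field_simps sum_divide_distrib[symmetric])
  have "(\<Sum>i\<in>{2..Suc n}. a i * (w (Suc n - i) / w n))
      \<le> (\<Sum>i\<in>{2..Suc n}. a i * (w (Suc (Suc n) - i) / w (Suc n)))"
  proof (intro sum_mono mult_left_mono)
    fix i assume i: "i \<in> {2..Suc n}"
    then have "\<rho> n \<le> \<rho> (Suc n - i)" by (intro dec) auto
    moreover have "Suc (Suc n - i) = Suc (Suc n) - i" using i by auto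
    ultimately show "w (Suc n - i) / w n \<le> w (Suc (Suc n) - i) / w (Suc n)"
      using pos[of n] pos[of "Suc n"] pos[of "Suc n - i"] unfolding \<rho>_def
      by (simp add: field_simps)
  qed (use a in auto)
  also have "\<dots> \<le> (\<Sum>i\<in>{2..Suc (Suc n)}. a i * (w (Suc (Suc n) - i) / w (Suc n)))"
    using a[of "Suc (Suc n)"] pos[of 0] pos[of "Suc n"] by simp
  finally have "a 0 * \<rho> (Suc n) \<le> a 0 * \<rho> n" unfolding ratio by simp
  then show ?case using a0 by (simp add: \<rho>_def mult_le_cancel_left_pos del: times_divide_eq_right)
qed

text \<open>Concavity of \<open>ln w\<close> at three indices. With the gaps as factors instead of
  denominators it also covers coinciding indices and passes to limits directly.\<close>

lemma log_concave_sequence_slope: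
  fixes w :: "nat \<Rightarrow> real"
  assumes pos: "\<And>n. 0 < w n"
    and dec: "\<And>n. w (Suc (Suc n)) / w (Suc n) \<le> w (Suc n) / w n"
    and "i \<le> j" "j \<le> k"
  shows "real (j - i) * (ln (w k) - ln (w j)) \<le> real (k - j) * (ln (w j) - ln (w i))"
proof -
  define \<delta> where "\<delta> n = ln (w (Suc n)) - ln (w n)" for n
  have "\<delta> (Suc n) \<le> \<delta> n" for n
  proof -
    have "ln (w (Suc (Suc n)) / w (Suc n)) \<le> ln (w (Suc n) / w n)"
      using dec[of n] pos by (subst ln_le_cancel_iff) auto
    then show ?thesis using pos unfolding \<delta>_def by (simp add: ln_divide_pos)
  qed
  then have dec: "decseq \<delta>" by (rule decseq_SucI)
  have tel: "ln (w n) - ln (w m) = (\<Sum>l\<in>{m..<n}. \<delta> l)" if "m \<le> n" for m n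
    unfolding \<delta>_def using that by (simp add: sum_Suc_diff'[of m n "\<lambda>n. ln (w n)"])
  have 1: "ln (w k) - ln (w j) \<le> real (k - j) * \<delta> j"
    using sum_bounded_above[of "{j..<k}" \<delta> "\<delta> j"] dec tel[OF \<open>j \<le> k\<close>] by (auto simp: decseq_def)
  have 2: "real (j - i) * \<delta> j \<le> ln (w j) - ln (w i)"
    using sum_bounded_below[of "{i..<j}" "\<delta> j" \<delta>] dec tel[OF \<open>i \<le> j\<close>] by (auto simp: decseq_def)
  have "real (j - i) * (ln (w k) - ln (w j)) \<le> real (j - i) * (real (k - j) * \<delta> j)"
    by (intro mult_left_mono 1) auto
  also have "\<dots> = real (k - j) * (real (j - i) * \<delta> j)" by simp
  also have "\<dots> \<le> real (k - j) * (ln (w j) - ln (w i))"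
    by (intro mult_left_mono 2) auto
  finally show ?thesis .
qed

section \<open>The Laplace exponent\<close>

lemma levy_integrable:
  fixes f :: "real \<Rightarrow> real"
  assumes nu: "levy_measure \<nu>" and [measurable]: "f \<in> borel_measurable borel"
    and bd: "\<And>z. 0 < z \<Longrightarrow> \<bar>f z\<bar> \<le> C * min 1 (z^2)"
  shows "set_integrable \<nu> {0<..} f"
proof -
  have sets[measurable_cong]: "sets \<nu> = sets borel" using nu by (simp add: levy_measure_def)
  have C: "0 \<le> C" using bd[of 1] by simp
  have m: "integrable \<nu> (\<lambda>z. min 1 (z^2))"
    using nu by (intro integrableI_nonneg) (auto simp: levy_measure_def)
  show ?thesis unfolding set_integrable_def
  proof (rule Bochner_Integration.integrable_bound[OF integrable_mult_right[of C, OF m]])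
    show "AE z in \<nu>. norm (indicator {0<..} z *\<^sub>R f z) \<le> norm (C * min 1 (z^2))"
      using bd C by (intro AE_I2) (auto simp: indicator_def abs_mult)
  qed measurable
qed

text \<open>The quantity \<open>1 - exp (-u) * (1 + u)\<close> is the probability that a Poisson
  variable of mean \<open>u\<close> is at least 2. Its bound by \<open>min 1 (u^2)\<close> makes the
  power series of the Laplace exponent integrable against a Levy measure.\<close>

lemma exp_bounds:
  fixes u :: real
  assumes "0 \<le> u"
  shows "0 \<le> exp (-u) - 1 + u" "exp (-u) - 1 + u \<le> u^2 / 2"
    "0 \<le> 1 - exp (-u) * (1 + u)" "1 - exp (-u) * (1 + u) \<le> min 1 (u^2)"
    "u * (1 - exp (-u)) \<le> u^2" "0 \<le> u * (1 - exp (-u))" "0 \<le> u * exp (-u)" "u * exp (-u) \<le> 1"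
proof -
  show 1: "0 \<le> exp (-u) - 1 + u" using exp_ge_add_one_self[of "-u"] by simp
  have "1 + u \<le> exp u" by (rule exp_ge_add_one_self)
  then have 2: "exp (-u) * (1 + u) \<le> 1"
    by (simp add: exp_minus field_simps)
  then show "0 \<le> 1 - exp (-u) * (1 + u)" by simp
  have "(1 - u) * (1 + u) \<le> exp (-u) * (1 + u)" using 1 assms by (intro mult_right_mono) auto
  moreover have "0 \<le> exp (-u) * (1 + u)" using assms by simp
  ultimately show "1 - exp (-u) * (1 + u) \<le> min 1 (u^2)" by (simp add: algebra_simps power2_eq_square)
  have "1 - exp (-u) \<le> u" using 1 by simp
  then show "u * (1 - exp (-u)) \<le> u^2" using assms unfolding power2_eq_square by (intro mult_left_mono)
  show "0 \<le> u * (1 - exp (-u))" using assms by (intro mult_nonneg_nonneg) auto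
  show "0 \<le> u * exp (-u)" using assms by simp
  show "u * exp (-u) \<le> 1" using 2 assms by (smt (verit) distrib_left exp_gt_zero mult.commute mult_cancel_right1)
  show "exp (-u) - 1 + u \<le> u^2 / 2"
  proof -
    have "(\<lambda>u::real. u^2/2 - (exp (-u) - 1 + u)) 0 \<le> (\<lambda>u. u^2/2 - (exp (-u) - 1 + u)) u"
    proof (rule DERIV_nonneg_imp_nondecreasing[OF assms])
      fix x :: real assume "0 \<le> x" "x \<le> u"
      then show "\<exists>y. ((\<lambda>u. u^2/2 - (exp (-u) - 1 + u)) has_real_derivative y) (at x) \<and> 0 \<le> y"
        using exp_ge_add_one_self[of "-x"]
        by (intro exI[of _ "x + exp (-x) - 1"]) (auto intro!: derivative_eq_intros)
    qed
    then show ?thesis by simp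
  qed
qed

lemma le_mult_min_one:
  fixes a :: real
  assumes "z < 1 \<Longrightarrow> a \<le> C * z^2" "1 \<le> z \<Longrightarrow> a \<le> C" "0 < z"
  shows "a \<le> C * min 1 (z^2)"
proof (cases "z < 1")
  case True then show ?thesis using assms by (simp add: min_absorb2 power_le_one)
next
  case False then show ?thesis using assms by (simp add: min_absorb1)
qed

lemma laplace_integrand_bound:
  fixes \<beta> z :: real
  assumes "0 \<le> \<beta>" "0 < z"
  shows "\<bar>exp (- \<beta> * z) - 1 + \<beta> * z * indicator {0<..<1} z\<bar> \<le> (\<beta>^2 + 1) * min 1 (z^2)"
proof (rule le_mult_min_one)
  have "0 \<le> \<beta> * z" using assms by simp
  note e = exp_bounds[OF this]
  show "\<bar>exp (- \<beta> * z) - 1 + \<beta> * z * indicator {0<..<1} z\<bar> \<le> (\<beta>^2 + 1) * z^2" if "z < 1"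
  proof -
    have "\<bar>exp (- \<beta> * z) - 1 + \<beta> * z * indicator {0<..<1} z\<bar> \<le> (\<beta>*z)^2 / 2"
      using e that assms by simp
    also have "\<dots> \<le> (\<beta>^2 + 1) * z^2" by (simp add: power_mult_distrib algebra_simps)
    finally show ?thesis .
  qed
  show "\<bar>exp (- \<beta> * z) - 1 + \<beta> * z * indicator {0<..<1} z\<bar> \<le> (\<beta>^2 + 1)" if "1 \<le> z"
  proof -
    have "\<bar>exp (- \<beta> * z) - 1 + \<beta> * z * indicator {0<..<1} z\<bar> \<le> 1"
      using that assms by simp
    then show ?thesis by (smt (verit) zero_le_power2)
  qed
qed (use assms in auto)

text \<open>An upper bound on the Laplace exponent is a lower bound on the Laplace transform of the
  scale function, and so limits how small the scale function can be near 0.\<close>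

lemma laplace_exponent_le_square:
  assumes nu: "levy_measure \<nu>"
  obtains C where "0 < C" "\<And>\<beta>. 1 \<le> \<beta> \<Longrightarrow> laplace_exponent \<gamma> \<sigma> \<nu> \<beta> \<le> C * \<beta>^2"
proof -
  define m where "m = (LINT z:{0<..}|\<nu>. min 1 (z^2))"
  have i: "set_integrable \<nu> {0<..} (\<lambda>z. min 1 (z^2))"
    by (rule levy_integrable[OF nu, of _ 1]) auto
  have "laplace_exponent \<gamma> \<sigma> \<nu> \<beta> \<le> (\<bar>\<gamma>\<bar> + \<sigma>^2 + 2 * \<bar>m\<bar> + 1) * \<beta>^2" if b: "1 \<le> \<beta>" for \<beta>
  proof -
    have bb: "1 \<le> \<beta>^2" "\<beta> \<le> \<beta>^2" using b by (auto simp: self_le_power one_le_power)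
    have "(LINT z:{0<..}|\<nu>. (exp (- \<beta> * z) - 1 + \<beta> * z * indicator {0<..<1} z))
      \<le> (LINT z:{0<..}|\<nu>. (\<beta>^2 + 1) * min 1 (z^2))"
    proof (rule set_integral_mono)
      show "set_integrable \<nu> {0<..} (\<lambda>z. exp (- \<beta> * z) - 1 + \<beta> * z * indicator {0<..<1} z)"
        by (rule levy_integrable[OF nu _ laplace_integrand_bound]) (use b in auto)
      show "set_integrable \<nu> {0<..} (\<lambda>z. (\<beta>^2 + 1) * min 1 (z^2))" using i by simp
    qed (use b laplace_integrand_bound[of \<beta>] in \<open>auto simp: abs_le_iff\<close>)
    also have "\<dots> = (\<beta>^2 + 1) * m" by (simp add: m_def)
    also have "\<dots> \<le> (\<beta>^2 + 1) * \<bar>m\<bar>" by (intro mult_left_mono) auto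
    also have "\<dots> \<le> (\<beta>^2 + \<beta>^2) * \<bar>m\<bar>" using bb by (intro mult_right_mono) auto
    finally have 1: "(LINT z:{0<..}|\<nu>. (exp (- \<beta> * z) - 1 + \<beta> * z * indicator {0<..<1} z)) \<le> 2 * \<bar>m\<bar> * \<beta>^2" by (simp add: mult_ac)
    have "\<gamma> * \<beta> \<le> \<bar>\<gamma>\<bar> * \<beta>^2" using bb b by (intro mult_mono) auto
    moreover have "\<sigma>^2 * \<beta>^2 / 2 \<le> \<sigma>^2 * \<beta>^2" by simp
    moreover have "(\<bar>\<gamma>\<bar> + \<sigma>^2 + 2 * \<bar>m\<bar> + 1) * \<beta>^2 = \<bar>\<gamma>\<bar> * \<beta>^2 + \<sigma>^2 * \<beta>^2 + 2 * \<bar>m\<bar> * \<beta>^2 + \<beta>^2"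
      by (simp add: distrib_right)
    ultimately show ?thesis using 1 bb unfolding laplace_exponent_def by linarith
  qed
  moreover have "0 < \<bar>\<gamma>\<bar> + \<sigma>^2 + 2 * \<bar>m\<bar> + 1" by (intro add_nonneg_pos add_nonneg_nonneg) auto
  ultimately show ?thesis using that by blast
qed

text \<open>The factor \<open>exp (\<beta> * s * z)\<close> of the integrand is expanded in
  \<open>s\<close>. Drift and compensator are affine in \<open>s\<close> and the Gaussian part is a
  multiple of \<open>(1 - s)^2\<close>, so from index 2 on a coefficient is a Levy integral of
  Poisson weights, plus a nonnegative Gaussian term at index 2.\<close>

lemma laplace_exponent_power_series:
  assumes nu: "levy_measure \<nu>" and b: "0 \<le> \<beta>"
  obtains a where "\<And>k. 2 \<le> k \<Longrightarrow> (0::real) \<le> a k"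
    "\<And>s. 0 \<le> s \<Longrightarrow> s \<le> 1 \<Longrightarrow> (\<lambda>k. a k * s^k) sums laplace_exponent \<gamma> \<sigma> \<nu> (\<beta> * (1 - s))"
proof -
  have sets[measurable_cong]: "sets \<nu> = sets borel" using nu by (simp add: levy_measure_def)
  \<comment> \<open>The term \<open>- 1\<close> and the compensator are charged to the indices 0 and
    1, whose Poisson weights alone need not be integrable near 0.\<close>
  define t where "t k z = exp (- \<beta> * z) * (\<beta> * z)^k / fact k +
    (if k = 0 then - 1 + \<beta> * z * indicator {0<..<1} z
     else if k = 1 then - \<beta> * z * indicator {0<..<1} z else 0)" for k :: nat and z :: real
  define \<Phi> where "\<Phi> s z = exp (- (\<beta> * (1 - s)) * z) - 1 + (\<beta> * (1 - s)) * z * indicator {0<..<1} z" for s z :: real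
  have [measurable]: "t k \<in> borel_measurable borel" "\<Phi> s \<in> borel_measurable borel" for k s
    unfolding t_def[abs_def] \<Phi>_def[abs_def] by measurable
  have t_sums: "(\<lambda>k. t k z * s^k) sums \<Phi> s z" for s z
  proof -
    have "(\<lambda>k. exp (- \<beta> * z) * ((\<beta> * z * s)^k /\<^sub>R fact k)) sums (exp (- \<beta> * z) * exp (\<beta> * z * s))"
      by (intro sums_mult exp_converges)
    moreover have "(\<lambda>k. (if k = 0 then - 1 + \<beta> * z * indicator {0<..<1} z
      else if k = 1 then - \<beta> * z * indicator {0<..<1} z else 0) * s^k)
      sums (\<Sum>k\<in>{0,1}. (if k = 0 then - 1 + \<beta> * z * indicator {0<..<1} z
      else if k = 1 then - \<beta> * z * indicator {0<..<1} z else 0) * s^k)" (is "?f sums _")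
      by (rule sums_finite) auto
    ultimately have "(\<lambda>k. exp (- \<beta> * z) * ((\<beta> * z * s)^k /\<^sub>R fact k) + ?f k) sums
       (exp (- \<beta> * z) * exp (\<beta> * z * s) + (\<Sum>k\<in>{0,1}. ?f k))"
      by (rule sums_add)
    moreover have "exp (- \<beta> * z) * exp (\<beta> * z * s) + (\<Sum>k\<in>{0,1}. ?f k) = \<Phi> s z"
      unfolding \<Phi>_def by (simp add: algebra_simps mult_exp_exp)
    moreover have "exp (- \<beta> * z) * ((\<beta> * z * s)^k /\<^sub>R fact k) + ?f k = t k z * s^k" for k
      unfolding t_def by (simp add: power_mult_distrib divide_inverse algebra_simps)
    ultimately show ?thesis by simp
  qed
  have t0: "\<bar>t 0 z\<bar> \<le> (\<beta>^2 + 1) * min 1 (z^2)" if "0 < z" for z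
    using laplace_integrand_bound[OF b that] by (simp add: t_def algebra_simps)
  have t1: "\<bar>t 1 z\<bar> \<le> (\<beta>^2 + 1) * min 1 (z^2)" if z: "0 < z" for z
  proof (rule le_mult_min_one[OF _ _ z])
    have "0 \<le> \<beta> * z" using b z by simp
    note e = exp_bounds[OF this]
    show "\<bar>t 1 z\<bar> \<le> (\<beta>^2 + 1) * z^2" if "z < 1"
    proof -
      have "\<bar>t 1 z\<bar> = \<beta> * z * (1 - exp (- (\<beta> * z)))"
        using e z that unfolding t_def by (simp add: algebra_simps)
      also have "\<dots> \<le> (\<beta> * z)^2" by (rule e)
      also have "\<dots> \<le> (\<beta>^2 + 1) * z^2" by (simp add: power_mult_distrib algebra_simps)
      finally show ?thesis .
    qed
    show "\<bar>t 1 z\<bar> \<le> \<beta>^2 + 1" if "1 \<le> z"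
    proof -
      have "\<bar>t 1 z\<bar> = \<beta> * z * exp (- (\<beta> * z))"
        using e z that unfolding t_def by (simp add: algebra_simps)
      also have "\<dots> \<le> 1" by (rule e)
      finally show ?thesis by (smt (verit) zero_le_power2)
    qed
  qed
  have t2: "0 \<le> t k z" if "2 \<le> k" "0 < z" for k z
    using that b unfolding t_def by simp
  have t01: "t 0 z + t 1 z = - (1 - exp (- (\<beta> * z)) * (1 + \<beta> * z))" for z
    unfolding t_def by (simp add: algebra_simps)
  \<comment> \<open>At \<open>s = 1\<close> the whole series vanishes, so its part from index 2 on
    is \<open>- (t 0 z + t 1 z)\<close>, a Poisson tail probability. A smaller \<open>s\<close> only
    decreases the nonnegative terms, which gives one majorant for all partial sums.\<close>
  have psum: "(\<Sum>k\<in>{2..<n}. t k z * s^k) \<le> (\<beta>^2 + 1) * min 1 (z^2)" "0 \<le> (\<Sum>k\<in>{2..<n}. t k z * s^k)"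
    if z: "0 < z" and s: "0 \<le> s" "s \<le> 1" for n z s
  proof -
    show "0 \<le> (\<Sum>k\<in>{2..<n}. t k z * s^k)" using t2 z s by (intro sum_nonneg) auto
    have "(\<Sum>k\<in>{2..<n}. t k z * s^k) \<le> (\<Sum>k\<in>{2..<n}. t k z * 1^k)"
      using t2 z s by (intro sum_mono mult_left_mono power_mono) auto
    also have "\<dots> \<le> 1 - exp (- (\<beta> * z)) * (1 + \<beta> * z)"
    proof (cases "2 \<le> n")
      case True
      have "summable (\<lambda>k. t k z * 1^k)" using t_sums by (rule sums_summable)
      then have "(\<Sum>k\<in>{..<n}. t k z * 1^k) \<le> (\<Sum>k. t k z * 1^k)"
        by (rule sum_le_suminf) (use t2 z True in auto)
      also have "\<dots> = \<Phi> 1 z" using t_sums by (rule sums_unique[symmetric])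
      also have "\<Phi> 1 z = 0" by (simp add: \<Phi>_def)
      finally have "(\<Sum>k\<in>{..<n}. t k z * 1^k) \<le> 0" .
      moreover have "{..<n} = {0,1} \<union> {2..<n}" using True by auto
      ultimately have "t 0 z + t 1 z + (\<Sum>k\<in>{2..<n}. t k z * 1^k) \<le> 0"
        by (simp add: sum.union_disjoint)
      then show ?thesis using t01[of z] by simp
    next
      case False
      then show ?thesis using exp_bounds(3)[of "\<beta> * z"] b z by simp
    qed
    also have "\<dots> \<le> min 1 ((\<beta> * z)^2)" using exp_bounds(4)[of "\<beta> * z"] b z by simp
    also have "\<dots> \<le> (\<beta>^2 + 1) * min 1 (z^2)"
      by (rule le_mult_min_one[OF _ _ z]) (auto simp: power_mult_distrib algebra_simps min_le_iff_disj)
    finally show "(\<Sum>k\<in>{2..<n}. t k z * s^k) \<le> (\<beta>^2 + 1) * min 1 (z^2)" .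
  qed
  have tk: "\<bar>t k z\<bar> \<le> (\<beta>^2 + 1) * min 1 (z^2)" if z: "0 < z" for k z
  proof (cases "2 \<le> k")
    case True
    have "t k z * 1^k \<le> (\<Sum>k\<in>{2..<Suc k}. t k z * 1^k)"
      using True by (intro member_le_sum) (use t2 z in auto)
    then show ?thesis using psum(1)[OF z, of 1 "Suc k"] t2[OF True z] by simp
  next
    case False
    then have "k = 0 \<or> k = 1" by auto
    then show ?thesis using t0[OF z] t1[OF z] by auto
  qed
  have it: "set_integrable \<nu> {0<..} (t k)" for k
    by (rule levy_integrable[OF nu _ tk]) auto
  define a where "a k = \<gamma> * (if k = 0 then \<beta> else if k = 1 then - \<beta> else 0)
    + \<sigma>^2 / 2 * (if k = 0 then \<beta>^2 else if k = 1 then - 2 * \<beta>^2 else if k = 2 then \<beta>^2 else 0)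
    + (LINT z:{0<..}|\<nu>. t k z)" for k
  show ?thesis
  proof (rule that)
    fix k :: nat assume k: "2 \<le> k"
    have "0 \<le> (LINT z:{0<..}|\<nu>. t k z)"
      using t2[OF k] unfolding set_lebesgue_integral_def
      by (intro Bochner_Integration.integral_nonneg) (auto simp: indicator_def)
    then show "0 \<le> a k" using k unfolding a_def by simp
  next
    fix s :: real assume s: "0 \<le> s" "s \<le> 1"
    have "(\<lambda>n. LINT z:{0<..}|\<nu>. (\<Sum>k<n. t k z * s^k)) \<longlonglongrightarrow> (LINT z:{0<..}|\<nu>. \<Phi> s z)"
      unfolding set_lebesgue_integral_def
    proof (rule integral_dominated_convergence)
      \<comment> \<open>The factor 3 counts index 0, index 1 and the part from index 2 on.\<close>
      show "integrable \<nu> (\<lambda>z. indicator {0<..} z *\<^sub>R (3 * (\<beta>^2 + 1) * min 1 (z^2)))"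
        unfolding set_integrable_def[symmetric]
        by (rule levy_integrable[OF nu, of _ "3 * (\<beta>^2 + 1)"]) (auto simp: abs_mult)
      show "AE z in \<nu>. (\<lambda>n. indicator {0<..} z *\<^sub>R (\<Sum>k<n. t k z * s^k)) \<longlonglongrightarrow> indicator {0<..} z *\<^sub>R \<Phi> s z"
        using t_sums[of _ s] unfolding sums_def by (intro AE_I2 tendsto_scaleR tendsto_const) auto
      show "AE z in \<nu>. norm (indicator {0<..} z *\<^sub>R (\<Sum>k<n. t k z * s^k))
         \<le> indicator {0<..} z *\<^sub>R (3 * (\<beta>^2 + 1) * min 1 (z^2))" for n
      proof (rule AE_I2)
        fix z
        show "norm (indicator {0<..} z *\<^sub>R (\<Sum>k<n. t k z * s^k))
         \<le> indicator {0<..} z *\<^sub>R (3 * (\<beta>^2 + 1) * min 1 (z^2))"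
        proof (cases "0 < z")
          case z: True
          have u: "{..<n} = ({0,1} \<inter> {..<n}) \<union> {2..<n}" by auto
          have "(\<Sum>k<n. t k z * s^k) = (\<Sum>k\<in>({0,1} \<inter> {..<n}) \<union> {2..<n}. t k z * s^k)"
            using u by (rule arg_cong)
          also have "\<dots> = (\<Sum>k\<in>{0,1} \<inter> {..<n}. t k z * s^k) + (\<Sum>k\<in>{2..<n}. t k z * s^k)"
            by (rule sum.union_disjoint) auto
          finally have "(\<Sum>k<n. t k z * s^k) = (\<Sum>k\<in>{0,1} \<inter> {..<n}. t k z * s^k) + (\<Sum>k\<in>{2..<n}. t k z * s^k)" .
          moreover have "\<bar>\<Sum>k\<in>{0,1} \<inter> {..<n}. t k z * s^k\<bar> \<le> (\<Sum>k\<in>{0,1} \<inter> {..<n}. \<bar>t k z * s^k\<bar>)"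
            by (rule sum_abs)
          moreover have "(\<Sum>k\<in>{0,1} \<inter> {..<n}. \<bar>t k z * s^k\<bar>) \<le> (\<Sum>k\<in>{0,1}. \<bar>t k z * s^k\<bar>)"
            by (intro sum_mono2) auto
          moreover have "(\<Sum>k\<in>{0,1}. \<bar>t k z * s^k\<bar>) \<le> \<bar>t 0 z\<bar> + \<bar>t 1 z\<bar>"
            using s by (auto simp: abs_mult mult_left_le)
          ultimately have "\<bar>\<Sum>k<n. t k z * s^k\<bar> \<le> 3 * ((\<beta>^2 + 1) * min 1 (z^2))"
            using psum[OF z s, of n] t0[OF z] t1[OF z] by linarith
          then show ?thesis using z by (simp add: algebra_simps)
        qed auto
      qed
    qed measurable
    also have "(\<lambda>n. LINT z:{0<..}|\<nu>. (\<Sum>k<n. t k z * s^k)) = (\<lambda>n. \<Sum>k<n. (LINT z:{0<..}|\<nu>. t k z) * s^k)"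
    proof
      fix n
      have "set_integrable \<nu> {0<..} (\<lambda>z. t k z * s^k)" for k using it[of k] by simp
      then have "(LINT z:{0<..}|\<nu>. (\<Sum>k<n. t k z * s^k)) = (\<Sum>k<n. LINT z:{0<..}|\<nu>. t k z * s^k)"
        unfolding set_integrable_def set_lebesgue_integral_def
        by (subst Bochner_Integration.integral_sum[symmetric]) (auto simp: sum_distrib_left)
      then show "(LINT z:{0<..}|\<nu>. (\<Sum>k<n. t k z * s^k)) = (\<Sum>k<n. (LINT z:{0<..}|\<nu>. t k z) * s^k)" by simp
    qed
    finally have 1: "(\<lambda>k. (LINT z:{0<..}|\<nu>. t k z) * s^k) sums (LINT z:{0<..}|\<nu>. \<Phi> s z)" by (simp add: sums_def)
    have 2: "(\<lambda>k. (if k = 0 then \<beta> else if k = 1 then - \<beta> else 0) * s^k) sums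
       (\<Sum>k\<in>{0,1}. (if k = 0 then \<beta> else if k = 1 then - \<beta> else 0) * s^k)"
      by (rule sums_finite) auto
    have 3: "(\<lambda>k. (if k = 0 then \<beta>^2 else if k = 1 then - 2 * \<beta>^2 else if k = 2 then \<beta>^2 else 0) * s^k) sums
       (\<Sum>k\<in>{0,1,2}. (if k = 0 then \<beta>^2 else if k = 1 then - 2 * \<beta>^2 else if k = 2 then \<beta>^2 else 0) * s^k)"
      by (rule sums_finite) auto
    have "(\<lambda>k. a k * s^k) sums (\<gamma> * (\<Sum>k\<in>{0,1}. (if k = 0 then \<beta> else if k = 1 then - \<beta> else 0) * s^k)
      + \<sigma>^2 / 2 * (\<Sum>k\<in>{0,1,2}. (if k = 0 then \<beta>^2 else if k = 1 then - 2 * \<beta>^2 else if k = 2 then \<beta>^2 else 0) * s^k)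
      + (LINT z:{0<..}|\<nu>. \<Phi> s z))"
      using sums_add[OF sums_add[OF sums_mult[OF 2, of \<gamma>] sums_mult[OF 3, of "\<sigma>^2/2"]] 1]
      unfolding a_def by (simp only: distrib_right mult.assoc)
    moreover have "\<gamma> * (\<Sum>k\<in>{0,1}. (if k = 0 then \<beta> else if k = 1 then - \<beta> else 0) * s^k)
      + \<sigma>^2 / 2 * (\<Sum>k\<in>{0,1,2}. (if k = 0 then \<beta>^2 else if k = 1 then - 2 * \<beta>^2 else if k = 2 then \<beta>^2 else 0) * s^k)
      + (LINT z:{0<..}|\<nu>. \<Phi> s z) = laplace_exponent \<gamma> \<sigma> \<nu> (\<beta> * (1 - s))"
      unfolding laplace_exponent_def \<Phi>_def by (simp add: power2_eq_square field_simps)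
    ultimately show "(\<lambda>k. a k * s^k) sums laplace_exponent \<gamma> \<sigma> \<nu> (\<beta> * (1 - s))" by simp
  qed
qed

text \<open>Behind this is the limit of
  \<open>laplace_exponent \<gamma> \<sigma> \<nu> n / n\<close>, which is the drift for paths of
  bounded variation and infinity otherwise. The conditional hypothesis on \<open>K\<close> covers
  both cases, being vacuous in the second.\<close>

lemma laplace_exponent_superlinear:
  assumes nu: "levy_measure \<nu>" and K: "bounded_variation_case \<sigma> \<nu> \<Longrightarrow> K < drift \<gamma> \<nu>"
  shows "\<forall>\<^sub>F n in sequentially. K * real n \<le> laplace_exponent \<gamma> \<sigma> \<nu> (real n)"
proof -
  have sets[measurable_cong]: "sets \<nu> = sets borel" using nu by (simp add: levy_measure_def)
  define m where "m = (LINT z:{0<..}|\<nu>. min 1 (z^2))"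
  have im: "set_integrable \<nu> {0<..} (\<lambda>z. min 1 (z^2))"
    by (rule levy_integrable[OF nu, of _ 1]) auto
  \<comment> \<open>For \<open>n > 0\<close> this is the contribution of jumps below 1 divided by
    \<open>n\<close>. It tends to \<open>z\<close> on \<open>(0, 1)\<close>, so that
    \<open>I n\<close> eventually exceeds any number below the integral of the small jumps. Jumps of
    size at least 1 cost at most \<open>m\<close> in total.\<close>
  define H where "H n z = indicator {0<..<1} z * (z - (1 - exp (- real n * z)) / real n)" for n :: nat and z :: real
  have [measurable]: "H n \<in> borel_measurable borel" for n
    unfolding H_def[abs_def] by measurable
  define I where "I n = (LINT z:{0<..}|\<nu>. H n z)" for n
  have Hpos: "0 \<le> H n z" for n z
    using exp_bounds(1)[of "real n * z"] unfolding H_def by (cases "n = 0") (auto simp: indicator_def field_simps)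
  have Hbd: "\<bar>H n z\<bar> \<le> (real n ^ 2 + 1) * min 1 (z^2)" if n: "0 < n" and z: "0 < z" for n z
  proof -
    have n1: "1 \<le> real n" using n by simp
    have "\<bar>H n z\<bar> \<le> \<bar>exp (- real n * z) - 1 + real n * z * indicator {0<..<1} z\<bar>"
    proof (cases "z < 1")
      case True
      then have "real n * H n z = exp (- real n * z) - 1 + real n * z * indicator {0<..<1} z"
        using z n unfolding H_def by (simp add: field_simps)
      moreover have "1 * H n z \<le> real n * H n z" using n1 Hpos by (intro mult_right_mono) auto
      ultimately show ?thesis using Hpos[of n z] by simp
    qed (simp add: H_def)
    also have "\<dots> \<le> (real n ^ 2 + 1) * min 1 (z^2)" using laplace_integrand_bound[of "real n" z] z by simp
    finally show ?thesis .
  qed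
  have iH: "set_integrable \<nu> {0<..} (H n)" if n: "0 < n" for n
    by (rule levy_integrable[OF nu _ Hbd]) (use n in auto)
  have I0: "0 \<le> I n" for n
    using Hpos unfolding I_def set_lebesgue_integral_def by (intro Bochner_Integration.integral_nonneg) (auto simp: indicator_def)
  have lower: "(\<gamma> + \<sigma>^2 * real n / 2 + I n - m / real n) * real n \<le> laplace_exponent \<gamma> \<sigma> \<nu> (real n)"
    if n: "0 < n" for n
  proof -
    have "real n * I n - m = (LINT z:{0<..}|\<nu>. real n * H n z - min 1 (z^2))"
      using iH[OF n] im unfolding I_def m_def by simp
    also have "\<dots> \<le> (LINT z:{0<..}|\<nu>. exp (- real n * z) - 1 + real n * z * indicator {0<..<1} z)"
    proof (rule set_integral_mono)
      show "set_integrable \<nu> {0<..} (\<lambda>z. exp (- real n * z) - 1 + real n * z * indicator {0<..<1} z)"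
        by (rule levy_integrable[OF nu _ laplace_integrand_bound]) auto
      show "set_integrable \<nu> {0<..} (\<lambda>z. real n * H n z - min 1 (z^2))"
        using iH[OF n] im by (intro set_integral_diff) auto
      fix z :: real assume "z \<in> {0<..}"
      then have z: "0 < z" by simp
      show "real n * H n z - min 1 (z^2) \<le> exp (- real n * z) - 1 + real n * z * indicator {0<..<1} z"
      proof (cases "z < 1")
        case True
        have "real n * H n z = exp (- real n * z) - 1 + real n * z * indicator {0<..<1} z"
          using z n True unfolding H_def by (simp add: field_simps)
        then show ?thesis by simp
      next
        case False
        then show ?thesis by (simp add: H_def min_absorb1)
      qed
    qed
    finally show ?thesis using n unfolding laplace_exponent_def
      by (simp add: algebra_simps power2_eq_square)
  qed
  have m_lim: "(\<lambda>n. m / real n) \<longlonglongrightarrow> 0" by (rule lim_const_over_n)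
  show ?thesis
  proof (cases "\<sigma> = 0")
    case False
    have "filterlim (\<lambda>n. (\<sigma>^2/2) * real n) at_top sequentially"
      using False by (intro filterlim_tendsto_pos_mult_at_top[OF tendsto_const] filterlim_real_sequentially) auto
    then have "\<forall>\<^sub>F n in sequentially. K - \<gamma> + 1 \<le> (\<sigma>^2/2) * real n"
      unfolding filterlim_at_top by blast
    moreover have "\<forall>\<^sub>F n in sequentially. m / real n < 1"
      using m_lim by (rule order_tendstoD) simp
    moreover have "\<forall>\<^sub>F n in sequentially. 0 < n" by (rule eventually_gt_at_top)
    ultimately show ?thesis
    proof eventually_elim
      case (elim n)
      have "\<sigma>^2/2 * real n = \<sigma>^2 * real n / 2" by simp
      then have "K \<le> \<gamma> + \<sigma>^2 * real n / 2 + I n - m / real n" using elim I0[of n] by linarith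
      then have "K * real n \<le> (\<gamma> + \<sigma>^2 * real n / 2 + I n - m / real n) * real n"
        by (intro mult_right_mono) auto
      then show ?case using lower[OF elim(3)] by simp
    qed
  next
    case True
    define A where "A = (\<integral>\<^sup>+ z\<in>{0<..<1}. ennreal z \<partial>\<nu>)"
    \<comment> \<open>A number strictly below the integral \<open>A\<close> of the small jumps that
      still leaves room above \<open>K - \<gamma>\<close>. A negative \<open>K'\<close> is kept
      apart because \<open>ennreal\<close> would send it to 0.\<close>
    have "\<exists>K'. K < \<gamma> + K' \<and> (K' < 0 \<or> ennreal K' < A)"
    proof (cases "A < \<infinity>")
      case fin: True
      then have "bounded_variation_case \<sigma> \<nu>" using True by (simp add: bounded_variation_case_def A_def)
      then have Kd: "K < drift \<gamma> \<nu>" by (rule K)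
      have "(LINT z:{0<..<1}|\<nu>. z) = enn2real A"
        unfolding set_lebesgue_integral_def A_def
        by (subst integral_eq_nn_integral)
          (auto intro!: AE_I2 arg_cong[where f=enn2real] nn_integral_cong simp: indicator_def)
      then have "K < \<gamma> + enn2real A" using Kd by (simp add: drift_def)
      then obtain K' where "K - \<gamma> < K'" "K' < enn2real A" using dense[of "K - \<gamma>" "enn2real A"] by auto
      moreover have "ennreal K' < A" if "0 \<le> K'"
        using \<open>K' < enn2real A\<close> fin that by (metis ennreal_enn2real ennreal_less_iff infinity_ennreal_def)
      ultimately show ?thesis by (intro exI[of _ K']) force
    next
      case False
      then show ?thesis by (intro exI[of _ "K - \<gamma> + 1"]) (simp add: less_top[symmetric] not_less top_unique)
    qed
    then obtain K' where K': "K < \<gamma> + K'" "K' < 0 \<or> ennreal K' < A" by blast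
    have evI: "\<forall>\<^sub>F n in sequentially. K' \<le> I n"
    proof (cases "K' < 0")
      case True then show ?thesis using I0 by (intro always_eventually) (smt (verit))
    next
      case False
      \<comment> \<open>Only a lower bound on the limit is wanted, so Fatou's lemma works whether or
        not \<open>A\<close> is finite.\<close>
      have "A = (\<integral>\<^sup>+ z. liminf (\<lambda>n. ennreal (H n z)) \<partial>\<nu>)"
        unfolding A_def
      proof (rule nn_integral_cong)
        fix z :: real
        have "(\<lambda>n. H n z) \<longlonglongrightarrow> indicator {0<..<1} z * (z - 0)"
        proof -
          have "(\<lambda>n. (1 - exp (- real n * z)) / real n) \<longlonglongrightarrow> 0" if "0 < z"
          proof (rule tendsto_sandwich[OF _ _ tendsto_const lim_const_over_n[of 1]])
            show "\<forall>\<^sub>F n in sequentially. 0 \<le> (1 - exp (- real n * z)) / real n"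
              using that by (intro always_eventually) auto
            show "\<forall>\<^sub>F n in sequentially. (1 - exp (- real n * z)) / real n \<le> 1 / real n"
              by (intro always_eventually allI divide_right_mono) auto
          qed
          then have "(\<lambda>n. indicator {0<..<1} z * (z - (1 - exp (- real n * z)) / real n))
              \<longlonglongrightarrow> indicator {0<..<1} z * (z - 0)" if "z \<in> {0<..<1}"
            using that by (intro tendsto_intros) auto
          then show ?thesis unfolding H_def by (cases "z \<in> {0<..<1}") auto
        qed
        then have "(\<lambda>n. ennreal (H n z)) \<longlonglongrightarrow> ennreal (indicator {0<..<1} z * z)" by (auto intro: tendsto_ennrealI)
        then show "ennreal z * indicator {0<..<1} z = liminf (\<lambda>n. ennreal (H n z))"
          by (subst lim_imp_Liminf) (auto simp: indicator_def)
      qed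
      also have "\<dots> \<le> liminf (\<lambda>n. \<integral>\<^sup>+ z. ennreal (H n z) \<partial>\<nu>)"
        by (rule nn_integral_liminf) measurable
      finally have "ennreal K' < liminf (\<lambda>n. \<integral>\<^sup>+ z. ennreal (H n z) \<partial>\<nu>)" using K' False by auto
      then have "\<forall>\<^sub>F n in sequentially. ennreal K' < (\<integral>\<^sup>+ z. ennreal (H n z) \<partial>\<nu>)"
        by (rule less_LiminfD)
      moreover have "\<forall>\<^sub>F n in sequentially. 0 < n" by (rule eventually_gt_at_top)
      ultimately show ?thesis
      proof eventually_elim
        case (elim n)
        have "(\<integral>\<^sup>+ z. ennreal (H n z) \<partial>\<nu>) = (\<integral>\<^sup>+ z. ennreal (indicator {0<..} z *\<^sub>R H n z) \<partial>\<nu>)"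
          by (intro nn_integral_cong) (auto simp: H_def indicator_def)
        also have "\<dots> = ennreal (I n)"
          unfolding I_def set_lebesgue_integral_def
          by (intro nn_integral_eq_integral AE_I2) (use iH[OF elim(2)] Hpos in \<open>auto simp: set_integrable_def indicator_def\<close>)
        finally show ?case using elim(1) False by (simp add: ennreal_less_iff)
      qed
    qed
    moreover have "\<forall>\<^sub>F n in sequentially. m / real n < \<gamma> + K' - K"
      using m_lim by (rule order_tendstoD) (use K' in simp)
    moreover have "\<forall>\<^sub>F n in sequentially. 0 < n" by (rule eventually_gt_at_top)
    ultimately show ?thesis
    proof eventually_elim
      case (elim n)
      have "0 \<le> \<sigma>^2 * real n / 2" by simp
      then have "K \<le> \<gamma> + \<sigma>^2 * real n / 2 + I n - m / real n" using elim by linarith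
      then have "K * real n \<le> (\<gamma> + \<sigma>^2 * real n / 2 + I n - m / real n) * real n"
        by (intro mult_right_mono) auto
      then show ?case using lower[OF elim(3)] by simp
    qed
  qed
qed

section \<open>Erlang densities and the Post--Widder formula\<close>

text \<open>Zeros of a nontrivial power series are isolated, so vanishing on a one-sided interval is
  enough. The constant coefficient is a separate hypothesis because isolation is applied at 0, which
  must be a zero for that.\<close>

lemma power_series_coeffs_eq_0:
  fixes c :: "nat \<Rightarrow> real"
  assumes r: "0 < r" and z: "\<And>s. 0 < s \<Longrightarrow> s < r \<Longrightarrow> (\<lambda>n. c n * s^n) sums 0" and c0: "c 0 = 0"
  shows "c m = 0"
proof (rule ccontr)
  assume m: "c m \<noteq> 0"
  then have "m > 0" using c0 by (cases m) auto
  have sm: "(\<lambda>n. c n * (x - 0) ^ n) sums (\<Sum>n. c n * x ^ n)" if "norm (x - 0) < r" for x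
  proof -
    define s where "s = (\<bar>x\<bar> + r) / 2"
    have "0 < s" "s < r" "\<bar>x\<bar> < s" using that r by (auto simp: s_def)
    then have "summable (\<lambda>n. c n * x ^ n)"
      using powser_inside[OF sums_summable[OF z[of s]], of x] by auto
    then show ?thesis by (simp add: summable_sums)
  qed
  have f0: "(\<Sum>n. c n * 0 ^ n) = 0" using c0 by simp
  obtain s where s: "0 < s" "\<And>x. x \<in> cball 0 s - {0} \<Longrightarrow> (\<Sum>n. c n * x ^ n) \<noteq> 0"
    using powser_0_nonzero[OF r sm f0 m \<open>m > 0\<close>] by blast
  define x where "x = min s (r/2)"
  have "x \<in> cball 0 s - {0}" "0 < x" "x < r" using s(1) r by (auto simp: x_def)
  then show False using s(2)[of x] z[of x] sums_unique[of "\<lambda>n. c n * x^n" 0] by auto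
qed

section \<open>Erlang densities as smoothing kernels\<close>

lemma erlang_density_alt:
  "erlang_density n \<beta> y = indicator {0..} y * (\<beta> * exp (- \<beta> * y) * (\<beta> * y)^n / fact n)"
  by (auto simp: erlang_density_def indicator_def power_mult_distrib mult_ac)

lemma power_div_fact_le_exp:
  fixes u :: real
  assumes "0 \<le> u"
  shows "u^n / fact n \<le> exp u"
proof -
  have s: "(\<lambda>k. u^k /\<^sub>R fact k) sums exp u" by (rule exp_converges)
  have "(\<Sum>k\<in>{n}. u^k /\<^sub>R fact k) \<le> (\<Sum>k. u^k /\<^sub>R fact k)"
    using assms by (intro sum_le_suminf sums_summable[OF s]) auto
  then show ?thesis using sums_unique[OF s] by (simp add: divide_inverse mult.commute)
qed

text \<open>A fraction \<open>s\<close> of the rate pays for the polynomial factor, through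
  \<open>(s * \<beta> * y)^n / fact n \<le> exp (s * \<beta> * y)\<close>; the choice of
  \<open>s\<close> leaves exactly the rate \<open>\<beta>0\<close>.\<close>

lemma erlang_density_exp_bound:
  assumes "0 \<le> \<beta>0" "\<beta>0 < \<beta>"
  obtains M where "0 \<le> M" "\<And>y. erlang_density n \<beta> y \<le> M * (indicator {0..} y * exp (- \<beta>0 * y))"
proof (rule that)
  define s where "s = 1 - \<beta>0 / \<beta>"
  have s: "0 < s" "s * \<beta> = \<beta> - \<beta>0" "0 < \<beta>" using assms by (auto simp: s_def field_simps)
  show "0 \<le> \<beta> / s^n" using s by simp
  fix y :: real
  show "erlang_density n \<beta> y \<le> \<beta> / s^n * (indicator {0..} y * exp (- \<beta>0 * y))"
  proof (cases "0 \<le> y")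
    case True
    have "(s * \<beta> * y)^n / fact n \<le> exp (s * \<beta> * y)"
      using s(1,3) True by (intro power_div_fact_le_exp mult_nonneg_nonneg) auto
    then have "(\<beta> * y)^n / fact n \<le> exp (s * \<beta> * y) / s^n"
      using s by (simp add: power_mult_distrib field_simps)
    then have "\<beta> * exp (- \<beta> * y) * ((\<beta> * y)^n / fact n) \<le> \<beta> * exp (- \<beta> * y) * (exp (s * \<beta> * y) / s^n)"
      using s by (intro mult_left_mono) auto
    also have "\<dots> = \<beta> / s^n * (exp (- \<beta> * y) * exp (s * \<beta> * y))" by simp
    also have "exp (- \<beta> * y) * exp (s * \<beta> * y) = exp (- \<beta>0 * y)"
      unfolding mult_exp_exp s(2) by (simp add: algebra_simps)
    finally show ?thesis using True by (simp add: erlang_density_alt)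
  qed (simp add: erlang_density_def)
qed

lemma integrable_erlang_density_mult:
  fixes W :: "real \<Rightarrow> real"
  assumes [measurable]: "W \<in> borel_measurable borel" and b: "0 \<le> \<beta>0" "\<beta>0 < \<beta>"
    and W: "set_integrable lborel {0..} (\<lambda>y. exp (- \<beta>0 * y) * W y)"
  shows "integrable lborel (\<lambda>y. erlang_density n \<beta> y * W y)"
proof -
  obtain M where M: "0 \<le> M" "\<And>y. erlang_density n \<beta> y \<le> M * (indicator {0..} y * exp (- \<beta>0 * y))"
    using erlang_density_exp_bound[OF b] by blast
  show ?thesis
  proof (rule Bochner_Integration.integrable_bound[OF integrable_mult_right[of M, OF W[unfolded set_integrable_def]]])
    show "AE y in lborel. norm (erlang_density n \<beta> y * W y) \<le> norm (M * indicator {0..} y *\<^sub>R (exp (- \<beta>0 * y) * W y))"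
    proof (rule AE_I2)
      fix y :: real
      have "erlang_density n \<beta> y * \<bar>W y\<bar> \<le> M * (indicator {0..} y * exp (- \<beta>0 * y)) * \<bar>W y\<bar>"
        by (intro mult_right_mono M) auto
      then show "norm (erlang_density n \<beta> y * W y) \<le> norm (M * indicator {0..} y *\<^sub>R (exp (- \<beta>0 * y) * W y))"
        using b M(1) by (simp add: abs_mult mult_ac)
    qed
  qed measurable
qed

text \<open>For fixed \<open>y \<ge> 0\<close> the densities weighted by \<open>s^n\<close> sum to
  \<open>\<beta> * exp (- \<beta> * (1 - s) * y)\<close>, by the exponential series. The sign of
  \<open>W\<close> is not known at this stage, so the exchange of sum and integral rests on a
  majorant with \<open>\<bar>W y\<bar>\<close>.\<close>

lemma erlang_generating_function:
  fixes W :: "real \<Rightarrow> real"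
  assumes [measurable]: "W \<in> borel_measurable borel" and b: "0 \<le> \<beta>0" "\<beta>0 < \<beta>"
    and W: "set_integrable lborel {0..} (\<lambda>y. exp (- \<beta>0 * y) * W y)"
    and s: "0 \<le> s" "\<beta>0 \<le> \<beta> * (1 - s)"
  shows "(\<lambda>n. (LBINT y. erlang_density n \<beta> y * W y) * s^n) sums
     (\<beta> * (LBINT y:{0..}. exp (- (\<beta> * (1 - s)) * y) * W y))"
    (is "_ sums ?R")
proof -
  have expW: "(\<lambda>n. erlang_density n \<beta> y * W y * s^n) sums
     (indicator {0..} y * (\<beta> * exp (- (\<beta> * (1 - s)) * y) * W y))" for y
  proof -
    have "(\<lambda>n. (\<beta> * exp (- \<beta> * y) * W y * indicator {0..} y) * ((\<beta> * y * s)^n /\<^sub>R fact n)) sums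
      ((\<beta> * exp (- \<beta> * y) * W y * indicator {0..} y) * exp (\<beta> * y * s))"
      by (intro sums_mult exp_converges)
    moreover have "exp (- \<beta> * y) * exp (\<beta> * y * s) = exp (- (\<beta> * (1 - s)) * y)"
      unfolding mult_exp_exp by (simp add: algebra_simps)
    then have "(\<beta> * exp (- \<beta> * y) * W y * indicator {0..} y) * exp (\<beta> * y * s)
      = indicator {0..} y * (\<beta> * exp (- (\<beta> * (1 - s)) * y) * W y)"
      by (simp add: mult_ac)
    moreover have "(\<beta> * exp (- \<beta> * y) * W y * indicator {0..} y) * ((\<beta> * y * s)^n /\<^sub>R fact n)
        = erlang_density n \<beta> y * W y * s^n" for n
      by (simp add: erlang_density_alt power_mult_distrib divide_inverse mult_ac)
    ultimately show ?thesis by (simp only:)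
  qed
  have abs_bound: "\<bar>\<Sum>k<n. erlang_density k \<beta> y * W y * s^k\<bar>
      \<le> \<beta> * (indicator {0..} y * (exp (- \<beta>0 * y) * \<bar>W y\<bar>))" for n y
  proof (cases "0 \<le> y")
    case True
    have "\<bar>\<Sum>k<n. erlang_density k \<beta> y * W y * s^k\<bar> = (\<Sum>k<n. \<beta> * exp (- \<beta> * y) * ((\<beta> * y * s)^k /\<^sub>R fact k)) * \<bar>W y\<bar>"
    proof -
      have "(\<Sum>k<n. erlang_density k \<beta> y * W y * s^k) = (\<Sum>k<n. \<beta> * exp (- \<beta> * y) * ((\<beta> * y * s)^k /\<^sub>R fact k)) * W y"
        unfolding sum_distrib_right
        using True by (intro sum.cong) (auto simp: erlang_density_alt power_mult_distrib divide_inverse mult_ac)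
      moreover have "0 \<le> (\<Sum>k<n. \<beta> * exp (- \<beta> * y) * ((\<beta> * y * s)^k /\<^sub>R fact k))"
        using b s True by (intro sum_nonneg) auto
      ultimately show ?thesis by (simp add: abs_mult)
    qed
    also have "\<dots> = \<beta> * exp (- \<beta> * y) * (\<Sum>k<n. (\<beta> * y * s)^k /\<^sub>R fact k) * \<bar>W y\<bar>"
      by (simp add: sum_distrib_left)
    also have "\<dots> \<le> \<beta> * exp (- \<beta> * y) * exp (\<beta> * y * s) * \<bar>W y\<bar>"
    proof (intro mult_right_mono mult_left_mono)
      show "(\<Sum>k<n. (\<beta> * y * s)^k /\<^sub>R fact k) \<le> exp (\<beta> * y * s)"
        unfolding exp_def using b s True
        by (intro sum_le_suminf sums_summable[OF exp_converges]) auto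
    qed (use b in auto)
    also have "\<dots> = \<beta> * exp (- (\<beta> * (1 - s)) * y) * \<bar>W y\<bar>"
    proof -
      have "exp (- \<beta> * y) * exp (\<beta> * y * s) = exp (- (\<beta> * (1 - s)) * y)"
        unfolding mult_exp_exp by (simp add: algebra_simps)
      then show ?thesis by simp
    qed
    also have "\<dots> \<le> \<beta> * exp (- \<beta>0 * y) * \<bar>W y\<bar>"
      using b s True by (intro mult_right_mono mult_left_mono) (auto intro: mult_right_mono)
    finally show ?thesis using True by simp
  qed (simp add: erlang_density_def)
  have "(\<lambda>n. LBINT y. (\<Sum>k<n. erlang_density k \<beta> y * W y * s^k)) \<longlonglongrightarrow>
     (LBINT y. indicator {0..} y * (\<beta> * exp (- (\<beta> * (1 - s)) * y) * W y))"
  proof (rule integral_dominated_convergence)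
    have "set_integrable lborel {0..} (\<lambda>y. \<bar>exp (- \<beta>0 * y) * W y\<bar>)" using W by (rule set_integrable_abs)
    then show "integrable lborel (\<lambda>y. \<beta> * (indicator {0..} y * (exp (- \<beta>0 * y) * \<bar>W y\<bar>)))"
      by (intro integrable_mult_right) (simp add: set_integrable_def abs_mult)
    show "AE y in lborel. norm (\<Sum>k<n. erlang_density k \<beta> y * W y * s^k)
      \<le> \<beta> * (indicator {0..} y * (exp (- \<beta>0 * y) * \<bar>W y\<bar>))" for n
      using abs_bound by (intro AE_I2) simp
    show "AE y in lborel. (\<lambda>n. \<Sum>k<n. erlang_density k \<beta> y * W y * s^k) \<longlonglongrightarrow>
      indicator {0..} y * (\<beta> * exp (- (\<beta> * (1 - s)) * y) * W y)"
      using expW by (intro AE_I2) (simp add: sums_def)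
  qed measurable
  moreover have "(LBINT y. (\<Sum>k<n. erlang_density k \<beta> y * W y * s^k)) = (\<Sum>k<n. (LBINT y. erlang_density k \<beta> y * W y) * s^k)" for n
    using integrable_erlang_density_mult[OF assms(1) b W]
    by (subst Bochner_Integration.integral_sum) auto
  moreover have "(LBINT y. indicator {0..} y * (\<beta> * exp (- (\<beta> * (1 - s)) * y) * W y)) = ?R"
    unfolding set_lebesgue_integral_def
    by (subst integral_mult_right_zero[symmetric]) (simp add: mult_ac)
  ultimately show ?thesis by (simp add: sums_def)
qed

text \<open>The function \<open>t * exp (1 - t)\<close> rises up to \<open>t = 1\<close> and falls
  afterwards. The sign condition places \<open>s\<close> between \<open>t\<close> and 1 and so
  treats both branches together.\<close>

lemma mult_exp_one_minus_mono:
  fixes t s :: real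
  assumes "0 < t" "0 < s" "(t - s) * (1 - s) \<le> 0"
  shows "t * exp (1 - t) \<le> s * exp (1 - s)"
proof -
  have "t / s \<le> exp (t / s - 1)" using exp_ge_add_one_self[of "t/s - 1"] by simp
  also have "\<dots> = exp ((t - s) * (1 - s) / s + (t - s))" using assms by (simp add: field_simps)
  also have "\<dots> \<le> exp (t - s)"
    using assms by (simp add: divide_nonpos_pos)
  finally have "t \<le> s * exp (t - s)" using assms by (simp add: field_simps)
  then have "t * exp (1 - t) \<le> s * exp (t - s) * exp (1 - t)" by (intro mult_right_mono) auto
  also have "\<dots> = s * exp (1 - s)" by (simp add: mult_exp_exp)
  finally show ?thesis .
qed

lemma mult_exp_one_minus_less_1:
  fixes t :: real
  assumes "t \<noteq> 1"
  shows "t * exp (1 - t) < 1"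
proof -
  have "1 + (t - 1) < exp (t - 1)"
  proof -
    have "1 + x < exp x" if "x \<noteq> 0" for x :: real
    proof (cases "1 + x/2 \<ge> 0")
      case True
      have "1 + x < (1 + x/2)^2" using that zero_less_power2[of x] by (simp add: power2_eq_square algebra_simps)
      also have "\<dots> \<le> exp (x/2)^2" using True by (intro power_mono exp_ge_add_one_self)
      also have "\<dots> = exp x" by (simp add: exp_double[symmetric])
      finally show ?thesis .
    next
      case False
      then have "1 + x < 0" by simp
      then show ?thesis using exp_gt_zero[of x] by linarith
    qed
    from this[of "t - 1"] show ?thesis using assms by simp
  qed
  then have "t < exp (t - 1)" by simp
  then have "t * exp (1 - t) < exp (t - 1) * exp (1 - t)" by (intro mult_strict_right_mono) auto
  then show ?thesis by (simp add: mult_exp_exp)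
qed

text \<open>Since \<open>n^n / fact n \<le> exp n\<close>, the density is at most
  \<open>n / x\<close> times the \<open>n\<close>-th power of \<open>t * exp (1 - t)\<close> with
  \<open>t = y / x\<close>. All but \<open>k\<close> of these factors give geometric decay in
  \<open>n\<close>; the \<open>k\<close> set aside give decay in \<open>y\<close> at the rate
  \<open>\<beta>0\<close> at which \<open>W\<close> is known to be integrable.\<close>

lemma erlang_density_tail:
  fixes x y :: real
  assumes x: "0 < x" and y: "0 \<le> y" and r: "y / x * exp (1 - y / x) \<le> r" and k: "2 * x * \<beta>0 \<le> real k" "k \<le> n"
  shows "erlang_density n (real n / x) y \<le> real n / x * (r^(n - k) * 2^k) * exp (- \<beta>0 * y)"
proof -
  define t where "t = y / x"
  have t: "0 \<le> t" using x y by (simp add: t_def)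
  have "erlang_density n (real n / x) y = real n / x * ((real n)^n / fact n * (t * exp (- t))^n)"
    using x y by (simp add: erlang_density_def t_def power_mult_distrib power_divide exp_of_nat_mult[symmetric] field_simps)
  also have "\<dots> \<le> real n / x * (exp (real n) * (t * exp (- t))^n)"
    using x t by (intro mult_left_mono mult_right_mono power_div_fact_le_exp) auto
  also have "exp (real n) * (t * exp (- t))^n = (t * exp (1 - t))^n"
    by (simp add: exp_diff exp_minus power_mult_distrib power_divide exp_of_nat_mult[symmetric] field_simps)
  also have "(t * exp (1 - t))^n = (t * exp (1 - t))^(n - k) * (t * exp (1 - t))^k"
    using k by (simp add: power_add[symmetric])
  also have "\<dots> \<le> r^(n - k) * (2^k * exp (- \<beta>0 * y))"
  proof (rule mult_mono)
    show "(t * exp (1 - t))^(n - k) \<le> r^(n - k)"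
      using r t unfolding t_def by (intro power_mono mult_nonneg_nonneg) auto
    \<comment> \<open>This leads to \<open>t * exp (1 - t) \<le> 2 * exp (- (t / 2))\<close>. Its
      \<open>k\<close>-th power decays at rate \<open>k / (2 * x)\<close> in \<open>y\<close>, which
      is at least \<open>\<beta>0\<close> by the choice of \<open>k\<close>.\<close>
    have "t / 2 \<le> exp (t / 2 - 1)" using exp_ge_add_one_self[of "t/2 - 1"] by simp
    then have "t * exp (1 - t) \<le> 2 * exp (t / 2 - 1) * exp (1 - t)" by (intro mult_right_mono) auto
    also have "\<dots> = 2 * exp (- (t / 2))" by (simp add: mult_exp_exp)
    finally have "(t * exp (1 - t))^k \<le> (2 * exp (- (t / 2)))^k" using t by (intro power_mono) auto
    also have "\<dots> = 2^k * exp (- (real k * t / 2))" by (simp add: power_mult_distrib exp_of_nat_mult[symmetric])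
    also have "\<dots> \<le> 2^k * exp (- \<beta>0 * y)"
    proof -
      have "2 * x * \<beta>0 * t \<le> real k * t" using k t by (intro mult_right_mono) auto
      then have "\<beta>0 * y \<le> real k * t / 2" using x by (simp add: t_def field_simps)
      then show ?thesis by simp
    qed
    finally show "(t * exp (1 - t))^k \<le> 2^k * exp (- \<beta>0 * y)" .
    have "0 \<le> t * exp (1 - t)" using t by (intro mult_nonneg_nonneg) auto
    then have "0 \<le> r" using r unfolding t_def by linarith
    then show "0 \<le> r^(n-k)" by simp
    show "0 \<le> (t * exp (1 - t))^k" using t by (intro zero_le_power mult_nonneg_nonneg) auto
  qed
  finally have "erlang_density n (real n / x) y \<le> real n / x * (r^(n - k) * (2^k * exp (- \<beta>0 * y)))"
    using x by (simp add: mult_left_mono divide_right_mono)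
  then show ?thesis by (simp only: mult.assoc)
qed

lemma erlang_density_integral:
  assumes "0 < \<beta>"
  shows "integrable lborel (erlang_density n \<beta>)" "(LBINT y. erlang_density n \<beta> y) = 1"
proof -
  have "(\<integral>\<^sup>+ y. ennreal (erlang_density n \<beta> y) \<partial>lborel) = ennreal 1"
    using nn_integral_erlang_ith_moment[OF assms, of n 0] by simp
  then have "has_bochner_integral lborel (erlang_density n \<beta>) 1"
    using assms by (intro has_bochner_integral_nn_integral) auto
  then show "integrable lborel (erlang_density n \<beta>)" "(LBINT y. erlang_density n \<beta> y) = 1"
    by (auto simp: has_bochner_integral_iff)
qed

lemma exp_integral: "0 < \<beta> \<Longrightarrow> set_integrable lborel {0..} (\<lambda>y. exp (- \<beta> * y))"
  "0 < \<beta> \<Longrightarrow> (LBINT y:{0..}. exp (- \<beta> * y)) = 1 / \<beta>" for \<beta> :: real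
proof -
  assume b: "0 < \<beta>"
  have eq: "(\<lambda>y. indicator {0..} y *\<^sub>R exp (- \<beta> * y)) = (\<lambda>y. erlang_density 0 \<beta> y / \<beta>)"
    using b by (auto simp: fun_eq_iff erlang_density_def indicator_def)
  show "set_integrable lborel {0..} (\<lambda>y. exp (- \<beta> * y))"
    unfolding set_integrable_def eq using erlang_density_integral(1)[OF b, of 0] by simp
  show "(LBINT y:{0..}. exp (- \<beta> * y)) = 1 / \<beta>"
    unfolding set_lebesgue_integral_def eq using erlang_density_integral(2)[OF b, of 0] by simp
qed

text \<open>With index \<open>n\<close> and rate \<open>n / x\<close> the density has its mode
  exactly at \<open>x\<close>. Away from \<open>x\<close> it is at most
  \<open>exp (- \<beta>0 * y)\<close> times a factor of order \<open>n * r^n\<close> with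
  \<open>r < 1\<close>, so continuity at the single point \<open>x\<close> decides the
  limit.\<close>

lemma post_widder:
  fixes W :: "real \<Rightarrow> real"
  assumes [measurable]: "W \<in> borel_measurable borel" and b0: "0 < \<beta>0"
    and W: "set_integrable lborel {0..} (\<lambda>y. exp (- \<beta>0 * y) * W y)"
    and x: "0 < x" and cont: "isCont W x"
  shows "(\<lambda>n. LBINT y. erlang_density n (real n / x) y * W y) \<longlonglongrightarrow> W x"
proof (rule tendstoI)
  fix e :: real assume "0 < e"
  define D where "D = (LBINT y:{0..}. exp (- \<beta>0 * y) * \<bar>W y - W x\<bar>)"
  have "set_integrable lborel {0..} (\<lambda>y. \<bar>exp (- \<beta>0 * y) * W y - exp (- \<beta>0 * y) * W x\<bar>)"
    using exp_integral(1)[OF b0] by (intro set_integrable_abs set_integral_diff(1) W) auto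
  then have intD: "set_integrable lborel {0..} (\<lambda>y. exp (- \<beta>0 * y) * \<bar>W y - W x\<bar>)"
    by (simp add: right_diff_distrib[symmetric] abs_mult)
  obtain d where d: "0 < d" "\<And>y. \<bar>y - x\<bar> < d \<Longrightarrow> \<bar>W y - W x\<bar> < e / 2"
    using cont \<open>0 < e\<close> unfolding continuous_at_eps_delta dist_real_def by (meson half_gt_zero)
  \<comment> \<open>A relative distance from \<open>x\<close>; the cap 1/2 keeps
    \<open>1 - \<delta>\<close> positive. By unimodality the supremum of
    \<open>t * exp (1 - t)\<close> at relative distance at least \<open>\<delta>\<close> is attained
    at one of the two end points that define \<open>r\<close>.\<close>
  define \<delta> where "\<delta> = min (d / x) (1/2)"
  have \<delta>: "0 < \<delta>" "\<delta> < 1" "\<delta> * x \<le> d" using d x by (auto simp: \<delta>_def min_def field_simps)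
  define r where "r = max ((1 - \<delta>) * exp (1 - (1 - \<delta>))) ((1 + \<delta>) * exp (1 - (1 + \<delta>)))"
  have r: "0 < r" "r < 1"
    using \<delta> mult_exp_one_minus_less_1[of "1 - \<delta>"] mult_exp_one_minus_less_1[of "1 + \<delta>"]
    by (auto simp: r_def less_max_iff_disj)
  have tr: "t * exp (1 - t) \<le> r" if "0 \<le> t" "\<delta> \<le> \<bar>t - 1\<bar>" for t
  proof (cases "t = 0")
    case False
    then have t: "0 < t" using that by simp
    show ?thesis
    proof (cases "t \<le> 1")
      case True
      then have "t * exp (1 - t) \<le> (1 - \<delta>) * exp (1 - (1 - \<delta>))"
        using that \<delta> t by (intro mult_exp_one_minus_mono) (auto simp: mult_le_0_iff)
      then show ?thesis by (simp add: r_def)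
    next
      case False
      then have "t * exp (1 - t) \<le> (1 + \<delta>) * exp (1 - (1 + \<delta>))"
        using that \<delta> t by (intro mult_exp_one_minus_mono) (auto simp: mult_le_0_iff)
      then show ?thesis by (simp add: r_def)
    qed
  qed (use r in simp)
  define k where "k = nat \<lceil>2 * x * \<beta>0\<rceil>"
  have k: "2 * x * \<beta>0 \<le> real k" unfolding k_def by (rule real_nat_ceiling_ge)
  define c where "c n = real n / x * (r^(n - k) * 2^k)" for n
  have c0: "0 \<le> c n" for n using x r by (simp add: c_def)
  have "(\<lambda>n. (2^k / x / r^k * D) * (real n * r^n)) \<longlonglongrightarrow> (2^k / x / r^k * D) * 0"
    using r by (intro tendsto_mult_left powser_times_n_limit_0) auto
  then have "\<forall>\<^sub>F n in sequentially. (2^k / x / r^k * D) * (real n * r^n) < e / 2"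
    using \<open>0 < e\<close> by (intro order_tendstoD) auto
  moreover have "\<forall>\<^sub>F n in sequentially. max k (nat \<lceil>x * \<beta>0\<rceil>) < n" by (rule eventually_gt_at_top)
  ultimately show "\<forall>\<^sub>F n in sequentially. dist (LBINT y. erlang_density n (real n / x) y * W y) (W x) < e"
  proof eventually_elim
    case (elim n)
    define E where "E = erlang_density n (real n / x)"
    have n: "k \<le> n" "0 < n" using elim by auto
    have "x * \<beta>0 < real n" using elim(2) by linarith
    then have b: "\<beta>0 < real n / x" "0 < real n / x" using x n by (auto simp: field_simps)
    have E[measurable]: "E \<in> borel_measurable borel" unfolding E_def by simp
    have intE: "integrable lborel E" and E1: "(LBINT y. E y) = 1"
      using erlang_density_integral[OF b(2)] by (auto simp: E_def)
    have E0: "0 \<le> E y" for y using b by (simp add: E_def)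
    have intEW: "integrable lborel (\<lambda>y. E y * W y)"
      unfolding E_def using b b0 by (intro integrable_erlang_density_mult[OF _ _ _ W]) auto
    have "c n * D = (2^k / x / r^k * D) * (real n * r^n)"
      using r n by (simp add: c_def power_diff field_simps)
    then have cD: "c n * D < e / 2" using elim(1) by simp
    have intB: "integrable lborel (\<lambda>y. e/2 * E y + c n * (indicator {0..} y *\<^sub>R (exp (- \<beta>0 * y) * \<bar>W y - W x\<bar>)))"
      using intE intD unfolding set_integrable_def by auto
    have intEd: "integrable lborel (\<lambda>y. E y * (W y - W x))"
      using intE intEW by (simp add: right_diff_distrib)
    have "(LBINT y. E y * W y) - W x = (LBINT y. E y * (W y - W x))"
      using intE intEW E1 by (simp add: right_diff_distrib)
    also have "\<bar>\<dots>\<bar> \<le> (LBINT y. \<bar>E y * (W y - W x)\<bar>)" using integral_norm_bound[of lborel "\<lambda>y. E y * (W y - W x)"] by simp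
    also have "\<dots> \<le> (LBINT y. e/2 * E y + c n * (indicator {0..} y *\<^sub>R (exp (- \<beta>0 * y) * \<bar>W y - W x\<bar>)))"
    proof (rule integral_mono[OF integrable_abs[OF intEd] intB])
      fix y :: real
      show "\<bar>E y * (W y - W x)\<bar> \<le> e/2 * E y + c n * (indicator {0..} y *\<^sub>R (exp (- \<beta>0 * y) * \<bar>W y - W x\<bar>))"
      proof (cases "\<bar>y - x\<bar> < d")
        case True
        then have "E y * \<bar>W y - W x\<bar> \<le> E y * (e/2)" using d(2)[of y] E0 by (intro mult_left_mono) auto
        moreover have "0 \<le> c n * (indicator {0..} y *\<^sub>R (exp (- \<beta>0 * y) * \<bar>W y - W x\<bar>))"
          using c0 by (simp add: indicator_def)
        ultimately show ?thesis using E0[of y] by (simp add: abs_mult mult.commute)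
      next
        case False
        show ?thesis
        proof (cases "0 \<le> y")
          case y: True
          have "\<delta> \<le> \<bar>y / x - 1\<bar>"
          proof -
            have "\<delta> * x \<le> \<bar>y - x\<bar>" using \<delta> False by linarith
            also have "\<dots> = \<bar>y / x - 1\<bar> * x" using x by (simp add: abs_if field_simps)
            finally show ?thesis using x by simp
          qed
          then have "y / x * exp (1 - y / x) \<le> r" using x y by (intro tr) auto
          then have "E y \<le> c n * exp (- \<beta>0 * y)"
            unfolding E_def c_def by (rule erlang_density_tail[OF x y _ k n(1)])
          then have "E y * \<bar>W y - W x\<bar> \<le> c n * exp (- \<beta>0 * y) * \<bar>W y - W x\<bar>" by (rule mult_right_mono) simp
          then show ?thesis using y E0[of y] \<open>0 < e\<close> by (simp add: abs_mult mult.assoc add_increasing)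
        next
          case False
          then show ?thesis by (simp add: E_def erlang_density_def)
        qed
      qed
    qed
    also have "\<dots> = e/2 + c n * D"
      using intE intD E1 unfolding D_def set_lebesgue_integral_def set_integrable_def by simp
    finally show ?case using cD by (simp add: dist_real_def E_def)
  qed
qed

section \<open>Monotonicity and log-concavity of the scale function\<close>

text \<open>Sampling \<open>W\<close> along a Poisson process of rate \<open>\<beta>\<close> gives the scale function of a skip-free
  random walk: the generating function of \<open>w\<close> is \<open>\<beta> / (\<psi>(\<beta>(1 - s)) - q)\<close>, and \<open>\<psi>(\<beta>(1 - s)) - q\<close>
  is a power series in \<open>s\<close> whose coefficients of index at least \<open>2\<close> are nonnegative.\<close>

lemma erlang_scale_sequence:
  fixes W :: "real \<Rightarrow> real"
  assumes nu: "levy_measure \<nu>" and q: "0 \<le> q" and [measurable]: "W \<in> borel_measurable borel"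
    and b: "0 < \<beta>0" "\<beta>0 < \<beta>" "q < laplace_exponent \<gamma> \<sigma> \<nu> \<beta>"
    and int: "\<And>\<beta>. \<beta>0 \<le> \<beta> \<Longrightarrow> set_integrable lborel {0..} (\<lambda>y. exp (- \<beta> * y) * W y)"
    and F: "\<And>\<beta>. \<beta>0 \<le> \<beta> \<Longrightarrow> (LBINT y:{0..}. exp (- \<beta> * y) * W y) = 1 / (laplace_exponent \<gamma> \<sigma> \<nu> \<beta> - q)"
  defines "w \<equiv> \<lambda>n. LBINT y. erlang_density n \<beta> y * W y"
  shows "0 < w n" "w n \<le> w (Suc n)" "w (Suc (Suc n)) / w (Suc n) \<le> w (Suc n) / w n"
proof -
  define \<psi> where "\<psi> = laplace_exponent \<gamma> \<sigma> \<nu>"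
  obtain a' where a'0: "\<And>k. 2 \<le> k \<Longrightarrow> (0::real) \<le> a' k"
    and a's: "\<And>s. 0 \<le> s \<Longrightarrow> s \<le> 1 \<Longrightarrow> (\<lambda>k. a' k * s^k) sums \<psi> (\<beta> * (1 - s))"
    using laplace_exponent_power_series[OF nu, of \<beta> \<gamma> \<sigma>] b unfolding \<psi>_def by auto
  define a where "a k = a' k - (if k = 0 then q else 0)" for k
  have a0: "0 \<le> a k" if "2 \<le> k" for k using a'0[OF that] that by (simp add: a_def)
  have as: "(\<lambda>k. a k * s^k) sums (\<psi> (\<beta> * (1 - s)) - q)" if "0 \<le> s" "s \<le> 1" for s
  proof -
    have "(\<lambda>k. (if k = 0 then q else 0) * s^k) sums (\<Sum>k\<in>{0}. (if k = 0 then q else 0) * s^k)"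
      by (rule sums_finite) auto
    then show ?thesis using sums_diff[OF a's[OF that]] by (simp add: a_def left_diff_distrib)
  qed
  have a_0: "a 0 = \<psi> \<beta> - q"
    using sums_unique2[OF powser_sums_zero[of a] as[of 0]] by simp
  have apos: "0 < a 0" using b by (simp add: a_0 \<psi>_def)
  \<comment> \<open>Positivity of the series near 0 means that the Laplace exponent at
    \<open>\<beta> * (1 - s)\<close> exceeds \<open>q\<close> for small \<open>s > 0\<close>. The
    generating function of \<open>w\<close> is then a genuine quotient, and its product with the
    series of \<open>a\<close> is \<open>\<beta>\<close>.\<close>
  have "isCont (\<lambda>x. \<Sum>n. a n * x^n) 0"
    using sums_summable[OF as[of 1]] by (intro isCont_powser[of a 1]) auto
  then have "((\<lambda>x. \<Sum>n. a n * x^n) \<longlongrightarrow> a 0) (at 0)" by (simp add: isCont_def)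
  then have "\<forall>\<^sub>F x in at 0. 0 < (\<Sum>n. a n * x^n)" using apos by (rule order_tendstoD)
  then obtain r1 where r1: "0 < r1" "\<And>x. x \<noteq> 0 \<Longrightarrow> \<bar>x\<bar> < r1 \<Longrightarrow> 0 < (\<Sum>n. a n * x^n)"
    unfolding eventually_at dist_real_def by auto
  define r where "r = min r1 (1 - \<beta>0 / \<beta>)"
  have "\<beta>0 / \<beta> < 1" "0 < \<beta>0 / \<beta>" using b by auto
  then have r: "0 < r" "r \<le> r1" "r \<le> 1" using r1 by (auto simp: r_def)
  have rb: "\<beta>0 \<le> \<beta> * (1 - s)" if "s < r" for s
  proof -
    have "s < 1 - \<beta>0 / \<beta>" using that by (simp add: r_def)
    then show ?thesis using b by (simp add: field_simps)
  qed
  have psi_pos: "0 < \<psi> (\<beta> * (1 - s)) - q" if "0 < s" "s < r" for s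
    using r1(2)[of s] sums_unique[OF as[of s]] that r by auto
  have ws: "(\<lambda>n. w n * s^n) sums (\<beta> / (\<psi> (\<beta> * (1 - s)) - q))" if "0 \<le> s" "s < r" for s
    using erlang_generating_function[of W \<beta>0 \<beta> s] b int[of \<beta>0] that rb[of s] F[of "\<beta> * (1 - s)"]
    by (simp add: w_def \<psi>_def)
  have w_0: "w 0 = \<beta> / (\<psi> \<beta> - q)"
    using sums_unique2[OF powser_sums_zero[of w] ws[of 0]] r by simp
  \<comment> \<open>The coefficients of the Cauchy product of \<open>a\<close> and \<open>w\<close>,
    minus those of the constant \<open>\<beta>\<close>. Their vanishing from index 1 on is the
    renewal recurrence.\<close>
  define c where "c k = (\<Sum>i\<le>k. a i * w (k - i)) - (if k = 0 then \<beta> else 0)" for k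
  have "c m = 0" for m
  proof (rule power_series_coeffs_eq_0[OF r(1)])
    show "c 0 = 0" using apos by (simp add: c_def w_0 a_0)
    fix s :: real assume s: "0 < s" "s < r"
    define s' where "s' = (s + r) / 2"
    have s': "s < s'" "s' < r" using s by (auto simp: s'_def)
    have sa: "summable (\<lambda>k. norm (a k * s^k))"
      using powser_insidea[OF sums_summable[OF as[of s']], of s] s s' r by auto
    have sw: "summable (\<lambda>k. norm (w k * s^k))"
      using powser_insidea[OF sums_summable[OF ws[of s']], of s] s s' r by auto
    have "(\<lambda>k. \<Sum>i\<le>k. (a i * s^i) * (w (k - i) * s^(k - i))) sums ((\<Sum>k. a k * s^k) * (\<Sum>k. w k * s^k))"
      by (rule Cauchy_product_sums[OF sa sw])
    also have "(\<Sum>k. a k * s^k) = \<psi> (\<beta> * (1 - s)) - q" using sums_unique[OF as[of s]] s r by simp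
    also have "(\<Sum>k. w k * s^k) = \<beta> / (\<psi> (\<beta> * (1 - s)) - q)" using sums_unique[OF ws[of s]] s by simp
    also have "(\<psi> (\<beta> * (1 - s)) - q) * (\<beta> / (\<psi> (\<beta> * (1 - s)) - q)) = \<beta>"
      using psi_pos[OF s] by simp
    also have "(\<lambda>k. \<Sum>i\<le>k. (a i * s^i) * (w (k - i) * s^(k - i))) = (\<lambda>k. (\<Sum>i\<le>k. a i * w (k - i)) * s^k)"
    proof
      fix k
      have "(a i * s^i) * (w (k - i) * s^(k - i)) = a i * w (k - i) * s^k" if "i \<le> k" for i
      proof -
        have "s^k = s^i * s^(k - i)" using that by (simp add: power_add[symmetric])
        then show ?thesis by simp
      qed
      then show "(\<Sum>i\<le>k. (a i * s^i) * (w (k - i) * s^(k - i))) = (\<Sum>i\<le>k. a i * w (k - i)) * s^k"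
        unfolding sum_distrib_right by (intro sum.cong) auto
    qed
    finally have 1: "(\<lambda>k. (\<Sum>i\<le>k. a i * w (k - i)) * s^k) sums \<beta>" .
    have "(\<lambda>k. (if k = 0 then \<beta> else 0) * s^k) sums (\<Sum>k\<in>{0}. (if k = 0 then \<beta> else 0) * s^k)"
      by (rule sums_finite) auto
    then show "(\<lambda>k. c k * s^k) sums 0"
      using sums_diff[OF 1] by (force simp: c_def left_diff_distrib)
  qed
  then have rec: "(\<Sum>i\<le>n. a i * w (n - i)) = 0" if "1 \<le> n" for n
    using that by (force simp: c_def)
  \<comment> \<open>At \<open>s = 1\<close> the coefficients sum to
    \<open>\<psi> 0 - q = - q\<close>, and for \<open>n \<ge> 1\<close> all coefficients omitted
    from the partial sum are nonnegative.\<close>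
  have psum: "(\<Sum>i\<le>n. a i) \<le> 0" if "1 \<le> n" for n
  proof -
    have s: "(\<lambda>k. a k) sums (\<psi> 0 - q)" using as[of 1] by simp
    have "(\<Sum>i\<le>n. a i) \<le> (\<Sum>i. a i)"
      by (intro sum_le_suminf sums_summable[OF s] a0) (use that in auto)
    also have "\<dots> = \<psi> 0 - q" using sums_unique[OF s] by simp
    also have "\<psi> 0 = 0" by (simp add: \<psi>_def laplace_exponent_def set_lebesgue_integral_def)
    finally show ?thesis using q by simp
  qed
  have w0: "0 < w 0" using apos b by (simp add: w_0 a_0)
  have pos: "0 < w n" for n
    using renewal_sequence_mono[of a w n] apos a0 psum w0 rec by blast
  show "0 < w n" "w n \<le> w (Suc n)"
    using renewal_sequence_mono[of a w n] apos a0 psum w0 rec by blast+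
  show "w (Suc (Suc n)) / w (Suc n) \<le> w (Suc n) / w n"
    using renewal_sequence_log_concave[of a w n] apos a0 rec pos by blast
qed

lemma nat_floor_div_tendsto:
  assumes "0 \<le> x"
  shows "(\<lambda>m. real (nat \<lfloor>x * real m\<rfloor>) / real m) \<longlonglongrightarrow> x"
proof (rule tendsto_sandwich)
  show "(\<lambda>m. x - 1 / real m) \<longlonglongrightarrow> x"
    using tendsto_diff[OF tendsto_const lim_const_over_n[of 1]] by simp
  show "\<forall>\<^sub>F m in sequentially. x - 1 / real m \<le> real (nat \<lfloor>x * real m\<rfloor>) / real m"
    using eventually_gt_at_top[of 0]
  proof eventually_elim
    case (elim m)
    have "x * real m - 1 \<le> real (nat \<lfloor>x * real m\<rfloor>)" using assms by linarith
    then have "(x * real m - 1) / real m \<le> real (nat \<lfloor>x * real m\<rfloor>) / real m" by (rule divide_right_mono) simp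
    then show ?case using elim by (simp add: diff_divide_distrib)
  qed
  show "\<forall>\<^sub>F m in sequentially. real (nat \<lfloor>x * real m\<rfloor>) / real m \<le> x"
    using eventually_gt_at_top[of 0]
  proof eventually_elim
    case (elim m)
    have "0 \<le> x * real m" using assms by simp
    then have "real (nat \<lfloor>x * real m\<rfloor>) \<le> x * real m" by linarith
    then show ?case using elim by (simp add: field_simps)
  qed
qed (rule tendsto_const)

section \<open>Setting for the scale function and its sampled sequences\<close>

lemma scale_function_borel_measurable:
  assumes "scale_function \<psi> q W" shows "W \<in> borel_measurable borel"
proof -
  have "(\<lambda>x. indicator {0..} x *\<^sub>R W x) \<in> borel_measurable borel"
    using assms by (intro borel_measurable_continuous_on_indicator) (auto simp: scale_function_def)
  also have "(\<lambda>x. indicator {0..} x *\<^sub>R W x) = W"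
    using assms by (auto simp: scale_function_def fun_eq_iff indicator_def)
  finally show ?thesis .
qed

text \<open>The condition \<open>drift_pos\<close> ensures that also for paths of bounded variation
  the Laplace exponent grows at least linearly and so exceeds \<open>q\<close> eventually.\<close>

locale scale =
  fixes \<gamma> \<sigma> q :: real and \<nu> :: "real measure" and W :: "real \<Rightarrow> real"
  assumes nu: "levy_measure \<nu>" and q: "0 \<le> q"
    and scale: "scale_function (laplace_exponent \<gamma> \<sigma> \<nu>) q W"
    and drift_pos: "bounded_variation_case \<sigma> \<nu> \<Longrightarrow> 0 < drift \<gamma> \<nu>"
begin

abbreviation \<psi> where "\<psi> \<equiv> laplace_exponent \<gamma> \<sigma> \<nu>"

lemma W_measurable[measurable]: "W \<in> borel_measurable borel"
  using scale by (rule scale_function_borel_measurable)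

lemma W_isCont: "0 < x \<Longrightarrow> isCont W x"
  using scale by (auto simp: scale_function_def intro!: continuous_on_interior[of "{0..}"])

lemma W_tendsto_0: "(\<lambda>n. W (1 / real (Suc n))) \<longlonglongrightarrow> W 0"
proof -
  have "continuous_on {0..} W" using scale by (simp add: scale_function_def)
  moreover have "(\<lambda>n. 1 / real (Suc n)) \<longlonglongrightarrow> 0" using LIMSEQ_Suc[OF lim_const_over_n[of 1]] by simp
  ultimately show ?thesis by (rule continuous_on_tendsto_compose) auto
qed

lemma laplace_transform:
  obtains \<beta>0 where "0 < \<beta>0"
    "\<And>\<beta>. \<beta>0 \<le> \<beta> \<Longrightarrow> set_integrable lborel {0..} (\<lambda>y. exp (- \<beta> * y) * W y)"
    "\<And>\<beta>. \<beta>0 \<le> \<beta> \<Longrightarrow> (LBINT y:{0..}. exp (- \<beta> * y) * W y) = 1 / (\<psi> \<beta> - q)"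
proof -
  obtain b where "\<forall>\<beta>\<ge>b. set_integrable lborel {0..} (\<lambda>y. exp (- \<beta> * y) * W y) \<and>
        (LBINT y:{0..}. exp (- \<beta> * y) * W y) = 1 / (\<psi> \<beta> - q)"
    using scale unfolding scale_function_def eventually_at_top_linorder by blast
  then show ?thesis by (intro that[of "max b 1"]) auto
qed

lemma psi_gt_q: "\<forall>\<^sub>F n in sequentially. q < \<psi> (real n)"
proof -
  obtain K where K: "0 < K" "bounded_variation_case \<sigma> \<nu> \<Longrightarrow> K < drift \<gamma> \<nu>"
    using drift_pos dense[of 0 "drift \<gamma> \<nu>"] zero_less_one by (metis (full_types))
  have "filterlim (\<lambda>n. K * real n) at_top sequentially"
    using K by (intro filterlim_tendsto_pos_mult_at_top[OF tendsto_const] filterlim_real_sequentially) auto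
  then have "\<forall>\<^sub>F n in sequentially. q < K * real n" unfolding filterlim_at_top_dense by blast
  moreover have "\<forall>\<^sub>F n in sequentially. K * real n \<le> \<psi> (real n)"
    using K by (intro laplace_exponent_superlinear[OF nu])
  ultimately show ?thesis by eventually_elim simp
qed

lemma erlang_sequence:
  shows "\<forall>\<^sub>F N in sequentially. \<forall>n. 0 < (LBINT y. erlang_density n (real N) y * W y) \<and>
     (LBINT y. erlang_density n (real N) y * W y) \<le> (LBINT y. erlang_density (Suc n) (real N) y * W y) \<and>
     (LBINT y. erlang_density (Suc (Suc n)) (real N) y * W y) / (LBINT y. erlang_density (Suc n) (real N) y * W y)
      \<le> (LBINT y. erlang_density (Suc n) (real N) y * W y) / (LBINT y. erlang_density n (real N) y * W y)"
proof -
  obtain \<beta>0 where b: "0 < \<beta>0"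
    "\<And>\<beta>. \<beta>0 \<le> \<beta> \<Longrightarrow> set_integrable lborel {0..} (\<lambda>y. exp (- \<beta> * y) * W y)"
    "\<And>\<beta>. \<beta>0 \<le> \<beta> \<Longrightarrow> (LBINT y:{0..}. exp (- \<beta> * y) * W y) = 1 / (\<psi> \<beta> - q)"
    using laplace_transform by blast
  have "\<forall>\<^sub>F N in sequentially. \<beta>0 < real N"
    using filterlim_real_sequentially unfolding filterlim_at_top_dense by blast
  then show ?thesis using psi_gt_q
    by eventually_elim (intro allI conjI erlang_scale_sequence[OF nu q W_measurable b(1) _ _ b(2,3)], auto)
qed

text \<open>Index \<open>a * N\<close> and rate \<open>m * N\<close> keep the ratio
  \<open>a / m\<close> fixed, and the rate depends on the denominator only. Points with a common
  denominator are thus compared within one and the same sampled sequence.\<close>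

lemma erlang_tendsto:
  assumes "0 < a" "0 < m"
  shows "(\<lambda>N. LBINT y. erlang_density (a * N) (real (m * N)) y * W y) \<longlonglongrightarrow> W (real a / real m)"
proof -
  obtain \<beta>0 where b: "0 < \<beta>0"
    "\<And>\<beta>. \<beta>0 \<le> \<beta> \<Longrightarrow> set_integrable lborel {0..} (\<lambda>y. exp (- \<beta> * y) * W y)"
    using laplace_transform by metis
  let ?x = "real a / real m"
  have "(\<lambda>n. LBINT y. erlang_density n (real n / ?x) y * W y) \<longlonglongrightarrow> W ?x"
    using assms b by (intro post_widder[where ?\<beta>0.0=\<beta>0] W_isCont) auto
  moreover have "strict_mono (\<lambda>N. a * N)" using assms by (simp add: strict_mono_def)
  ultimately have "((\<lambda>n. LBINT y. erlang_density n (real n / ?x) y * W y) \<circ> (\<lambda>N. a * N)) \<longlonglongrightarrow> W ?x"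
    by (rule LIMSEQ_subseq_LIMSEQ)
  moreover have "real (a * N) / ?x = real (m * N)" for N using assms by simp
  ultimately show ?thesis by (simp add: o_def)
qed

section \<open>Monotonicity, from rational points to all points\<close>

lemma eventually_mult_filter:
  assumes "\<forall>\<^sub>F N in sequentially. P N" "0 < (m::nat)"
  shows "\<forall>\<^sub>F N in sequentially. P (m * N)"
proof -
  have "filterlim (\<lambda>N. m * N) sequentially sequentially"
    using assms by (intro filterlim_subseq) (simp add: strict_mono_def)
  then show ?thesis using assms(1) by (simp add: filterlim_iff)
qed

lemma W_mono_rat:
  assumes "0 < a" "a \<le> b" "0 < m"
  shows "W (real a / real m) \<le> W (real b / real m)" "0 \<le> W (real a / real m)"
proof -
  have "\<forall>\<^sub>F N in sequentially. (LBINT y. erlang_density (a * N) (real (m * N)) y * W y) \<le>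
      (LBINT y. erlang_density (b * N) (real (m * N)) y * W y)"
    using eventually_mult_filter[OF erlang_sequence assms(3)]
  proof eventually_elim
    case (elim N)
    show ?case
      by (rule lift_Suc_mono_le[where f="\<lambda>n. LBINT y. erlang_density n (real (m * N)) y * W y"])
        (use elim assms in auto)
  qed
  then show "W (real a / real m) \<le> W (real b / real m)"
    using tendsto_le[OF _ erlang_tendsto erlang_tendsto] assms by auto
  have "\<forall>\<^sub>F N in sequentially. 0 \<le> (LBINT y. erlang_density (a * N) (real (m * N)) y * W y)"
    using eventually_mult_filter[OF erlang_sequence assms(3)] by eventually_elim (auto intro: less_imp_le)
  then show "0 \<le> W (real a / real m)"
    using tendsto_lowerbound[OF erlang_tendsto] assms by auto
qed

lemma W_floor_tendsto:
  assumes "0 < x"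
  shows "(\<lambda>m. W (real (nat \<lfloor>x * real m\<rfloor>) / real m)) \<longlonglongrightarrow> W x"
    "\<forall>\<^sub>F m in sequentially. 0 < nat \<lfloor>x * real m\<rfloor> \<and> 0 < m"
proof -
  have t: "(\<lambda>m. real (nat \<lfloor>x * real m\<rfloor>) / real m) \<longlonglongrightarrow> x"
    using assms by (intro nat_floor_div_tendsto) auto
  show "(\<lambda>m. W (real (nat \<lfloor>x * real m\<rfloor>) / real m)) \<longlonglongrightarrow> W x"
    by (rule isCont_tendsto_compose[OF W_isCont[OF assms] t])
  have "\<forall>\<^sub>F m in sequentially. 0 < real (nat \<lfloor>x * real m\<rfloor>) / real m"
    using order_tendstoD(1)[OF t assms] .
  then show "\<forall>\<^sub>F m in sequentially. 0 < nat \<lfloor>x * real m\<rfloor> \<and> 0 < m"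
    by eventually_elim (auto simp: zero_less_divide_iff)
qed

lemma W_mono_pos:
  assumes "0 < x" "x \<le> y" shows "W x \<le> W y"
proof (rule tendsto_le[OF _ W_floor_tendsto(1) W_floor_tendsto(1)])
  show "\<forall>\<^sub>F m in sequentially. W (real (nat \<lfloor>x * real m\<rfloor>) / real m) \<le> W (real (nat \<lfloor>y * real m\<rfloor>) / real m)"
    using W_floor_tendsto(2)[OF assms(1)]
  proof eventually_elim
    case (elim m)
    have "nat \<lfloor>x * real m\<rfloor> \<le> nat \<lfloor>y * real m\<rfloor>"
      using assms by (intro nat_mono floor_mono mult_right_mono) auto
    then show ?case using elim by (intro W_mono_rat) auto
  qed
qed (use assms in auto)

lemma W_0_le:
  assumes "0 < y" shows "W 0 \<le> W y"
proof (rule tendsto_upperbound[OF W_tendsto_0])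
  have "(\<lambda>n. 1 / real (Suc n)) \<longlonglongrightarrow> 0" using LIMSEQ_Suc[OF lim_const_over_n[of 1]] by simp
  then have "\<forall>\<^sub>F n in sequentially. 1 / real (Suc n) < y" using assms by (rule order_tendstoD)
  then show "\<forall>\<^sub>F n in sequentially. W (1 / real (Suc n)) \<le> W y"
    by eventually_elim (auto intro: W_mono_pos)
qed simp

lemma W_nonneg: "0 \<le> W x"
proof -
  have "0 \<le> W (1 / real (Suc n))" for n using W_mono_rat(2)[of 1 1 "Suc n"] by simp
  then have 0: "0 \<le> W 0"
    by (intro tendsto_lowerbound[OF W_tendsto_0] always_eventually) auto
  show ?thesis
  proof (cases "0 < x")
    case True then show ?thesis using 0 W_0_le by (meson order_trans)
  next
    case False
    then show ?thesis using 0 scale by (cases "x = 0") (auto simp: scale_function_def)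
  qed
qed

lemma W_mono: "x \<le> y \<Longrightarrow> W x \<le> W y"
proof -
  assume xy: "x \<le> y"
  consider "x < 0" | "x = 0" "y = 0" | "x = 0" "0 < y" | "0 < x" using xy by linarith
  then show ?thesis
  proof cases
    case 1 then have "W x = 0" using scale by (simp add: scale_function_def)
    then show ?thesis using W_nonneg by simp
  qed (use xy W_0_le W_mono_pos in auto)
qed

text \<open>As \<open>W\<close> is at least \<open>W 0\<close> on the half-line, its Laplace
  transform at \<open>n\<close> is at least \<open>W 0 / n\<close>; comparison with
  \<open>\<psi> n \<ge> K * n\<close> gives the bound in the limit. So \<open>W 0\<close> is at most
  the reciprocal of the drift, and 0 for unbounded variation, where every \<open>K\<close> is
  admissible. This is the source of the positivity of \<open>Xi\<close>.\<close>

lemma W_0_mult_le: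
  assumes K: "bounded_variation_case \<sigma> \<nu> \<Longrightarrow> K < drift \<gamma> \<nu>"
  shows "W 0 * K \<le> 1"
proof -
  obtain \<beta>0 where b: "0 < \<beta>0"
    "\<And>\<beta>. \<beta>0 \<le> \<beta> \<Longrightarrow> set_integrable lborel {0..} (\<lambda>y. exp (- \<beta> * y) * W y)"
    "\<And>\<beta>. \<beta>0 \<le> \<beta> \<Longrightarrow> (LBINT y:{0..}. exp (- \<beta> * y) * W y) = 1 / (\<psi> \<beta> - q)"
    using laplace_transform by blast
  have "\<forall>\<^sub>F N in sequentially. \<beta>0 < real N"
    using filterlim_real_sequentially unfolding filterlim_at_top_dense by blast
  moreover have "\<forall>\<^sub>F n in sequentially. K * real n \<le> \<psi> (real n)"
    using K by (intro laplace_exponent_superlinear[OF nu])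
  ultimately have ev: "\<forall>\<^sub>F n in sequentially. W 0 * K \<le> 1 + W 0 * q / real n"
    using psi_gt_q
  proof eventually_elim
    case (elim n)
    have n: "0 < real n" using elim b by linarith
    have "W 0 * (1 / real n) = (LBINT y:{0..}. exp (- real n * y) * W 0)"
      using exp_integral[OF n] by simp
    also have "\<dots> \<le> (LBINT y:{0..}. exp (- real n * y) * W y)"
      using exp_integral(1)[OF n] b(2)[of "real n"] elim
      by (intro set_integral_mono mult_left_mono W_mono) auto
    also have "\<dots> = 1 / (\<psi> (real n) - q)" using b(3) elim by simp
    finally have "W 0 * (\<psi> (real n) - q) \<le> real n" using n elim by (simp add: field_simps)
    moreover have "W 0 * (K * real n - q) \<le> W 0 * (\<psi> (real n) - q)"
      using elim W_nonneg by (intro mult_left_mono) auto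
    ultimately have "W 0 * (K * real n - q) \<le> real n" by linarith
    then show ?case using n by (simp add: field_simps)
  qed
  have "(\<lambda>n. 1 + W 0 * q / real n) \<longlonglongrightarrow> 1 + 0" by (intro tendsto_add tendsto_const lim_const_over_n)
  then show ?thesis by (intro tendsto_lowerbound[OF _ ev]) auto
qed

text \<open>The Laplace transform at \<open>\<beta> = k\<^sup>2\<close> is at least of order \<open>1 / k\<^sup>4\<close>, because \<open>\<psi>\<close> grows at most
  quadratically; the part of the integral beyond \<open>1 / k\<close> is exponentially small in \<open>k\<close>.\<close>

lemma W_square_bound_near_0:
  obtains c k0 where "0 < c" "\<And>k. k0 \<le> k \<Longrightarrow> 0 < k \<and> c * (1 / real k)^2 \<le> W (1 / real k)"
proof -
  obtain \<beta>0 where b: "0 < \<beta>0"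
    "\<And>\<beta>. \<beta>0 \<le> \<beta> \<Longrightarrow> set_integrable lborel {0..} (\<lambda>y. exp (- \<beta> * y) * W y)"
    "\<And>\<beta>. \<beta>0 \<le> \<beta> \<Longrightarrow> (LBINT y:{0..}. exp (- \<beta> * y) * W y) = 1 / (\<psi> \<beta> - q)"
    using laplace_transform by blast
  obtain C where C: "0 < C" "\<And>\<beta>. 1 \<le> \<beta> \<Longrightarrow> \<psi> \<beta> \<le> C * \<beta>^2"
    using laplace_exponent_le_square[OF nu] by blast
  define M where "M = (LBINT y:{0..}. exp (- \<beta>0 * y) * W y)"
  have M0: "0 \<le> M" unfolding M_def set_lebesgue_integral_def
    using W_nonneg by (intro Bochner_Integration.integral_nonneg) (auto simp: indicator_def)
  have sq: "filterlim (\<lambda>k::nat. k^2) sequentially sequentially"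
    by (rule filterlim_subseq) (auto simp: strict_mono_def power2_eq_square intro: mult_strict_mono)
  \<comment> \<open>For \<open>\<beta> = k^2\<close> the tail term times \<open>\<beta>^2\<close> is
    of this order. Keeping it below half of \<open>1 / C\<close> leaves the other half for
    \<open>W (1 / k)\<close>.\<close>
  have "(\<lambda>k. M * exp \<beta>0 * (real k ^ 4 / exp (real k))) \<longlonglongrightarrow> M * exp \<beta>0 * 0"
    by (intro tendsto_mult_left filterlim_compose[OF tendsto_power_div_exp_0 filterlim_real_sequentially])
  then have 1: "\<forall>\<^sub>F k in sequentially. M * exp \<beta>0 * (real k ^ 4 / exp (real k)) < 1 / (2 * C)"
    using C by (intro order_tendstoD) auto
  have "\<forall>\<^sub>F k in sequentially. \<beta>0 < real k"
    using filterlim_real_sequentially unfolding filterlim_at_top_dense by blast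
  moreover have "\<forall>\<^sub>F k in sequentially. q < \<psi> (real (k^2))"
    using psi_gt_q sq by (rule eventually_compose_filterlim)
  moreover have "\<forall>\<^sub>F k::nat in sequentially. 0 < k" by (rule eventually_gt_at_top)
  ultimately have "\<forall>\<^sub>F k in sequentially. 0 < k \<and> 1 / (2 * C) * (1 / real k)^2 \<le> W (1 / real k)"
    using 1
  proof eventually_elim
    case (elim k)
    define t where "t = 1 / real k"
    define \<beta> where "\<beta> = real k ^ 2"
    have k: "1 \<le> real k" using elim by simp
    have bt: "\<beta> * t = real k" "0 < t" "t \<le> 1" using k by (auto simp: \<beta>_def t_def power2_eq_square)
    have "real k \<le> \<beta>" using k by (simp add: \<beta>_def self_le_power)
    then have be: "\<beta>0 < \<beta>" "1 \<le> \<beta>" using elim k by linarith+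
    have "1 / (C * \<beta>^2) \<le> 1 / (\<psi> \<beta> - q)"
      using C(2)[OF be(2)] C(1) q elim by (intro divide_left_mono) (auto simp: \<beta>_def)
    also have "\<dots> = (LBINT y:{0..}. exp (- \<beta> * y) * W y)" using b(3) be by simp
    \<comment> \<open>Up to \<open>t\<close> the function is at most \<open>W t\<close>; beyond
      \<open>t\<close> the spare rate \<open>\<beta> - \<beta>0\<close> contributes
      \<open>exp (- (\<beta> - \<beta>0) * t)\<close> and the remaining integral is part of the
      fixed transform \<open>M\<close>.\<close>
    also have "\<dots> \<le> (LBINT y:{0..}. W t * exp (- \<beta> * y) + exp (- (\<beta> - \<beta>0) * t) * (exp (- \<beta>0 * y) * W y))"
    proof (rule set_integral_mono)
      show "set_integrable lborel {0..} (\<lambda>y. W t * exp (- \<beta> * y) + exp (- (\<beta> - \<beta>0) * t) * (exp (- \<beta>0 * y) * W y))"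
        using exp_integral(1)[of \<beta>] b be by (intro set_integral_add set_integrable_mult_right) auto
      show "set_integrable lborel {0..} (\<lambda>y. exp (- \<beta> * y) * W y)" using b be by simp
      fix y :: real assume "y \<in> {0..}"
      then have y: "0 \<le> y" by simp
      show "exp (- \<beta> * y) * W y \<le> W t * exp (- \<beta> * y) + exp (- (\<beta> - \<beta>0) * t) * (exp (- \<beta>0 * y) * W y)"
      proof (cases "y \<le> t")
        case True
        then have "W y * exp (- \<beta> * y) \<le> W t * exp (- \<beta> * y)" using W_mono by (intro mult_right_mono) auto
        moreover have "0 \<le> exp (- (\<beta> - \<beta>0) * t) * (exp (- \<beta>0 * y) * W y)" using W_nonneg by simp
        moreover have "exp (- \<beta> * y) * W y = W y * exp (- \<beta> * y)" by (rule mult.commute)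
        ultimately show ?thesis by linarith
      next
        case False
        have "(\<beta> - \<beta>0) * t \<le> (\<beta> - \<beta>0) * y" using False be by (intro mult_left_mono) auto
        then have "exp (- \<beta> * y) \<le> exp (- (\<beta> - \<beta>0) * t + (- \<beta>0 * y))" by (simp add: algebra_simps)
        also have "\<dots> = exp (- (\<beta> - \<beta>0) * t) * exp (- \<beta>0 * y)" by (rule exp_add)
        finally have "exp (- \<beta> * y) \<le> exp (- (\<beta> - \<beta>0) * t) * exp (- \<beta>0 * y)" .
        then have "exp (- \<beta> * y) * W y \<le> exp (- (\<beta> - \<beta>0) * t) * exp (- \<beta>0 * y) * W y"
          using W_nonneg by (intro mult_right_mono) auto
        moreover have "0 \<le> W t * exp (- \<beta> * y)" using W_nonneg by simp
        ultimately show ?thesis by (simp add: mult.assoc)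
      qed
    qed
    also have "\<dots> = (LBINT y:{0..}. W t * exp (- \<beta> * y)) + (LBINT y:{0..}. exp (- (\<beta> - \<beta>0) * t) * (exp (- \<beta>0 * y) * W y))"
      using exp_integral(1)[of \<beta>] b be by (intro set_integral_add set_integrable_mult_right) auto
    also have "\<dots> = W t / \<beta> + exp (- (\<beta> - \<beta>0) * t) * M"
      using exp_integral(2)[of \<beta>] be by (simp add: M_def)
    finally have "1 / (C * \<beta>^2) * \<beta> \<le> (W t / \<beta> + exp (- (\<beta> - \<beta>0) * t) * M) * \<beta>"
      using be by (intro mult_right_mono) auto
    moreover have "1 / (C * \<beta>^2) * \<beta> = 1 / (C * \<beta>)" using be by (simp add: power2_eq_square)
    moreover have "(W t / \<beta> + exp (- (\<beta> - \<beta>0) * t) * M) * \<beta> = W t + exp (- (\<beta> - \<beta>0) * t) * M * \<beta>"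
      using be by (simp add: distrib_right)
    ultimately have "1 / (C * \<beta>) \<le> W t + exp (- (\<beta> - \<beta>0) * t) * M * \<beta>" by (simp only:)
    moreover have "exp (- (\<beta> - \<beta>0) * t) * M * \<beta> \<le> 1 / (2 * C * \<beta>)"
    proof -
      have "- (\<beta> - \<beta>0) * t \<le> \<beta>0 - real k" using bt b mult_left_le[of t \<beta>0] by (simp add: algebra_simps)
      then have "exp (- (\<beta> - \<beta>0) * t) * (M * \<beta>^2) \<le> exp (\<beta>0 - real k) * (M * \<beta>^2)"
        using M0 by (intro mult_right_mono) auto
      also have "\<dots> = M * exp \<beta>0 * (real k ^ 4 / exp (real k))"
        by (simp add: \<beta>_def exp_diff power_mult[symmetric])
      also have "\<dots> \<le> 1 / (2 * C)" using elim by simp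
      finally show ?thesis using be C(1) by (simp add: field_simps power2_eq_square)
    qed
    moreover have "1 / (C * \<beta>) = 1 / (2 * C * \<beta>) + 1 / (2 * C * \<beta>)" by simp
    moreover have "1 / (2 * C * \<beta>) = 1 / (2 * C) * (1 / real k)^2" by (simp add: \<beta>_def power_divide)
    ultimately show ?case using elim unfolding t_def by linarith
  qed
  then obtain k0 where "\<forall>k\<ge>k0. 0 < k \<and> 1 / (2 * C) * (1 / real k)^2 \<le> W (1 / real k)"
    unfolding eventually_sequentially by blast
  then show ?thesis using C by (intro that[of "1 / (2 * C)" k0]) auto
qed

section \<open>Positivity and quadratic lower bound on bounded intervals\<close>

lemma W_pos: assumes "0 < x" shows "0 < W x"
proof -
  obtain c k0 where c: "0 < c" "\<And>k. k0 \<le> k \<Longrightarrow> 0 < k \<and> c * (1 / real k)^2 \<le> W (1 / real k)"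
    using W_square_bound_near_0 by blast
  define k where "k = max k0 (nat \<lceil>1 / x\<rceil>)"
  have k: "0 < k" "c * (1 / real k)^2 \<le> W (1 / real k)" using c(2)[of k] by (auto simp: k_def)
  have "1 / x \<le> real (nat \<lceil>1 / x\<rceil>)" by (rule real_nat_ceiling_ge)
  then have "1 / x \<le> real k" by (simp add: k_def)
  then have "1 / real k \<le> x" using k assms by (simp add: field_simps)
  then have "W (1 / real k) \<le> W x" by (rule W_mono)
  moreover have "0 < c * (1 / real k)^2" using c k by simp
  ultimately show ?thesis using k by linarith
qed

lemma W_square_bound:
  assumes R: "0 < R"
  obtains c where "0 < c" "\<And>x. 0 < x \<Longrightarrow> x \<le> R \<Longrightarrow> c * x^2 \<le> W x"
proof -
  obtain c k0 where c: "0 < c" "\<And>k. k0 \<le> k \<Longrightarrow> 0 < k \<and> c * (1 / real k)^2 \<le> W (1 / real k)"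
    using W_square_bound_near_0 by blast
  define x0 where "x0 = 1 / real (Suc k0)"
  have x0: "0 < x0" "x0 \<le> 1" by (auto simp: x0_def)
  \<comment> \<open>The 4 stems from \<open>1 / k \<ge> x / 2\<close> for a suitable grid point
    \<open>1 / k\<close> below \<open>x\<close>. The second entry serves \<open>x\<close> beyond
    \<open>x0\<close>, by monotonicity and \<open>x \<le> R\<close>.\<close>
  define c' where "c' = min (c / 4) (W x0 / R^2)"
  have "c' * x^2 \<le> W x" if x: "0 < x" "x \<le> R" for x
  proof (cases "x \<le> x0")
    case True
    define k where "k = nat \<lceil>1 / x\<rceil>"
    have "1 / x0 \<le> 1 / x" using True x by (intro divide_left_mono) (use x0 in auto)
    then have "real (Suc k0) \<le> 1 / x" by (simp add: x0_def)
    then have kk: "1 / x \<le> real k" "real k \<le> 1 / x + 1" "k0 \<le> k" "0 < k" "1 \<le> 1 / x"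
      unfolding k_def by linarith+
    have k2: "1 / real k \<le> x" using kk x by (simp add: field_simps)
    have "real k \<le> 2 / x" using kk by linarith
    then have k3: "x / 2 \<le> 1 / real k" using kk x by (simp add: field_simps)
    have "c' * x^2 \<le> c / 4 * x^2" unfolding c'_def by (intro mult_right_mono min.cobounded1) auto
    also have "\<dots> = c * (x / 2)^2" by (simp add: power2_eq_square)
    also have "\<dots> \<le> c * (1 / real k)^2" using c k3 x by (intro mult_left_mono power_mono) auto
    also have "\<dots> \<le> W (1 / real k)" using c kk by auto
    also have "\<dots> \<le> W x" using k2 by (rule W_mono)
    finally show ?thesis .
  next
    case False
    have "c' * x^2 \<le> W x0 / R^2 * R^2"
      unfolding c'_def using x W_nonneg by (intro mult_mono power_mono min.cobounded2) auto
    also have "\<dots> = W x0" using R by simp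
    also have "\<dots> \<le> W x" using False by (intro W_mono) auto
    finally show ?thesis .
  qed
  moreover have "0 < c'" using c R W_pos[OF x0(1)] by (simp add: c'_def)
  ultimately show ?thesis using that by blast
qed

text \<open>The three points correspond to the indices \<open>a * N\<close>, \<open>b * N\<close>
  and \<open>c * N\<close> of one log-concave sequence, and the common factor \<open>N\<close> of
  the gaps cancels before the limit is taken.\<close>

lemma W_log_concave_rat:
  assumes "0 < a" "a \<le> b" "b \<le> c" "0 < m"
  shows "real (b - a) * (ln (W (real c / real m)) - ln (W (real b / real m)))
     \<le> real (c - b) * (ln (W (real b / real m)) - ln (W (real a / real m)))"
proof -
  define w where "w a N = (LBINT y. erlang_density (a * N) (real (m * N)) y * W y)" for a N
  have lim: "(\<lambda>N. ln (w a N)) \<longlonglongrightarrow> ln (W (real a / real m))" if "0 < a" for a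
    unfolding w_def using assms that
    by (intro tendsto_ln erlang_tendsto less_imp_neq[THEN not_sym] W_pos) auto
  have "\<forall>\<^sub>F N in sequentially. real (b - a) * (ln (w c N) - ln (w b N)) \<le> real (c - b) * (ln (w b N) - ln (w a N))"
    using eventually_mult_filter[OF erlang_sequence assms(4)] eventually_gt_at_top[of 0]
  proof eventually_elim
    case (elim N)
    have "real (b * N - a * N) * (ln (w c N) - ln (w b N)) \<le> real (c * N - b * N) * (ln (w b N) - ln (w a N))"
      unfolding w_def
      by (rule log_concave_sequence_slope[where w="\<lambda>n. LBINT y. erlang_density n (real (m * N)) y * W y"])
        (use elim assms in auto)
    moreover have "real (b * N - a * N) = real N * real (b - a)" "real (c * N - b * N) = real N * real (c - b)"
      by (metis diff_mult_distrib mult.commute of_nat_mult)+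
    ultimately have "real N * (real (b - a) * (ln (w c N) - ln (w b N))) \<le> real N * (real (c - b) * (ln (w b N) - ln (w a N)))"
      by (simp only: mult.assoc)
    then show ?case using elim(2) by (simp add: mult_le_cancel_left_pos)
  qed
  moreover have "(\<lambda>N. real (b - a) * (ln (w c N) - ln (w b N))) \<longlonglongrightarrow> real (b - a) * (ln (W (real c / real m)) - ln (W (real b / real m)))"
    "(\<lambda>N. real (c - b) * (ln (w b N) - ln (w a N))) \<longlonglongrightarrow> real (c - b) * (ln (W (real b / real m)) - ln (W (real a / real m)))"
    using assms by (intro tendsto_mult tendsto_diff tendsto_const lim; simp)+
  ultimately show ?thesis by (intro tendsto_le[OF trivial_limit_sequentially])
qed

lemma W_log_concave:
  assumes "0 < x" "x \<le> y" "y \<le> z"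
  shows "(y - x) * (ln (W z) - ln (W y)) \<le> (z - y) * (ln (W y) - ln (W x))"
proof -
  define p where "p x m = nat \<lfloor>x * real m\<rfloor>" for x :: real and m :: nat
  have l1: "(\<lambda>m. real (p x m) / real m) \<longlonglongrightarrow> x" if "0 < x" for x
    unfolding p_def using that by (intro nat_floor_div_tendsto) auto
  have l2: "(\<lambda>m. ln (W (real (p x m) / real m))) \<longlonglongrightarrow> ln (W x)" if "0 < x" for x
    unfolding p_def using that W_pos[OF that] by (intro tendsto_ln W_floor_tendsto) auto
  have "\<forall>\<^sub>F m in sequentially.
     (real (p y m) / real m - real (p x m) / real m) * (ln (W (real (p z m) / real m)) - ln (W (real (p y m) / real m)))
     \<le> (real (p z m) / real m - real (p y m) / real m) * (ln (W (real (p y m) / real m)) - ln (W (real (p x m) / real m)))"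
    using W_floor_tendsto(2)[OF assms(1)]
  proof eventually_elim
    case (elim m)
    have le: "p x m \<le> p y m" "p y m \<le> p z m"
      unfolding p_def using assms by (auto intro!: nat_mono floor_mono mult_right_mono)
    have "real (p y m - p x m) * (ln (W (real (p z m) / real m)) - ln (W (real (p y m) / real m))) / real m
      \<le> real (p z m - p y m) * (ln (W (real (p y m) / real m)) - ln (W (real (p x m) / real m))) / real m"
      by (intro divide_right_mono W_log_concave_rat) (use elim le in \<open>auto simp: p_def\<close>)
    then show ?case using le by (simp add: of_nat_diff diff_divide_distrib[symmetric])
  qed
  moreover have "(\<lambda>m. (real (p y m) / real m - real (p x m) / real m) * (ln (W (real (p z m) / real m)) - ln (W (real (p y m) / real m))))
      \<longlonglongrightarrow> (y - x) * (ln (W z) - ln (W y))"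
    "(\<lambda>m. (real (p z m) / real m - real (p y m) / real m) * (ln (W (real (p y m) / real m)) - ln (W (real (p x m) / real m))))
      \<longlonglongrightarrow> (z - y) * (ln (W y) - ln (W x))"
    using assms by (intro tendsto_mult tendsto_diff l1 l2; simp)+
  ultimately show ?thesis by (intro tendsto_le[OF trivial_limit_sequentially])
qed

end

section \<open>The right derivative of the scale function\<close>

context scale
begin

lemma log_slope_antimono:
  assumes "0 < x" "x < u" "u \<le> v"
  shows "(ln (W v) - ln (W x)) / (v - x) \<le> (ln (W u) - ln (W x)) / (u - x)"
proof -
  have "(u - x) * (ln (W v) - ln (W u)) \<le> (v - u) * (ln (W u) - ln (W x))"
    using W_log_concave[of x u v] assms by simp
  then have "(ln (W v) - ln (W x)) * (u - x) \<le> (ln (W u) - ln (W x)) * (v - x)"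
    by (simp add: algebra_simps)
  then show ?thesis using assms by (simp add: field_simps)
qed

lemma log_slope_left_right:
  assumes "0 < x" "x < y" "y < u"
  shows "(ln (W u) - ln (W y)) / (u - y) \<le> (ln (W y) - ln (W x)) / (y - x)"
  using W_log_concave[of x y u] assms by (simp add: field_simps)

text \<open>By concavity of \<open>ln W\<close> the slopes from \<open>x\<close> to \<open>u\<close>
  increase as \<open>u\<close> decreases to \<open>x\<close> and stay below a slope on the left of
  \<open>x\<close>; so they converge, and exponentiation carries the limit over to \<open>W\<close>.
  This determines the value chosen in \<open>right_deriv\<close>.\<close>

lemma W_right_deriv:
  assumes x: "0 < x"
  shows "((\<lambda>u. (W u - W x) / (u - x)) \<longlongrightarrow> right_deriv W x) (at_right x)"
    "((\<lambda>u. (ln (W u) - ln (W x)) / (u - x)) \<longlongrightarrow> right_deriv W x / W x) (at_right x)"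
proof -
  let ?s = "\<lambda>u. (ln (W u) - ln (W x)) / (u - x)"
  \<comment> \<open>Negated, the slopes are nondecreasing in \<open>u\<close> and bounded below, as
    the limit theorem for monotone functions requires.\<close>
  have "((\<lambda>u. - ?s u) \<longlongrightarrow> Inf ((\<lambda>u. - ?s u) ` ({x<..} \<inter> UNIV))) (at x within ({x<..} \<inter> UNIV))"
  proof (rule Lim_right_bound)
    show "- ((ln (W x) - ln (W (x/2))) / (x - x/2)) \<le> - ?s a" if "x < a" for a
      using log_slope_left_right[of "x/2" x a] x that by simp
    show "- ?s a \<le> - ?s b" if "x < a" "a \<le> b" for a b
      using log_slope_antimono[OF x that] by simp
  qed
  then obtain l where "((\<lambda>u. - ?s u) \<longlongrightarrow> l) (at_right x)" by auto
  then have l: "(?s \<longlongrightarrow> - l) (at_right x)" using tendsto_minus by fastforce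
  then have "((\<lambda>u. ln (W u)) has_field_derivative - l) (at_right x)"
    by (simp add: has_field_derivative_iff)
  then have "((\<lambda>u. exp (ln (W u))) has_field_derivative exp (ln (W x)) * - l) (at_right x)"
    by (rule DERIV_chain'[OF _ DERIV_exp])
  then have "((\<lambda>u. (exp (ln (W u)) - exp (ln (W x))) / (u - x)) \<longlongrightarrow> W x * - l) (at_right x)"
    using W_pos[OF x] by (simp add: has_field_derivative_iff)
  moreover have "\<forall>\<^sub>F u in at_right x. (exp (ln (W u)) - exp (ln (W x))) / (u - x) = (W u - W x) / (u - x)"
    using eventually_at_right_less[of x] by eventually_elim (use x W_pos in auto)
  ultimately have d: "((\<lambda>u. (W u - W x) / (u - x)) \<longlongrightarrow> W x * - l) (at_right x)"
    by (rule Lim_transform_eventually)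
  then have "(W has_vector_derivative (W x * - l)) (at_right x)"
    by (simp add: has_field_derivative_iff has_real_derivative_iff_has_vector_derivative[symmetric])
  then have r: "right_deriv W x = W x * - l"
    unfolding right_deriv_def by (intro vector_derivative_within trivial_limit_at_right_real)
  show "((\<lambda>u. (W u - W x) / (u - x)) \<longlongrightarrow> right_deriv W x) (at_right x)" using d r by simp
  show "(?s \<longlongrightarrow> right_deriv W x / W x) (at_right x)" using l r W_pos[OF x] by simp
qed

lemma right_deriv_nonneg:
  assumes "0 < x" shows "0 \<le> right_deriv W x"
proof (rule tendsto_lowerbound[OF W_right_deriv(1)[OF assms]])
  show "\<forall>\<^sub>F u in at_right x. 0 \<le> (W u - W x) / (u - x)"
    using eventually_at_right_less[of x] by eventually_elim (use W_mono in auto)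
qed simp

lemma log_deriv_le_slope:
  assumes "0 < x" "x < y"
  shows "right_deriv W y / W y \<le> (ln (W y) - ln (W x)) / (y - x)"
proof (rule tendsto_upperbound[OF W_right_deriv(2)])
  show "\<forall>\<^sub>F u in at_right y. (ln (W u) - ln (W y)) / (u - y) \<le> (ln (W y) - ln (W x)) / (y - x)"
    using eventually_at_right_less[of y] by eventually_elim (use log_slope_left_right assms in auto)
qed (use assms in auto)

lemma log_deriv_antimono:
  assumes "0 < x" "x \<le> y"
  shows "right_deriv W y / W y \<le> right_deriv W x / W x"
proof (cases "x = y")
  case False
  have "(ln (W y) - ln (W x)) / (y - x) \<le> right_deriv W x / W x"
  proof (rule tendsto_lowerbound[OF W_right_deriv(2)[OF assms(1)]])
    have "\<forall>\<^sub>F u in at_right x. u \<in> {x<..<y}" using False assms by (intro eventually_at_right_real) auto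
    then show "\<forall>\<^sub>F u in at_right x. (ln (W y) - ln (W x)) / (y - x) \<le> (ln (W u) - ln (W x)) / (u - x)"
      by eventually_elim (use log_slope_antimono assms in auto)
  qed simp
  then show ?thesis using log_deriv_le_slope[of x y] False assms by simp
qed simp

text \<open>The derivative of \<open>ln W\<close> at \<open>x\<close> is at most the slope over
  \<open>(x / 2, x)\<close>, hence at most \<open>2 / x * (W x / W (x / 2))\<close>. The quadratic
  lower bound at \<open>x / 2\<close> supplies the other two powers; 8 is 2 from the interval length
  times 4 from \<open>(x / 2)^2\<close>.\<close>

lemma right_deriv_cubic_bound:
  assumes R: "0 < R"
  obtains B where "0 \<le> B" "\<And>x. 0 < x \<Longrightarrow> x \<le> R \<Longrightarrow> x^3 * right_deriv W x \<le> B"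
proof -
  obtain c where c: "0 < c" "\<And>x. 0 < x \<Longrightarrow> x \<le> R \<Longrightarrow> c * x^2 \<le> W x"
    using W_square_bound[OF R] by blast
  have "x^3 * right_deriv W x \<le> 8 * W R^2 / c" if x: "0 < x" "x \<le> R" for x
  proof -
    have p: "0 < W x" "0 < W (x/2)" using W_pos x by auto
    have "right_deriv W x / W x \<le> (ln (W x) - ln (W (x/2))) / (x - x/2)"
      using x by (intro log_deriv_le_slope) auto
    also have "\<dots> \<le> (W x / W (x/2)) / (x - x/2)"
    proof (rule divide_right_mono)
      have "ln (W x) - ln (W (x/2)) = ln (W x / W (x/2))" using p by (simp add: ln_divide_pos)
      also have "\<dots> \<le> W x / W (x/2) - 1" using p by (intro ln_le_minus_one) auto
      finally show "ln (W x) - ln (W (x/2)) \<le> W x / W (x/2)" by simp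
    qed (use x in simp)
    finally have "right_deriv W x * (x * W (x/2)) \<le> 2 * (W x)^2"
      using p x by (simp add: field_simps power2_eq_square)
    also have "\<dots> \<le> 2 * (W R)^2" using W_mono[OF x(2)] p by (intro mult_left_mono power_mono) auto
    finally have 1: "right_deriv W x * (x * W (x/2)) \<le> 2 * (W R)^2" .
    have "right_deriv W x * (x * (c * (x/2)^2)) \<le> right_deriv W x * (x * W (x/2))"
      using c(2)[of "x/2"] x right_deriv_nonneg[OF x(1)] by (intro mult_left_mono) auto
    with 1 have "right_deriv W x * (x * (c * (x/2)^2)) \<le> 2 * (W R)^2" by linarith
    then show ?thesis using c(1) by (simp add: field_simps power2_eq_square power3_eq_cube)
  qed
  then show ?thesis using c(1) by (intro that[of "8 * W R^2 / c"]) auto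
qed

text \<open>The logarithmic derivative decreases, so its value at \<open>t0\<close> bounds it from
  below at smaller arguments, while \<open>W\<close> is at least \<open>W \<epsilon>\<close> there.
  Uniqueness uses this to pass from integrability of kernel times solution to that of \<phi> times
  solution.\<close>

lemma right_deriv_lower_bound:
  assumes "0 < t0" "0 < right_deriv W t0" "0 < \<epsilon>"
  obtains c where "0 < c" "\<And>t. \<epsilon> \<le> t \<Longrightarrow> t \<le> t0 \<Longrightarrow> c \<le> right_deriv W t"
proof (rule that)
  have p: "0 < W t0" "0 < W \<epsilon>" using assms W_pos by auto
  show "0 < right_deriv W t0 / W t0 * W \<epsilon>" using p assms by simp
  fix t assume t: "\<epsilon> \<le> t" "t \<le> t0"
  have "right_deriv W t0 / W t0 * W \<epsilon> \<le> right_deriv W t / W t * W t"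
    using t assms p by (intro mult_mono log_deriv_antimono W_mono) (auto intro!: divide_nonneg_pos right_deriv_nonneg W_pos W_nonneg)
  also have "\<dots> = right_deriv W t" using W_pos[of t] assms t by simp
  finally show "right_deriv W t0 / W t0 * W \<epsilon> \<le> right_deriv W t" .
qed

section \<open>Measurability and local integrability of the right derivative\<close>

lemma right_deriv_neg: assumes "x < 0" shows "right_deriv W x = 0"
proof -
  have "\<forall>\<^sub>F u in at_right x. u \<in> {x<..<0}" using assms by (intro eventually_at_right_real) auto
  then have "\<forall>\<^sub>F u in at_right x. 0 = (W u - W x) / (u - x)"
    by eventually_elim (use assms scale in \<open>auto simp: scale_function_def\<close>)
  then have "((\<lambda>u. (W u - W x) / (u - x)) \<longlongrightarrow> 0) (at_right x)"
    by (rule Lim_transform_eventually[OF tendsto_const])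
  then have "(W has_vector_derivative 0) (at_right x)"
    by (simp add: has_field_derivative_iff has_real_derivative_iff_has_vector_derivative[symmetric])
  then show ?thesis unfolding right_deriv_def by (intro vector_derivative_within trivial_limit_at_right_real)
qed

lemma difference_quotient_tendsto:
  assumes "0 < x"
  shows "(\<lambda>n. real (Suc n) * (W (x + 1 / real (Suc n)) - W x)) \<longlonglongrightarrow> right_deriv W x"
proof -
  have "(\<lambda>n. x + 1 / real (Suc n)) \<longlonglongrightarrow> x"
    using tendsto_add[OF tendsto_const LIMSEQ_Suc[OF lim_const_over_n[of 1]]] by simp
  then have "filterlim (\<lambda>n. x + 1 / real (Suc n)) (at_right x) sequentially"
    unfolding filterlim_at by (auto intro!: always_eventually simp del: of_nat_Suc)
  from filterlim_compose[OF W_right_deriv(1)[OF assms] this]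
  show ?thesis by (simp add: mult.commute del: of_nat_Suc)
qed

lemma right_deriv_measurable[measurable]: "right_deriv W \<in> borel_measurable borel"
proof -
  \<comment> \<open>At 0 the difference quotients may diverge and \<open>right_deriv W 0\<close> is
    then an unspecified value, so the approximants take that value itself.\<close>
  define u where "u n x = (if 0 < x then real (Suc n) * (W (x + 1 / real (Suc n)) - W x) else if x = 0 then right_deriv W 0 else 0)" for n x
  show ?thesis
  proof (rule borel_measurable_LIMSEQ_real)
    show "u n \<in> borel_measurable borel" for n unfolding u_def[abs_def] by measurable
    show "(\<lambda>n. u n x) \<longlonglongrightarrow> right_deriv W x" for x
      using difference_quotient_tendsto[of x] right_deriv_neg[of x] unfolding u_def
      by (cases "0 < x"; cases "x = 0") auto
  qed
qed

text \<open>The integral telescopes to \<open>n\<close> times the integral of \<open>W\<close> over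
  \<open>(R, R + 1 / n)\<close> minus \<open>n\<close> times that over \<open>(0, 1 / n)\<close>.
  Subtraction in \<open>ennreal\<close> is avoided by adding the finite integral \<open>?A\<close>
  on both sides and cancelling it.\<close>

lemma nn_integral_difference_quotient_le:
  assumes R: "0 \<le> R" and n: "1 \<le> (n::real)"
  shows "(\<integral>\<^sup>+ x\<in>{0<..<R}. ennreal (n * (W (x + 1 / n) - W x)) \<partial>lborel) \<le> ennreal (W (R + 1))"
proof -
  let ?A = "\<integral>\<^sup>+ x\<in>{0<..<R}. ennreal (n * W x) \<partial>lborel"
  have Wn: "0 \<le> n * W x" for x using W_nonneg n by simp
  have "?A \<le> (\<integral>\<^sup>+ x\<in>{0<..<R}. ennreal (n * W R) \<partial>lborel)"
    using n W_mono by (intro nn_integral_mono) (auto simp: indicator_def intro!: ennreal_leI mult_left_mono)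
  also have "\<dots> = ennreal (n * W R) * emeasure lborel {0<..<R}" by (simp add: nn_integral_cmult_indicator)
  also have "\<dots> < \<infinity>" using R by (simp add: ennreal_mult_less_top)
  finally have fin: "?A < \<infinity>" .
  have "(\<integral>\<^sup>+ x\<in>{0<..<R}. ennreal (n * (W (x + 1 / n) - W x)) \<partial>lborel) + ?A
      = (\<integral>\<^sup>+ x. ennreal (n * (W (x + 1 / n) - W x)) * indicator {0<..<R} x + ennreal (n * W x) * indicator {0<..<R} x \<partial>lborel)"
    by (rule nn_integral_add[symmetric]) measurable
  also have "\<dots> = (\<integral>\<^sup>+ x. ennreal (n * W (x + 1 / n)) * indicator {0<..<R} x \<partial>lborel)"
  proof (rule nn_integral_cong)
    fix x
    have "0 \<le> n * (W (x + 1 / n) - W x)" using n W_mono[of x "x + 1/n"] by simp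
    then have "ennreal (n * (W (x + 1 / n) - W x)) + ennreal (n * W x) = ennreal (n * W (x + 1 / n))"
      using Wn by (simp add: ennreal_plus[symmetric] algebra_simps del: ennreal_plus)
    then show "ennreal (n * (W (x + 1 / n) - W x)) * indicator {0<..<R} x + ennreal (n * W x) * indicator {0<..<R} x
      = ennreal (n * W (x + 1 / n)) * indicator {0<..<R} x"
      by (simp add: indicator_def)
  qed
  also have "\<dots> = (\<integral>\<^sup>+ x. ennreal (n * W x) * indicator {1/n<..<R + 1/n} x \<partial>lborel)"
    by (subst nn_integral_real_affine[of "\<lambda>x. ennreal (n * W x) * indicator {1/n<..<R + 1/n} x" 1 "1/n"])
      (auto intro!: nn_integral_cong simp: indicator_def add.commute)
  also have "\<dots> \<le> (\<integral>\<^sup>+ x. ennreal (n * W x) * indicator {0<..<R} x + ennreal (n * W (R + 1)) * indicator {R..R + 1/n} x \<partial>lborel)"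
  proof (rule nn_integral_mono)
    fix x :: real
    have n1: "1 / n \<le> 1" "0 < 1 / n" using n by auto
    have "n * W x \<le> n * W (R + 1)" if "x < R + 1 / n"
    proof -
      have "x \<le> R + 1" using that n1 by linarith
      then show ?thesis using n by (intro mult_left_mono W_mono) auto
    qed
    moreover have "0 < x" if "1 / n < x" using that n1 by linarith
    ultimately show "ennreal (n * W x) * indicator {1/n<..<R + 1/n} x
      \<le> ennreal (n * W x) * indicator {0<..<R} x + ennreal (n * W (R + 1)) * indicator {R..R + 1/n} x"
      using Wn by (auto simp: indicator_def intro!: ennreal_leI)
  qed
  also have "\<dots> = ?A + ennreal (n * W (R + 1)) * emeasure lborel {R..R + 1/n}"
    by (subst nn_integral_add) (auto simp: nn_integral_cmult_indicator)
  also have "ennreal (n * W (R + 1)) * emeasure lborel {R..R + 1/n} = ennreal (W (R + 1))"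
    using n Wn by (simp add: ennreal_mult'[symmetric])
  finally show ?thesis using fin by (auto simp: add.commute ennreal_add_left_cancel_le)
qed

lemma right_deriv_integrable:
  assumes R: "0 \<le> R"
  shows "(\<integral>\<^sup>+ x\<in>{0<..<R}. ennreal (right_deriv W x) \<partial>lborel) < \<infinity>"
proof -
  have "(\<integral>\<^sup>+ x\<in>{0<..<R}. ennreal (right_deriv W x) \<partial>lborel)
    = (\<integral>\<^sup>+ x. liminf (\<lambda>n. ennreal (real (Suc n) * (W (x + 1 / real (Suc n)) - W x)) * indicator {0<..<R} x) \<partial>lborel)"
  proof (rule nn_integral_cong)
    fix x
    show "ennreal (right_deriv W x) * indicator {0<..<R} x =
      liminf (\<lambda>n. ennreal (real (Suc n) * (W (x + 1 / real (Suc n)) - W x)) * indicator {0<..<R} x)"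
    proof (cases "x \<in> {0<..<R}")
      case True
      then have "(\<lambda>n. ennreal (real (Suc n) * (W (x + 1 / real (Suc n)) - W x))) \<longlonglongrightarrow> ennreal (right_deriv W x)"
        by (intro tendsto_ennrealI difference_quotient_tendsto) auto
      then show ?thesis using True by (simp add: lim_imp_Liminf del: of_nat_Suc)
    qed (simp add: Liminf_const)
  qed
  also have "\<dots> \<le> liminf (\<lambda>n. \<integral>\<^sup>+ x. ennreal (real (Suc n) * (W (x + 1 / real (Suc n)) - W x)) * indicator {0<..<R} x \<partial>lborel)"
    by (rule nn_integral_liminf) measurable
  also have "\<dots> \<le> liminf (\<lambda>n::nat. ennreal (W (R + 1)))"
    by (intro Liminf_mono always_eventually allI nn_integral_difference_quotient_le R) auto
  also have "\<dots> = ennreal (W (R + 1))" by (simp add: Liminf_const)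
  also have "\<dots> < \<infinity>" by simp
  finally show ?thesis .
qed

end

section \<open>Linear Volterra equations with a singular kernel\<close>

text \<open>Written with comparisons, the indicator is visibly measurable jointly in the point and
  in the end points, which vary in the iterated integrals.\<close>

lemma indicator_greaterThanLessThan:
  "indicator {u<..<v::real} y = (if u < y \<and> y < v then 1 else (0::'a::zero_neq_one))"
  by (simp add: indicator_def)

lemma nn_integral_convolution:
  fixes G v :: "real \<Rightarrow> ennreal"
  assumes [measurable]: "G \<in> borel_measurable borel" "v \<in> borel_measurable borel"
  shows "(\<integral>\<^sup>+ x. \<integral>\<^sup>+ y. G (x - y) * v y \<partial>lborel \<partial>lborel) = (\<integral>\<^sup>+ t. G t \<partial>lborel) * (\<integral>\<^sup>+ y. v y \<partial>lborel)"
proof -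
  have "(\<integral>\<^sup>+ x. \<integral>\<^sup>+ y. G (x - y) * v y \<partial>lborel \<partial>lborel) = (\<integral>\<^sup>+ y. \<integral>\<^sup>+ x. G (x - y) * v y \<partial>lborel \<partial>lborel)"
    by (rule lborel_pair.Fubini'[symmetric]) measurable
  also have "\<dots> = (\<integral>\<^sup>+ y. (\<integral>\<^sup>+ t. G t \<partial>lborel) * v y \<partial>lborel)"
  proof (rule nn_integral_cong)
    fix y
    have "(\<integral>\<^sup>+ t. G t \<partial>lborel) = (\<integral>\<^sup>+ x. G (x - y) \<partial>lborel)"
      using nn_integral_real_affine[of G 1 "- y"] by simp
    then show "(\<integral>\<^sup>+ x. G (x - y) * v y \<partial>lborel) = (\<integral>\<^sup>+ t. G t \<partial>lborel) * v y"
      by (simp add: nn_integral_multc)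
  qed
  also have "\<dots> = (\<integral>\<^sup>+ t. G t \<partial>lborel) * (\<integral>\<^sup>+ y. v y \<partial>lborel)"
    by (rule nn_integral_cmult) measurable
  finally show ?thesis .
qed

text \<open>Dominated convergence along integer rates, with the undamped integrand as majorant. The
  contraction factor \<open>\<theta>\<close> is thus free to choose, whatever the size of the
  kernel.\<close>

lemma exponential_damping:
  fixes g :: "real \<Rightarrow> real"
  assumes [measurable]: "g \<in> borel_measurable borel" and \<theta>: "0 < \<theta>"
    and fin: "(\<integral>\<^sup>+ t\<in>{0<..<R}. ennreal (g t) \<partial>lborel) < \<infinity>"
  obtains l :: real where "0 \<le> l" "(\<integral>\<^sup>+ t\<in>{0<..<R}. ennreal (exp (- l * t) * g t) \<partial>lborel) \<le> ennreal \<theta>"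
proof -
  have "(\<lambda>n. \<integral>\<^sup>+ t\<in>{0<..<R}. ennreal (exp (- real n * t) * g t) \<partial>lborel) \<longlonglongrightarrow> (\<integral>\<^sup>+ t. 0 \<partial>(lborel :: real measure))"
  proof (rule nn_integral_dominated_convergence)
    show "(\<integral>\<^sup>+ t\<in>{0<..<R}. ennreal (g t) \<partial>lborel) < \<infinity>" by (rule fin)
    show "AE t in lborel. ennreal (exp (- real n * t) * g t) * indicator {0<..<R} t \<le> ennreal (g t) * indicator {0<..<R} t" for n
    proof (rule AE_I2)
      fix t :: real
      show "ennreal (exp (- real n * t) * g t) * indicator {0<..<R} t \<le> ennreal (g t) * indicator {0<..<R} t"
        by (cases "0 \<le> g t") (auto simp: indicator_def ennreal_neg mult_nonneg_nonpos intro!: ennreal_leI mult_left_le_one_le)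
    qed
    show "AE t in lborel. (\<lambda>n. ennreal (exp (- real n * t) * g t) * indicator {0<..<R} t) \<longlonglongrightarrow> 0"
    proof (rule AE_I2)
      fix t :: real
      show "(\<lambda>n. ennreal (exp (- real n * t) * g t) * indicator {0<..<R} t) \<longlonglongrightarrow> 0"
      proof (cases "t \<in> {0<..<R}")
        case True
        have "(\<lambda>n. exp (- t) ^ n * g t) \<longlonglongrightarrow> 0 * g t"
          using True by (intro tendsto_mult_right LIMSEQ_power_zero) auto
        then have "(\<lambda>n. exp (- real n * t) * g t) \<longlonglongrightarrow> 0"
          by (simp add: exp_of_nat_mult[symmetric])
        then have "(\<lambda>n. ennreal (exp (- real n * t) * g t)) \<longlonglongrightarrow> ennreal 0" by (rule tendsto_ennrealI)
        then show ?thesis using True by simp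
      qed simp
    qed
  qed measurable
  then have "(\<lambda>n. \<integral>\<^sup>+ t\<in>{0<..<R}. ennreal (exp (- real n * t) * g t) \<partial>lborel) \<longlonglongrightarrow> 0" by simp
  then have "\<forall>\<^sub>F n in sequentially. (\<integral>\<^sup>+ t\<in>{0<..<R}. ennreal (exp (- real n * t) * g t) \<partial>lborel) < ennreal \<theta>"
    using \<theta> by (intro order_tendstoD) auto
  then obtain n where "(\<integral>\<^sup>+ t\<in>{0<..<R}. ennreal (exp (- real n * t) * g t) \<partial>lborel) < ennreal \<theta>"
    using eventually_happens'[OF trivial_limit_sequentially] by blast
  then show ?thesis by (intro that[of "real n"]) auto
qed

text \<open>The separate dependence of the kernel on \<open>x\<close> and \<open>y\<close> is
  absorbed into \<open>C\<close>, leaving a comparison with a convolution kernel. Condition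
  \<open>g_int\<close> controls averages of \<open>g\<close>, condition \<open>g_le\<close> its
  pointwise size; neither implies the other.\<close>

locale volterra =
  fixes k :: "real \<Rightarrow> real \<Rightarrow> real" and g :: "real \<Rightarrow> real" and a T C B :: real
  assumes k_meas: "(\<lambda>(x, y). k x y) \<in> borel_measurable (borel \<Otimes>\<^sub>M borel)"
    and g_meas[measurable]: "g \<in> borel_measurable borel"
    and C: "0 \<le> C" and B: "0 \<le> B"
    and k_nonneg: "\<And>x y. a < y \<Longrightarrow> y < x \<Longrightarrow> x \<le> T \<Longrightarrow> 0 \<le> k x y"
    and k_le: "\<And>x y. a < y \<Longrightarrow> y < x \<Longrightarrow> x \<le> T \<Longrightarrow> k x y \<le> C * g (x - y)"
    and g_nonneg: "\<And>t. 0 < t \<Longrightarrow> 0 \<le> g t"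
    and g_le: "\<And>t. 0 < t \<Longrightarrow> t \<le> T - a \<Longrightarrow> t^3 * g t \<le> B"
    and g_int: "(\<integral>\<^sup>+ t\<in>{0<..<T - a}. ennreal (g t) \<partial>lborel) < \<infinity>"
begin

lemma k_measurable[measurable (raw)]:
  assumes "f \<in> borel_measurable M" "h \<in> borel_measurable M"
  shows "(\<lambda>p. k (f p) (h p)) \<in> borel_measurable M"
  using measurable_compose[OF measurable_Pair[OF assms] k_meas] by simp

section \<open>Iterated kernels as powers of the Volterra operator\<close>

lemma iterated_kernel_measurable:
  "(\<lambda>p. iterated_kernel k n (fst p) (snd p)) \<in> borel_measurable (borel \<Otimes>\<^sub>M borel)"
proof (induction n)
  case 0
  show ?case by simp
next
  case (Suc n)
  have [measurable (raw)]: "(\<lambda>p. iterated_kernel k n (f p) (h p)) \<in> borel_measurable M"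
    if "f \<in> borel_measurable M" "h \<in> borel_measurable M" for f h and M :: "'z measure"
    using measurable_compose[OF measurable_Pair[OF that] Suc] by simp
  show ?case unfolding iterated_kernel.simps indicator_greaterThanLessThan by measurable
qed

lemma iterated_kernel_measurable'[measurable (raw)]:
  assumes "f \<in> borel_measurable M" "h \<in> borel_measurable M"
  shows "(\<lambda>p. iterated_kernel k n (f p) (h p)) \<in> borel_measurable M"
  using measurable_compose[OF measurable_Pair[OF assms] iterated_kernel_measurable] by simp

text \<open>The Volterra operator on nonnegative functions, valued in \<open>ennreal\<close> so that
  the Neumann series can be rearranged before its finiteness is known.\<close>

definition A :: "(real \<Rightarrow> ennreal) \<Rightarrow> real \<Rightarrow> ennreal" where
  "A f x = (\<integral>\<^sup>+ y\<in>{a<..<x}. (ennreal (k x y) * f y) \<partial>lborel)"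

lemma A_measurable[measurable (raw)]:
  assumes [measurable]: "f \<in> borel_measurable borel"
  shows "A f \<in> borel_measurable borel"
  unfolding A_def[abs_def] indicator_greaterThanLessThan by measurable

lemma A_power_measurable[measurable]: "f \<in> borel_measurable borel \<Longrightarrow> (A ^^ n) f \<in> borel_measurable borel"
  by (induction n) auto

text \<open>The recursion for iterated kernels splits off the factor next to \<open>y\<close>. After
  Fubini the inner integral is therefore \<open>A f\<close>, and the induction has to range over all
  \<open>f\<close>.\<close>

lemma iterated_kernel_integral:
  assumes "f \<in> borel_measurable borel"
  shows "(\<integral>\<^sup>+ y\<in>{a<..<x}. (iterated_kernel k n x y * f y) \<partial>lborel) = (A ^^ Suc n) f x"
  using assms
proof (induction n arbitrary: f)
  case 0
  then show ?case by (simp add: A_def)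
next
  case (Suc n)
  note [measurable] = Suc.prems
  have "(\<integral>\<^sup>+ y\<in>{a<..<x}. (iterated_kernel k (Suc n) x y * f y) \<partial>lborel)
    = (\<integral>\<^sup>+ y. \<integral>\<^sup>+ w. iterated_kernel k n x w * (ennreal (k w y) * f y * indicator {a<..<w} y) * indicator {a<..<x} w \<partial>lborel \<partial>lborel)"
  proof (rule nn_integral_cong)
    fix y
    have "iterated_kernel k (Suc n) x y * f y * indicator {a<..<x} y
       = (\<integral>\<^sup>+ w. iterated_kernel k n x w * ennreal (k w y) * indicator {y<..<x} w * (f y * indicator {a<..<x} y) \<partial>lborel)"
      by (subst nn_integral_multc) (auto simp: mult_ac)
    \<comment> \<open>Both products of indicators describe \<open>a < y < w < x\<close>.\<close>
    also have "\<dots> = (\<integral>\<^sup>+ w. iterated_kernel k n x w * (ennreal (k w y) * f y * indicator {a<..<w} y) * indicator {a<..<x} w \<partial>lborel)"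
      by (intro nn_integral_cong) (auto simp: indicator_def mult_ac)
    finally show "iterated_kernel k (Suc n) x y * f y * indicator {a<..<x} y = \<dots>" .
  qed
  also have "\<dots> = (\<integral>\<^sup>+ w. \<integral>\<^sup>+ y. iterated_kernel k n x w * (ennreal (k w y) * f y * indicator {a<..<w} y) * indicator {a<..<x} w \<partial>lborel \<partial>lborel)"
    unfolding indicator_greaterThanLessThan by (rule lborel_pair.Fubini') measurable
  also have "\<dots> = (\<integral>\<^sup>+ w\<in>{a<..<x}. (iterated_kernel k n x w * A f w) \<partial>lborel)"
    unfolding A_def indicator_greaterThanLessThan
    by (intro nn_integral_cong) (simp add: nn_integral_cmult nn_integral_multc)
  also have "\<dots> = (A ^^ Suc n) (A f) x" by (rule Suc.IH) measurable
  also have "\<dots> = (A ^^ Suc (Suc n)) f x" by (simp add: funpow_swap1)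
  finally show ?case .
qed

lemma resolvent_kernel_integral:
  assumes [measurable]: "f \<in> borel_measurable borel"
  shows "(\<integral>\<^sup>+ y\<in>{a<..<x}. (resolvent_kernel k x y * f y) \<partial>lborel) = (\<Sum>n. (A ^^ Suc n) f x)"
proof -
  have "(\<integral>\<^sup>+ y\<in>{a<..<x}. (resolvent_kernel k x y * f y) \<partial>lborel)
     = (\<integral>\<^sup>+ y. (\<Sum>n. iterated_kernel k n x y * f y * indicator {a<..<x} y) \<partial>lborel)"
    unfolding resolvent_kernel_def by (simp add: ennreal_suminf_multc mult.assoc)
  also have "\<dots> = (\<Sum>n. \<integral>\<^sup>+ y\<in>{a<..<x}. (iterated_kernel k n x y * f y) \<partial>lborel)"
    by (rule nn_integral_suminf) measurable
  finally show ?thesis by (simp add: iterated_kernel_integral del: funpow.simps)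
qed

lemma A_sum:
  assumes [measurable]: "\<And>i. f i \<in> borel_measurable borel"
  shows "A (\<lambda>y. \<Sum>i<n. f i y) x = (\<Sum>i<n::nat. A (f i) x)"
  unfolding A_def by (subst nn_integral_sum[symmetric]) (auto simp: sum_distrib_left sum_distrib_right)

lemma A_suminf:
  assumes [measurable]: "\<And>i. f i \<in> borel_measurable borel"
  shows "A (\<lambda>y. \<Sum>i. f i y) x = (\<Sum>i. A (f i) x)"
  unfolding A_def by (subst nn_integral_suminf[symmetric]) (auto simp: ennreal_suminf_multc ennreal_suminf_cmult)

text \<open>The Neumann series is controlled by two weighted norms: an exponentially damped \<open>L\<^sup>1\<close>
  norm, in which \<open>A\<close> is a contraction, and a supremum norm with weight \<open>(x - a)\<^sup>3\<close>, in which
  the convexity bound \<open>(x - a)\<^sup>3 \<le> 4 (x - y)\<^sup>3 + 4 (y - a)\<^sup>3\<close> trades one factor for the other.\<close>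

lemma neumann_series_finite:
  fixes f :: "real \<Rightarrow> real"
  assumes [measurable]: "f \<in> borel_measurable borel"
    and f0: "\<And>x. a < x \<Longrightarrow> x \<le> T \<Longrightarrow> 0 \<le> f x"
    and fS: "\<And>x. a < x \<Longrightarrow> x \<le> T \<Longrightarrow> (x - a)^3 * f x \<le> S0"
    and fN: "(\<integral>\<^sup>+ x\<in>{a<..<T}. ennreal (f x) \<partial>lborel) < \<infinity>"
    and x: "a < x" "x \<le> T"
  shows "(\<Sum>n. (A ^^ n) (\<lambda>y. ennreal (f y)) x) < \<infinity>"
proof -
  \<comment> \<open>The 8 gives \<open>4 * C * \<theta> \<le> 1 / 2\<close>, where 4 is the constant
    of the cubic inequality; the summand 1 covers \<open>C = 0\<close>.\<close>
  define \<theta> where "\<theta> = 1 / (8 * (C + 1))"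
  have \<theta>: "0 < \<theta>" "4 * C * \<theta> \<le> 1 / 2" using C by (auto simp: \<theta>_def field_simps)
  then have \<theta>2: "C * \<theta> \<le> 1 / 2" using C by simp
  obtain l where l: "0 \<le> l" "(\<integral>\<^sup>+ t\<in>{0<..<T - a}. ennreal (exp (- l * t) * g t) \<partial>lborel) \<le> ennreal \<theta>"
    using exponential_damping[OF g_meas \<theta>(1) g_int] by blast
  define G where "G t = ennreal (exp (- l * t) * g t) * indicator {0<..<T - a} t" for t
  have [measurable]: "G \<in> borel_measurable borel" unfolding G_def[abs_def] by measurable
  have G: "(\<integral>\<^sup>+ t. G t \<partial>lborel) \<le> ennreal \<theta>" using l(2) by (simp add: G_def)
  define E where "E x = exp (- l * (x - a))" for x
  have [measurable]: "E \<in> borel_measurable borel" unfolding E_def[abs_def] by measurable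
  have Epos: "0 < E x" for x by (simp add: E_def)
  have E1: "E x \<le> 1" if "a < x" for x using that l by (simp add: E_def)
  \<comment> \<open>The weight is multiplicative: the decay from \<open>a\<close> to
    \<open>x\<close> is that from \<open>a\<close> to \<open>y\<close> times that from
    \<open>y\<close> to \<open>x\<close>, and the latter damps \<open>g (x - y)\<close>.\<close>
  have Ek: "ennreal (E x) * ennreal (k x y) \<le> ennreal C * (G (x - y) * ennreal (E y))" if "a < y" "y < x" "x \<le> T" for x y
  proof -
    have "E x * k x y \<le> E x * (C * g (x - y))"
      using that Epos[of x] by (intro mult_left_mono k_le) auto
    also have "\<dots> = C * ((exp (- l * (x - y)) * g (x - y)) * E y)"
      unfolding E_def by (simp add: mult_exp_exp algebra_simps)
    finally have "ennreal (E x * k x y) \<le> ennreal (C * ((exp (- l * (x - y)) * g (x - y)) * E y))" by (rule ennreal_leI)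
    moreover have "G (x - y) = ennreal (exp (- l * (x - y)) * g (x - y))" using that by (simp add: G_def)
    ultimately show ?thesis
      using that Epos[of x] Epos[of y] C g_nonneg[of "x - y"] k_nonneg[OF that] by (simp add: ennreal_mult[symmetric])
  qed
  define N0 where "N0 = enn2real (\<integral>\<^sup>+ x\<in>{a<..<T}. ennreal (f x) \<partial>lborel)"
  have N0: "(\<integral>\<^sup>+ x\<in>{a<..<T}. ennreal (f x) \<partial>lborel) = ennreal N0" "0 \<le> N0"
    using fN by (auto simp: N0_def)
  have S0: "0 \<le> S0" using fS[OF x] f0[OF x] x by (smt (verit) mult_nonneg_nonneg zero_le_power)
  \<comment> \<open>The constants solve \<open>N0 + C * \<theta> * N \<le> N\<close> and
    \<open>S0 + 4 * C * (B * N + \<theta> * S) \<le> S\<close>. Doubling is enough, since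
    \<open>N\<close> and \<open>S\<close> reappear on the respective left sides with factors at most
    1/2.\<close>
  define N where "N = 2 * N0"
  define S where "S = 2 * (S0 + 4 * C * B * N)"
  have N: "0 \<le> N" "N0 + C * \<theta> * N \<le> N"
    using N0 mult_right_mono[OF \<theta>2, of N] by (auto simp: N_def)
  have S: "0 \<le> S" "S0 + 4 * C * (B * N + \<theta> * S) \<le> S"
  proof -
    show "0 \<le> S" using S0 C B N by (simp add: S_def)
    then have "4 * C * \<theta> * S \<le> 1/2 * S" by (intro mult_right_mono \<theta>) auto
    then show "S0 + 4 * C * (B * N + \<theta> * S) \<le> S" by (simp add: S_def algebra_simps)
  qed
  \<comment> \<open>Both norms are bounded together because the weighted supremum of
    \<open>A u\<close> also involves the L1 norm of \<open>u\<close>. The property is invariant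
    under adding \<open>f\<close> to \<open>A u\<close>, so it holds for all partial sums of the
    series with the same constants.\<close>
  define P where "P u \<longleftrightarrow> u \<in> borel_measurable borel
    \<and> (\<integral>\<^sup>+ y\<in>{a<..<T}. (ennreal (E y) * u y) \<partial>lborel) \<le> ennreal N
    \<and> (\<forall>x. a < x \<longrightarrow> x \<le> T \<longrightarrow> ennreal ((x - a)^3 * E x) * u x \<le> ennreal S)" for u :: "real \<Rightarrow> ennreal"
  have step: "P (\<lambda>x. ennreal (f x) + A u x)" if "P u" for u
  proof -
    have [measurable]: "u \<in> borel_measurable borel" using that by (simp add: P_def)
    have uN: "(\<integral>\<^sup>+ y\<in>{a<..<T}. (ennreal (E y) * u y) \<partial>lborel) \<le> ennreal N"
      and uS: "ennreal ((x - a)^3 * E x) * u x \<le> ennreal S" if "a < x" "x \<le> T" for x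
      using \<open>P u\<close> that by (auto simp: P_def)
    have uN: "(\<integral>\<^sup>+ y\<in>{a<..<T}. (ennreal (E y) * u y) \<partial>lborel) \<le> ennreal N" using uN x by auto
    have "(\<integral>\<^sup>+ x\<in>{a<..<T}. (ennreal (E x) * A u x) \<partial>lborel)
       \<le> (\<integral>\<^sup>+ x. \<integral>\<^sup>+ y. G (x - y) * (ennreal C * (ennreal (E y) * u y * indicator {a<..<T} y)) \<partial>lborel \<partial>lborel)"
    proof (rule nn_integral_mono)
      fix x
      have "ennreal (E x) * A u x * indicator {a<..<T} x = (\<integral>\<^sup>+ y. (ennreal (E x) * ennreal (k x y)) * u y * indicator {a<..<x} y * indicator {a<..<T} x \<partial>lborel)"
        unfolding A_def by (subst nn_integral_cmult[symmetric], measurable, subst nn_integral_multc[symmetric])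
          (auto simp: mult_ac intro!: nn_integral_cong)
      also have "\<dots> \<le> (\<integral>\<^sup>+ y. G (x - y) * (ennreal C * (ennreal (E y) * u y * indicator {a<..<T} y)) \<partial>lborel)"
      proof (rule nn_integral_mono)
        fix y
        show "(ennreal (E x) * ennreal (k x y)) * u y * indicator {a<..<x} y * indicator {a<..<T} x
          \<le> G (x - y) * (ennreal C * (ennreal (E y) * u y * indicator {a<..<T} y))"
        proof (cases "a < y \<and> y < x \<and> x < T")
          case True
          then have "ennreal (E x) * ennreal (k x y) * u y \<le> ennreal C * (G (x - y) * ennreal (E y)) * u y"
            by (intro mult_right_mono Ek) auto
          then show ?thesis using True by (simp add: mult_ac)
        qed (auto simp: indicator_def)
      qed
      finally show "ennreal (E x) * A u x * indicator {a<..<T} x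
        \<le> (\<integral>\<^sup>+ y. G (x - y) * (ennreal C * (ennreal (E y) * u y * indicator {a<..<T} y)) \<partial>lborel)" .
    qed
    also have "\<dots> = (\<integral>\<^sup>+ t. G t \<partial>lborel) * (\<integral>\<^sup>+ y. ennreal C * (ennreal (E y) * u y * indicator {a<..<T} y) \<partial>lborel)"
      by (rule nn_integral_convolution) measurable
    also have "\<dots> = (\<integral>\<^sup>+ t. G t \<partial>lborel) * (ennreal C * (\<integral>\<^sup>+ y\<in>{a<..<T}. (ennreal (E y) * u y) \<partial>lborel))"
      by (subst nn_integral_cmult) auto
    also have "\<dots> \<le> ennreal \<theta> * (ennreal C * ennreal N)"
      by (intro mult_mono G uN) auto
    also have "\<dots> = ennreal (C * \<theta> * N)" using \<theta> C N by (simp add: ennreal_mult[symmetric] mult_ac)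
    finally have 1: "(\<integral>\<^sup>+ x\<in>{a<..<T}. (ennreal (E x) * A u x) \<partial>lborel) \<le> ennreal (C * \<theta> * N)" .
    have "(\<integral>\<^sup>+ x\<in>{a<..<T}. (ennreal (E x) * ennreal (f x)) \<partial>lborel) \<le> (\<integral>\<^sup>+ x\<in>{a<..<T}. ennreal (f x) \<partial>lborel)"
    proof (rule nn_integral_mono)
      fix x
      show "ennreal (E x) * ennreal (f x) * indicator {a<..<T} x \<le> ennreal (f x) * indicator {a<..<T} x"
        using mult_right_mono[of "ennreal (E x)" 1 "ennreal (f x)"] E1[of x] Epos[of x]
        by (auto simp: indicator_def)
    qed
    then have 2: "(\<integral>\<^sup>+ x\<in>{a<..<T}. (ennreal (E x) * ennreal (f x)) \<partial>lborel) \<le> ennreal N0" using N0 by simp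
    have "(\<integral>\<^sup>+ x\<in>{a<..<T}. (ennreal (E x) * (ennreal (f x) + A u x)) \<partial>lborel)
      = (\<integral>\<^sup>+ x\<in>{a<..<T}. (ennreal (E x) * ennreal (f x)) \<partial>lborel) + (\<integral>\<^sup>+ x\<in>{a<..<T}. (ennreal (E x) * A u x) \<partial>lborel)"
      by (subst nn_integral_add[symmetric]) (auto simp: distrib_left distrib_right)
    also have "\<dots> \<le> ennreal N0 + ennreal (C * \<theta> * N)" by (intro add_mono 1 2)
    also have "\<dots> \<le> ennreal N" using N0 N \<theta> C by (simp add: ennreal_plus[symmetric] ennreal_leI del: ennreal_plus)
    finally have norm1: "(\<integral>\<^sup>+ x\<in>{a<..<T}. (ennreal (E x) * (ennreal (f x) + A u x)) \<partial>lborel) \<le> ennreal N" .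
    have norm2: "ennreal ((x - a)^3 * E x) * (ennreal (f x) + A u x) \<le> ennreal S" if x: "a < x" "x \<le> T" for x
    proof -
      have "ennreal ((x - a)^3 * E x) * A u x = (\<integral>\<^sup>+ y. ennreal ((x - a)^3) * (ennreal (E x) * ennreal (k x y)) * u y * indicator {a<..<x} y \<partial>lborel)"
        unfolding A_def using x Epos[of x]
        by (subst nn_integral_cmult[symmetric]) (auto simp: ennreal_mult mult_ac less_imp_le intro!: nn_integral_cong)
      also have "\<dots> \<le> (\<integral>\<^sup>+ y. ennreal (4 * C * B) * (ennreal (E y) * u y * indicator {a<..<T} y) + ennreal (4 * C * S) * G (x - y) \<partial>lborel)"
      proof (rule nn_integral_mono)
        fix y
        show "ennreal ((x - a)^3) * (ennreal (E x) * ennreal (k x y)) * u y * indicator {a<..<x} y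
           \<le> ennreal (4 * C * B) * (ennreal (E y) * u y * indicator {a<..<T} y) + ennreal (4 * C * S) * G (x - y)"
        proof (cases "a < y \<and> y < x")
          case True
          define p r where "p = x - y" and "r = y - a"
          have pr: "0 < p" "0 < r" "x - a = p + r" "p \<le> T - a" "p < T - a" using True x by (auto simp: p_def r_def)
          \<comment> \<open>This is the difference
            \<open>4 * (p^3 + r^3) - (p + r)^3\<close>.\<close>
          have "0 \<le> 3 * (p + r) * (p - r)^2" using pr by simp
          then have "(p + r)^3 \<le> 4 * (p^3 + r^3)" by (simp add: power2_eq_square power3_eq_cube algebra_simps)
          then have "ennreal ((x - a)^3) \<le> ennreal (4 * (p^3 + r^3))" unfolding pr(3) by (rule ennreal_leI)
          also have "\<dots> = ennreal 4 * (ennreal (p^3) + ennreal (r^3))"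
            using pr by (simp add: ennreal_mult'')
          finally have cube: "ennreal ((x - a)^3) \<le> ennreal 4 * (ennreal (p^3) + ennreal (r^3))" .
          have Gp: "G p = ennreal (exp (- l * p) * g p)" using pr by (simp add: G_def)
          have "exp (- l * p) * (p^3 * g p) \<le> 1 * B"
            using pr l B g_nonneg[of p] g_le[of p] by (intro mult_mono) auto
          then have pB: "ennreal (p^3) * G p \<le> ennreal B"
            unfolding Gp using pr g_nonneg[of p] by (simp add: ennreal_mult[symmetric] ennreal_leI mult_ac)
          have "ennreal (r^3) * ennreal (E y) * u y = ennreal ((y - a)^3 * E y) * u y"
            using pr Epos[of y] by (simp add: r_def ennreal_mult)
          then have rS: "ennreal (r^3) * ennreal (E y) * u y \<le> ennreal S" using uS[of y] True x by simp
          have "ennreal ((x - a)^3) * (ennreal (E x) * ennreal (k x y)) * u y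
              \<le> (ennreal 4 * (ennreal (p^3) + ennreal (r^3))) * (ennreal C * (G p * ennreal (E y))) * u y"
            by (intro mult_right_mono mult_mono[OF cube]) (use True x Ek[of y x] in \<open>auto simp: p_def\<close>)
          \<comment> \<open>In the first summand \<open>p^3\<close> is spent on \<open>G p\<close>,
            which leaves the L1 norm of \<open>u\<close>; in the second \<open>r^3\<close> is spent
            on \<open>u\<close>, which leaves the integral of \<open>G\<close>.\<close>
          also have "\<dots> = ennreal 4 * ennreal C * (ennreal (p^3) * G p) * (ennreal (E y) * u y)
             + ennreal 4 * ennreal C * (ennreal (r^3) * ennreal (E y) * u y) * G p"
            by (simp add: algebra_simps)
          also have "\<dots> \<le> ennreal 4 * ennreal C * ennreal B * (ennreal (E y) * u y) + ennreal 4 * ennreal C * ennreal S * G p"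
            by (intro add_mono mult_right_mono mult_left_mono pB rS) auto
          also have "\<dots> = ennreal (4 * C * B) * (ennreal (E y) * u y) + ennreal (4 * C * S) * G p"
            using C B S by (simp add: ennreal_mult)
          finally show ?thesis using True x by (simp add: p_def)
        qed auto
      qed
      also have "\<dots> = ennreal (4 * C * B) * (\<integral>\<^sup>+ y\<in>{a<..<T}. (ennreal (E y) * u y) \<partial>lborel) + ennreal (4 * C * S) * (\<integral>\<^sup>+ y. G (x - y) \<partial>lborel)"
        by (subst nn_integral_add) (auto simp: nn_integral_cmult)
      also have "(\<integral>\<^sup>+ y. G (x - y) \<partial>lborel) = (\<integral>\<^sup>+ t. G t \<partial>lborel)"
        using nn_integral_real_affine[of G "-1" x] by simp
      also have "ennreal (4 * C * B) * (\<integral>\<^sup>+ y\<in>{a<..<T}. (ennreal (E y) * u y) \<partial>lborel) + ennreal (4 * C * S) * (\<integral>\<^sup>+ t. G t \<partial>lborel)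
         \<le> ennreal (4 * C * B) * ennreal N + ennreal (4 * C * S) * ennreal \<theta>"
        by (intro add_mono mult_left_mono uN G) auto
      also have "\<dots> = ennreal (4 * C * (B * N + \<theta> * S))"
        using C B S N \<theta> by (simp add: ennreal_mult[symmetric] ennreal_plus[symmetric] algebra_simps del: ennreal_plus)
      finally have 3: "ennreal ((x - a)^3 * E x) * A u x \<le> ennreal (4 * C * (B * N + \<theta> * S))" .
      have "(x - a)^3 * E x * f x \<le> S0"
      proof -
        have "E x * ((x - a)^3 * f x) \<le> 1 * S0"
          using x f0[OF x] fS[OF x] E1 by (intro mult_mono) auto
        then show ?thesis by (simp add: mult_ac)
      qed
      then have 4: "ennreal ((x - a)^3 * E x) * ennreal (f x) \<le> ennreal S0"
        using x f0[OF x] Epos[of x] by (simp add: ennreal_mult[symmetric] ennreal_leI)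
      have "ennreal ((x - a)^3 * E x) * (ennreal (f x) + A u x) \<le> ennreal S0 + ennreal (4 * C * (B * N + \<theta> * S))"
        unfolding distrib_left[of "ennreal ((x - a)^3 * E x)"] by (intro add_mono 3 4)
      also have "\<dots> \<le> ennreal S" using S S0 C B N \<theta> by (simp add: ennreal_plus[symmetric] ennreal_leI del: ennreal_plus)
      finally show ?thesis .
    qed
    show ?thesis unfolding P_def using norm1 norm2 by auto
  qed
  let ?f = "\<lambda>y. ennreal (f y)"
  have P: "P (\<lambda>y. \<Sum>i<n. (A ^^ i) ?f y)" for n
  proof (induction n)
    case 0
    then show ?case by (simp add: P_def)
  next
    case (Suc n)
    have "(\<lambda>y. \<Sum>i<Suc n. (A ^^ i) ?f y) = (\<lambda>x. ?f x + A (\<lambda>y. \<Sum>i<n. (A ^^ i) ?f y) x)"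
      by (simp only: sum.lessThan_Suc_shift) (simp add: A_sum)
    then show ?case using step[OF Suc] by simp
  qed
  define e where "e = (x - a)^3 * E x"
  have e: "0 < e" using x Epos[of x] by (simp add: e_def)
  have "(\<Sum>i<n. (A ^^ i) ?f x) \<le> ennreal (S / e)" for n
  proof -
    have "ennreal e * (\<Sum>i<n. (A ^^ i) ?f x) \<le> ennreal S" using P[of n] x by (simp add: P_def e_def)
    then have "ennreal (1 / e) * (ennreal e * (\<Sum>i<n. (A ^^ i) ?f x)) \<le> ennreal (1 / e) * ennreal S"
      by (rule mult_left_mono) simp
    then show ?thesis using e S by (simp add: mult.assoc[symmetric] ennreal_mult[symmetric])
  qed
  then have "(\<Sum>n. (A ^^ n) ?f x) \<le> ennreal (S / e)" by (intro suminf_le_const) auto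
  then show ?thesis using le_less_trans ennreal_less_top by (metis infinity_ennreal_def)
qed

text \<open>The sum \<open>s\<close> satisfies \<open>s = f + A s\<close> in \<open>ennreal\<close>,
  and finiteness at every point turns this into an equation between reals. The set \<open>I\<close>
  may contain \<open>a\<close> or not: the first equation of the theorem excludes its starting point
  and the second includes it.\<close>

lemma neumann_series_solution:
  fixes f :: "real \<Rightarrow> real"
  assumes [measurable]: "f \<in> borel_measurable borel" "I \<in> sets borel" and I: "{a<..T} \<subseteq> I" "I \<subseteq> {a..T}"
    and f0: "\<And>x. a < x \<Longrightarrow> x \<le> T \<Longrightarrow> 0 \<le> f x"
    and fS: "\<And>x. a < x \<Longrightarrow> x \<le> T \<Longrightarrow> (x - a)^3 * f x \<le> S0"
    and fN: "(\<integral>\<^sup>+ x\<in>{a<..<T}. ennreal (f x) \<partial>lborel) < \<infinity>"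
  shows "a < x \<Longrightarrow> x \<le> T \<Longrightarrow> (\<integral>\<^sup>+ y\<in>{a<..<x}. (resolvent_kernel k x y * ennreal (f y)) \<partial>lborel) < \<infinity>"
    and "volterra_solution I a f k
       (\<lambda>x. f x + enn2real (\<integral>\<^sup>+ y\<in>{a<..<x}. (resolvent_kernel k x y * ennreal (f y)) \<partial>lborel))"
proof -
  let ?f = "\<lambda>y. ennreal (f y)"
  define s where "s x = (\<Sum>n. (A ^^ n) ?f x)" for x
  have As: "A s x = (\<Sum>n. (A ^^ Suc n) ?f x)" for x
    unfolding s_def by (subst A_suminf) auto
  have R: "(\<integral>\<^sup>+ y\<in>{a<..<x}. (resolvent_kernel k x y * ?f y) \<partial>lborel) = A s x" for x
    unfolding As by (rule resolvent_kernel_integral) measurable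
  have s_split: "s x = ?f x + A s x" for x
    using suminf_offset[of "\<lambda>n. (A ^^ n) ?f x" 1] unfolding s_def[of x] As by simp
  have fin: "s x < \<infinity>" if "a < x" "x \<le> T" for x
    unfolding s_def by (rule neumann_series_finite[OF _ f0 fS fN that]) auto
  have fin2: "A s x < \<infinity>" if "a < x" "x \<le> T" for x
  proof -
    have "A s x \<le> s x" by (simp only: s_split[of x]) simp
    then show ?thesis using fin[OF that] by (rule le_less_trans)
  qed
  then show "(\<integral>\<^sup>+ y\<in>{a<..<x}. (resolvent_kernel k x y * ?f y) \<partial>lborel) < \<infinity>" if "a < x" "x \<le> T"
    using that unfolding R by auto
  define F where "F x = f x + enn2real (A s x)" for x
  have [measurable]: "s \<in> borel_measurable borel" unfolding s_def[abs_def] by measurable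
  have [measurable]: "F \<in> borel_measurable borel" unfolding F_def[abs_def] by measurable
  have F0: "0 \<le> F x" if "a < x" "x \<le> T" for x using f0[OF that] by (simp add: F_def)
  have Fs: "ennreal (F x) = s x" if "a < x" "x \<le> T" for x
    using f0[OF that] fin2[OF that] by (simp add: F_def s_split[of x])
  have "volterra_solution I a f k F"
    unfolding volterra_solution_def
  proof (intro conjI ballI)
    show "set_borel_measurable borel I F" unfolding set_borel_measurable_def by measurable
    fix x assume "x \<in> I"
    then have x: "a \<le> x" "x \<le> T" using I by auto
    have pos: "0 \<le> indicator {a<..<x} y * (k x y * F y)" for y
      using x k_nonneg[of y x] F0[of y] by (auto simp: indicator_def)
    have eq: "(\<integral>\<^sup>+ y. ennreal (indicator {a<..<x} y * (k x y * F y)) \<partial>lborel) = A s x"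
      unfolding A_def
    proof (rule nn_integral_cong)
      fix y
      show "ennreal (indicator {a<..<x} y * (k x y * F y)) = ennreal (k x y) * s y * indicator {a<..<x} y"
        using x k_nonneg[of y x] F0[of y] Fs[of y] by (auto simp: indicator_def ennreal_mult)
    qed
    have "A s a = 0" by (simp add: A_def)
    then have "A s x < \<infinity>" using fin2[of x] x by (cases "x = a") auto
    then have "has_bochner_integral lborel (\<lambda>y. indicator {a<..<x} y *\<^sub>R (k x y * F y)) (enn2real (A s x))"
      using pos by (intro has_bochner_integral_nn_integral) (auto simp: eq)
    then show "set_integrable lborel {a<..<x} (\<lambda>y. k x y * F y)"
      and "F x = f x + (LBINT y:{a<..<x}. k x y * F y)"
      by (auto simp: set_integrable_def set_lebesgue_integral_def has_bochner_integral_iff F_def)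
  qed
  then show "volterra_solution I a f k
       (\<lambda>x. f x + enn2real (\<integral>\<^sup>+ y\<in>{a<..<x}. (resolvent_kernel k x y * ?f y) \<partial>lborel))"
    unfolding R F_def .
qed

text \<open>A solution need not be integrable a priori. But \<open>k(x',\<cdot>) e\<close> is integrable for a point
  \<open>x' > x\<close>, and \<open>g\<close> is bounded away from \<open>0\<close> on compact subsets of \<open>(0, \<delta>]\<close>; this makes
  \<open>\<phi> e\<close> integrable on \<open>(s, x)\<close> for \<open>x < s + \<delta>\<close>, and uniqueness propagates in steps of length \<open>\<delta>\<close>.\<close>

lemma homogeneous_solution_eq_0:
  fixes e \<alpha> \<phi> :: "real \<Rightarrow> real"
  assumes I: "{a<..T} \<subseteq> I" "I \<subseteq> {a..T}"
    and e: "volterra_solution I a (\<lambda>_. 0) k e"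
    and k: "\<And>x y. a < y \<Longrightarrow> y < x \<Longrightarrow> x \<le> T \<Longrightarrow> k x y = \<alpha> x * \<phi> y * g (x - y)"
    and [measurable]: "\<phi> \<in> borel_measurable borel"
    and \<alpha>: "\<And>x. x \<le> T \<Longrightarrow> 0 < \<alpha> x" and \<phi>: "\<And>x. 0 \<le> \<phi> x"
    and \<phi>\<alpha>: "\<And>x. x \<le> T \<Longrightarrow> \<phi> x * \<alpha> x \<le> D"
    and g: "(\<forall>t>0. g t = 0) \<or> (\<exists>\<delta>>0. \<forall>\<epsilon>>0. \<exists>c>0. \<forall>t. \<epsilon> \<le> t \<longrightarrow> t \<le> \<delta> \<longrightarrow> c \<le> g t)"
    and x: "x \<in> I"
  shows "e x = 0"
proof -
  have e_int: "set_integrable lborel {a<..<x} (\<lambda>y. k x y * e y)"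
    and e_eq: "e x = (LBINT y:{a<..<x}. k x y * e y)" if "x \<in> I" for x
    using e that by (auto simp: volterra_solution_def)
  have e_zero: "e x = 0" if x: "x \<in> I" and z: "AE y in lborel. a < y \<longrightarrow> y < x \<longrightarrow> k x y * e y = 0" for x
  proof -
    have "(LBINT y:{a<..<x}. k x y * e y) = 0"
      unfolding set_lebesgue_integral_def
    proof (rule integral_eq_zero_AE)
      show "AE y in lborel. indicator {a<..<x} y *\<^sub>R (k x y * e y) = 0"
        using z by eventually_elim (auto simp: indicator_def)
    qed
    then show ?thesis using e_eq[OF x] by simp
  qed
  show ?thesis
  proof (cases "\<forall>t>0. g t = 0")
    case True
    show ?thesis using True I x by (intro e_zero[OF x] AE_I2) (auto simp: k)
  next
    case False
    then obtain \<delta> where \<delta>: "0 < \<delta>" "\<And>\<epsilon>. 0 < \<epsilon> \<Longrightarrow> \<exists>c>0. \<forall>t. \<epsilon> \<le> t \<longrightarrow> t \<le> \<delta> \<longrightarrow> c \<le> g t" using g by blast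
    \<comment> \<open>As in the convergence proof, damping produces a contraction; the factor is
      \<open>\<bar>D\<bar> * \<theta> \<le> 1 / 2\<close>, where \<open>D\<close> bounds
      \<open>\<phi> * \<alpha>\<close>.\<close>
    define \<theta> where "\<theta> = 1 / (2 * (\<bar>D\<bar> + 1))"
    have \<theta>: "0 < \<theta>" "\<bar>D\<bar> * \<theta> \<le> 1 / 2" by (auto simp: \<theta>_def field_simps)
    obtain l where l: "0 \<le> l" "(\<integral>\<^sup>+ t\<in>{0<..<T - a}. ennreal (exp (- l * t) * g t) \<partial>lborel) \<le> ennreal \<theta>"
      using exponential_damping[OF g_meas \<theta>(1) g_int] by blast
    define G where "G t = ennreal (exp (- l * t) * g t) * indicator {0<..<T - a} t" for t
    have [measurable]: "G \<in> borel_measurable borel" unfolding G_def[abs_def] by measurable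
    have G: "(\<integral>\<^sup>+ t. G t \<partial>lborel) \<le> ennreal \<theta>" using l(2) by (simp add: G_def)
    \<comment> \<open>The solution is measurable on \<open>I\<close> only, hence the extension by
      0.\<close>
    define e' where "e' y = indicator I y *\<^sub>R e y" for y
    have [measurable]: "e' \<in> borel_measurable borel"
      using e unfolding e'_def[abs_def] by (simp add: volterra_solution_def set_borel_measurable_def)
    have e': "e' y = e y" if "a < y" "y \<le> T" for y using that I by (auto simp: e'_def indicator_def)
    \<comment> \<open>Only the product with \<open>\<phi>\<close> enters the equation; where
      \<open>\<phi>\<close> vanishes, \<open>e\<close> itself need not be integrable.\<close>
    define u where "u y = ennreal (\<phi> y * \<bar>e' y\<bar>)" for y
    have [measurable]: "u \<in> borel_measurable borel" unfolding u_def[abs_def] by measurable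
    have ke: "ennreal \<bar>k z y * e y\<bar> = ennreal (\<alpha> z) * (ennreal (g (z - y)) * u y)" if "a < y" "y < z" "z \<le> T" for z y
      using that \<alpha>[of z] \<phi>[of y] g_nonneg[of "z - y"] e'[of y]
      by (simp add: k abs_mult u_def ennreal_mult[symmetric] mult_ac)
    have step: "\<forall>y. a < y \<longrightarrow> y \<le> min T (s + \<delta>) \<longrightarrow> e y = 0"
      if s: "a \<le> s" "s < T" and z: "\<And>y. a < y \<Longrightarrow> y \<le> s \<Longrightarrow> e y = 0" for s
    proof -
      define s' where "s' = min T (s + \<delta>)"
      have s': "s < s'" "s' \<le> T" "s' \<le> s + \<delta>" using s \<delta> by (auto simp: s'_def)
      have u0: "AE y in lborel. s < y \<longrightarrow> y < x \<longrightarrow> u y = 0" if x: "s < x" "x < s'" for x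
      proof -
        \<comment> \<open>The midpoint has distance at least \<open>x' - x\<close> and at most
          \<open>\<delta>\<close> from every \<open>y\<close> in \<open>(s, x)\<close>, the range in
          which \<open>c\<close> bounds \<open>g\<close> from below.\<close>
        define x' where "x' = (x + s') / 2"
        have x': "x < x'" "x' < s'" "x' \<le> T" "a < x'" using x s' s by (auto simp: x'_def)
        obtain c where c: "0 < c" "\<And>t. x' - x \<le> t \<Longrightarrow> t \<le> \<delta> \<Longrightarrow> c \<le> g t" using \<delta>(2)[of "x' - x"] x' by auto
        have x'I: "x' \<in> I" using x' I by auto
        have "(\<integral>\<^sup>+ y\<in>{s<..<x}. u y \<partial>lborel)
          \<le> (\<integral>\<^sup>+ y. ennreal (1 / (\<alpha> x' * c)) * ennreal (norm (indicator {a<..<x'} y *\<^sub>R (k x' y * e y))) \<partial>lborel)"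
        proof (rule nn_integral_mono)
          fix y
          show "u y * indicator {s<..<x} y \<le> ennreal (1 / (\<alpha> x' * c)) * ennreal (norm (indicator {a<..<x'} y *\<^sub>R (k x' y * e y)))"
          proof (cases "y \<in> {s<..<x}")
            case True
            then have y: "a < y" "y < x'" "y < x" "y \<le> T" using s x x' by auto
            have "c \<le> g (x' - y)" using True x' s' by (intro c) auto
            then have "c * (\<alpha> x' * (\<phi> y * \<bar>e y\<bar>)) \<le> g (x' - y) * (\<alpha> x' * (\<phi> y * \<bar>e y\<bar>))"
              using \<alpha>[of x'] \<phi>[of y] x' by (intro mult_right_mono) auto
            also have "\<dots> = \<bar>k x' y * e y\<bar>"
              using y x' \<alpha>[of x'] \<phi>[of y] g_nonneg[of "x' - y"] by (simp add: k abs_mult mult_ac)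
            finally have "\<phi> y * \<bar>e y\<bar> \<le> 1 / (\<alpha> x' * c) * \<bar>k x' y * e y\<bar>"
              using \<alpha>[of x'] x' c(1) by (simp add: field_simps)
            then have "ennreal (\<phi> y * \<bar>e y\<bar>) \<le> ennreal (1 / (\<alpha> x' * c)) * ennreal \<bar>k x' y * e y\<bar>"
              using \<alpha>[of x'] x' c(1) by (simp add: ennreal_mult[symmetric] ennreal_leI del: times_divide_eq_left)
            then show ?thesis using True y by (simp add: u_def e')
          qed simp
        qed
        also have "\<dots> = ennreal (1 / (\<alpha> x' * c)) * (\<integral>\<^sup>+ y. ennreal (norm (indicator {a<..<x'} y *\<^sub>R (k x' y * e y))) \<partial>lborel)"
          using e_int[OF x'I] unfolding set_integrable_def by (intro nn_integral_cmult) auto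
        also have "\<dots> < \<infinity>"
          using e_int[OF x'I] unfolding set_integrable_def integrable_iff_bounded by (simp add: ennreal_mult_less_top)
        finally have U: "(\<integral>\<^sup>+ y\<in>{s<..<x}. u y \<partial>lborel) < \<infinity>" .
        \<comment> \<open>Since \<open>e\<close> vanishes up to \<open>s\<close>, the homogeneous
          equation bounds \<open>v\<close> by \<open>\<bar>D\<bar>\<close> times its convolution
          with \<open>G\<close>. Integrated, this gives \<open>V \<le> V / 2\<close> for the finite
          mass \<open>V\<close> of \<open>v\<close>, so \<open>V = 0\<close>.\<close>
        define v where "v y = ennreal (exp (- l * (y - s))) * u y * indicator {s<..<x} y" for y
        have [measurable]: "v \<in> borel_measurable borel" unfolding v_def[abs_def] by measurable
        have "(\<integral>\<^sup>+ y. v y \<partial>lborel) \<le> (\<integral>\<^sup>+ y\<in>{s<..<x}. u y \<partial>lborel)"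
        proof (rule nn_integral_mono)
          fix y
          have "ennreal (exp (- l * (y - s))) \<le> 1" if "s < y" using that l by simp
          then show "v y \<le> u y * indicator {s<..<x} y"
            using mult_right_mono[of "ennreal (exp (- l * (y - s)))" 1 "u y"] by (auto simp: v_def indicator_def)
        qed
        then have vfin: "(\<integral>\<^sup>+ y. v y \<partial>lborel) < \<infinity>" using U by (rule le_less_trans)
        have "(\<integral>\<^sup>+ z. v z \<partial>lborel) \<le> (\<integral>\<^sup>+ z. \<integral>\<^sup>+ y. G (z - y) * (ennreal \<bar>D\<bar> * v y) \<partial>lborel \<partial>lborel)"
        proof (rule nn_integral_mono)
          fix w
          show "v w \<le> (\<integral>\<^sup>+ y. G (w - y) * (ennreal \<bar>D\<bar> * v y) \<partial>lborel)"
          proof (cases "w \<in> {s<..<x}")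
            case True
            then have w: "s < w" "w < x" "a < w" "w \<le> T" "w \<in> I" using s x s' I by auto
            have "ennreal \<bar>e w\<bar> = ennreal (norm (LBINT y:{a<..<w}. k w y * e y))" using e_eq[OF w(5)] by simp
            also have "\<dots> \<le> (\<integral>\<^sup>+ y. ennreal (norm (indicator {a<..<w} y *\<^sub>R (k w y * e y))) \<partial>lborel)"
              using e_int[OF w(5)] unfolding set_lebesgue_integral_def set_integrable_def
              by (intro integral_norm_bound_ennreal) auto
            also have "\<dots> = (\<integral>\<^sup>+ y. ennreal (\<alpha> w) * (ennreal (g (w - y)) * u y * indicator {s<..<w} y) \<partial>lborel)"
            proof (rule nn_integral_cong)
              fix y
              show "ennreal (norm (indicator {a<..<w} y *\<^sub>R (k w y * e y))) = ennreal (\<alpha> w) * (ennreal (g (w - y)) * u y * indicator {s<..<w} y)"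
                using ke[of y w] z[of y] w s by (cases "a < y"; cases "y < w"; cases "s < y") auto
            qed
            also have "\<dots> = ennreal (\<alpha> w) * (\<integral>\<^sup>+ y. ennreal (g (w - y)) * u y * indicator {s<..<w} y \<partial>lborel)"
              by (rule nn_integral_cmult) measurable
            finally have ew: "ennreal \<bar>e w\<bar> \<le> ennreal (\<alpha> w) * (\<integral>\<^sup>+ y. ennreal (g (w - y)) * u y * indicator {s<..<w} y \<partial>lborel)" .
            have "v w = ennreal (exp (- l * (w - s))) * ennreal (\<phi> w) * ennreal \<bar>e w\<bar>"
              using True w \<phi>[of w] by (simp add: v_def u_def e' ennreal_mult mult_ac)
            also have "\<dots> \<le> ennreal (exp (- l * (w - s))) * ennreal (\<phi> w) *
              (ennreal (\<alpha> w) * (\<integral>\<^sup>+ y. ennreal (g (w - y)) * u y * indicator {s<..<w} y \<partial>lborel))"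
              by (intro mult_left_mono ew) auto
            also have "\<dots> = ennreal (\<phi> w * \<alpha> w) * (\<integral>\<^sup>+ y. ennreal (exp (- l * (w - s))) * (ennreal (g (w - y)) * u y * indicator {s<..<w} y) \<partial>lborel)"
              using \<phi>[of w] \<alpha>[of w] w by (subst nn_integral_cmult) (auto simp: ennreal_mult mult_ac)
            also have "\<dots> \<le> ennreal \<bar>D\<bar> * (\<integral>\<^sup>+ y. G (w - y) * v y \<partial>lborel)"
            proof (rule mult_mono[OF _ nn_integral_mono])
              show "ennreal (\<phi> w * \<alpha> w) \<le> ennreal \<bar>D\<bar>" using \<phi>\<alpha>[of w] w by (intro ennreal_leI) auto
              fix y
              show "ennreal (exp (- l * (w - s))) * (ennreal (g (w - y)) * u y * indicator {s<..<w} y) \<le> G (w - y) * v y"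
              proof (cases "y \<in> {s<..<w}")
                case True
                then have y: "s < y" "y < w" "0 < w - y" "w - y < T - a" using w s by auto
                have "exp (- l * (w - s)) = exp (- l * (w - y)) * exp (- l * (y - s))"
                  by (simp add: mult_exp_exp algebra_simps)
                then show ?thesis using y w g_nonneg[of "w - y"]
                  by (simp add: G_def v_def ennreal_mult mult_ac)
              qed simp
            qed auto
            also have "\<dots> = (\<integral>\<^sup>+ y. G (w - y) * (ennreal \<bar>D\<bar> * v y) \<partial>lborel)"
              by (subst nn_integral_cmult[symmetric]) (auto simp: mult_ac)
            finally show ?thesis .
          qed (simp add: v_def)
        qed
        also have "\<dots> = (\<integral>\<^sup>+ t. G t \<partial>lborel) * (\<integral>\<^sup>+ y. ennreal \<bar>D\<bar> * v y \<partial>lborel)"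
          by (rule nn_integral_convolution) measurable
        also have "\<dots> = (\<integral>\<^sup>+ t. G t \<partial>lborel) * (ennreal \<bar>D\<bar> * (\<integral>\<^sup>+ y. v y \<partial>lborel))"
          by (subst nn_integral_cmult) auto
        also have "\<dots> \<le> ennreal \<theta> * (ennreal \<bar>D\<bar> * (\<integral>\<^sup>+ y. v y \<partial>lborel))"
          by (intro mult_right_mono G) auto
        also have "\<dots> = ennreal (\<bar>D\<bar> * \<theta>) * (\<integral>\<^sup>+ y. v y \<partial>lborel)" using \<theta> by (simp add: ennreal_mult mult_ac)
        also have "\<dots> \<le> ennreal (1/2) * (\<integral>\<^sup>+ y. v y \<partial>lborel)" by (intro mult_right_mono ennreal_leI \<theta>) auto
        finally have "(\<integral>\<^sup>+ z. v z \<partial>lborel) \<le> ennreal (1/2) * (\<integral>\<^sup>+ y. v y \<partial>lborel)" .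
        moreover obtain V where V: "(\<integral>\<^sup>+ z. v z \<partial>lborel) = ennreal V" "0 \<le> V" using vfin by (cases "\<integral>\<^sup>+ z. v z \<partial>lborel") auto
        ultimately have "V \<le> 1/2 * V" by (simp add: ennreal_mult[symmetric] del: ennreal_half)
        then have "(\<integral>\<^sup>+ z. v z \<partial>lborel) = 0" using V by simp
        then have "AE y in lborel. v y = 0" by (subst (asm) nn_integral_0_iff_AE) auto
        then show ?thesis by eventually_elim (auto simp: v_def indicator_def)
      qed
      \<comment> \<open>From almost everywhere to everywhere: the integral in the equation at
        \<open>w\<close> does not see null sets. The end point \<open>s'\<close> follows because its
        equation integrates over smaller points only.\<close>
      have e0: "e w = 0" if "a < w" "w < s'" for w
      proof (cases "w \<le> s")
        case False
        have wT: "w \<le> T" "w \<in> I" using that s' I by auto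
        have "AE y in lborel. s < y \<longrightarrow> y < w \<longrightarrow> u y = 0" using False that by (intro u0) auto
        then show ?thesis
        proof (intro e_zero wT, eventually_elim)
          case (elim y)
          show ?case
          proof (intro impI)
            assume y: "a < y" "y < w"
            then show "k w y * e y = 0" using elim ke[of y w] z[of y] wT by (cases "y \<le> s") auto
          qed
        qed
      qed (use z that in auto)
      moreover have "e s' = 0" using e0 s s' I by (intro e_zero AE_I2) auto
      ultimately show ?thesis unfolding s'_def[symmetric] by (auto simp: le_less)
    qed
    have all: "a < T \<Longrightarrow> \<forall>y. a < y \<longrightarrow> y \<le> min T (a + real n * \<delta>) \<longrightarrow> e y = 0" for n
    proof (induction n)
      case (Suc n)
      show ?case
      proof (cases "a + real n * \<delta> < T")
        case True
        have "\<forall>y. a < y \<longrightarrow> y \<le> min T (a + real n * \<delta> + \<delta>) \<longrightarrow> e y = 0"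
          using True \<delta>(1) Suc by (intro step) auto
        then show ?thesis by (simp add: algebra_simps)
      next
        case False
        then show ?thesis using Suc by auto
      qed
    qed auto
    show ?thesis
    proof (cases "x = a")
      case True
      then show ?thesis by (intro e_zero[OF x] AE_I2) auto
    next
      case False
      then have "a < x" "x \<le> T" using x I by auto
      obtain n where "(T - a) / \<delta> < real n" using reals_Archimedean2 by blast
      then have "T \<le> a + real n * \<delta>" using \<delta>(1) by (simp add: field_simps)
      then show ?thesis using all[of n] \<open>a < x\<close> \<open>x \<le> T\<close> by auto
    qed
  qed
qed

end

section \<open>The Volterra equations of the scale function\<close>

lemma volterra_solution_diff:
  assumes "volterra_solution I a f k h1" "volterra_solution I a f k h2"
  shows "volterra_solution I a (\<lambda>_. 0) k (\<lambda>x. h1 x - h2 x)"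
  using assms unfolding volterra_solution_def set_borel_measurable_def
  by (auto simp: right_diff_distrib set_integral_diff intro!: borel_measurable_diff)

context scale
begin

lemma volterra_scale_kernel:
  assumes mono: "mono \<phi>" and phi0: "\<And>x. 0 \<le> \<phi> x" and Wphi: "\<And>x. W 0 * \<phi> x < 1"
  obtains C B where "volterra (volterra_kernel W \<phi>) (right_deriv W) a T C B"
proof -
  have Xi: "0 < Xi W \<phi> x" "x \<le> T \<Longrightarrow> inverse (Xi W \<phi> x) \<le> inverse (Xi W \<phi> T)" for x
    using Wphi[of x] Wphi[of T] W_nonneg[of 0] monoD[OF mono, of x T] by (auto simp: Xi_def mult_left_mono)
  have [measurable]: "\<phi> \<in> borel_measurable borel" using mono by (rule borel_measurable_mono)
  \<comment> \<open>The cubic bound is stated for a positive radius, while \<open>T - a\<close> may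
    be nonpositive.\<close>
  obtain B where B: "0 \<le> B" "\<And>t. 0 < t \<Longrightarrow> t \<le> max (T - a) 1 \<Longrightarrow> t^3 * right_deriv W t \<le> B"
    using right_deriv_cubic_bound[of "max (T - a) 1"] less_max_iff_disj zero_less_one by metis
  have "volterra (volterra_kernel W \<phi>) (right_deriv W) a T (inverse (Xi W \<phi> T) * \<phi> T) B"
  proof
    show "(\<lambda>(x, y). volterra_kernel W \<phi> x y) \<in> borel_measurable (borel \<Otimes>\<^sub>M borel)"
      unfolding volterra_kernel_def Xi_def split_beta' by measurable
    show "0 \<le> inverse (Xi W \<phi> T) * \<phi> T" using Xi(1)[of T] phi0[of T] by simp
    fix x y assume xy: "a < y" "y < x" "x \<le> T"
    show "0 \<le> volterra_kernel W \<phi> x y"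
      using Xi(1)[of x] phi0[of y] right_deriv_nonneg[of "x - y"] xy by (simp add: volterra_kernel_def)
    show "volterra_kernel W \<phi> x y \<le> inverse (Xi W \<phi> T) * \<phi> T * right_deriv W (x - y)"
      unfolding volterra_kernel_def using xy Xi(1)[of x] Xi(1)[of T] Xi(2)[of x] phi0[of y]
      by (intro mult_right_mono mult_mono right_deriv_nonneg monoD[OF mono]) auto
  next
    show "(\<integral>\<^sup>+ t\<in>{0<..<T - a}. ennreal (right_deriv W t) \<partial>lborel) < \<infinity>"
      using right_deriv_integrable[of "T - a"] by (cases "0 \<le> T - a") auto
  qed (use B right_deriv_nonneg in auto)
  then show ?thesis by (rule that)
qed

lemma unique_volterra_scale_solution:
  assumes mono: "mono \<phi>" and phi0: "\<And>x. 0 \<le> \<phi> x" and Wphi: "\<And>x. W 0 * \<phi> x < 1"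
    and f_meas: "f \<in> borel_measurable borel" "I \<in> sets borel" and I: "{a<..T} \<subseteq> I" "I \<subseteq> {a..T}"
    and f0: "\<And>x. a < x \<Longrightarrow> x \<le> T \<Longrightarrow> 0 \<le> f x"
    and fS: "\<And>x. a < x \<Longrightarrow> x \<le> T \<Longrightarrow> (x - a)^3 * f x \<le> S0"
    and fN: "(\<integral>\<^sup>+ x\<in>{a<..<T}. ennreal (f x) \<partial>lborel) < \<infinity>"
  shows "a < x \<Longrightarrow> x \<le> T \<Longrightarrow>
      (\<integral>\<^sup>+ y\<in>{a<..<x}. (resolvent_kernel (volterra_kernel W \<phi>) x y * ennreal (f y)) \<partial>lborel) < \<infinity>"
    and "unique_volterra_solution I a f (volterra_kernel W \<phi>) (\<lambda>x. f x + enn2real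
      (\<integral>\<^sup>+ y\<in>{a<..<x}. (resolvent_kernel (volterra_kernel W \<phi>) x y * ennreal (f y)) \<partial>lborel))"
proof -
  obtain C B where "volterra (volterra_kernel W \<phi>) (right_deriv W) a T C B"
    using volterra_scale_kernel[OF mono phi0 Wphi] by metis
  then interpret volterra "volterra_kernel W \<phi>" "right_deriv W" a T C B .
  note sol = neumann_series_solution[OF f_meas I f0 fS fN]
  show "a < x \<Longrightarrow> x \<le> T \<Longrightarrow>
      (\<integral>\<^sup>+ y\<in>{a<..<x}. (resolvent_kernel (volterra_kernel W \<phi>) x y * ennreal (f y)) \<partial>lborel) < \<infinity>"
    by (rule sol(1))
  let ?F = "\<lambda>x. f x + enn2real
      (\<integral>\<^sup>+ y\<in>{a<..<x}. (resolvent_kernel (volterra_kernel W \<phi>) x y * ennreal (f y)) \<partial>lborel)"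
  have solF: "volterra_solution I a f (volterra_kernel W \<phi>) ?F" by (rule sol(2))
  moreover have "h x = ?F x" if h: "volterra_solution I a f (volterra_kernel W \<phi>) h" and x: "x \<in> I" for h x
  proof -
    have "h x - ?F x = 0"
    proof (rule homogeneous_solution_eq_0[OF I volterra_solution_diff[OF h solF] _ _ _ _ _ _ x])
      show "volterra_kernel W \<phi> x y = inverse (Xi W \<phi> x) * \<phi> y * right_deriv W (x - y)" for x y
        by (simp add: volterra_kernel_def)
      show "\<phi> \<in> borel_measurable borel" using mono by (rule borel_measurable_mono)
      show "0 < inverse (Xi W \<phi> x)" for x using Wphi[of x] by (simp add: Xi_def)
      \<comment> \<open>Both factors are nondecreasing in \<open>x\<close>, so the product is
        bounded by its value at \<open>T\<close>.\<close>
      show "\<phi> x * inverse (Xi W \<phi> x) \<le> \<phi> T * inverse (Xi W \<phi> T)" if "x \<le> T" for x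
        using that Wphi[of x] Wphi[of T] W_nonneg[of 0] monoD[OF mono, of x T] phi0
        by (intro mult_mono) (auto simp: Xi_def mult_left_mono)
      show "(\<forall>t>0. right_deriv W t = 0) \<or>
         (\<exists>\<delta>>0. \<forall>\<epsilon>>0. \<exists>c>0. \<forall>t. \<epsilon> \<le> t \<longrightarrow> t \<le> \<delta> \<longrightarrow> c \<le> right_deriv W t)"
      proof (cases "\<forall>t>0. right_deriv W t = 0")
        case False
        then obtain t0 where "0 < t0" "0 < right_deriv W t0" using right_deriv_nonneg by fastforce
        then show ?thesis using right_deriv_lower_bound by metis
      qed simp
    qed (use phi0 in auto)
    then show ?thesis by simp
  qed
  ultimately show "unique_volterra_solution I a f (volterra_kernel W \<phi>) ?F"
    by (simp add: unique_volterra_solution_def)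
qed

end

theorem proposition26:
  fixes M :: "'a measure" and X :: "real \<Rightarrow> 'a \<Rightarrow> real"
    and \<gamma> \<sigma> q d T :: real and \<nu> :: "real measure"
    and W \<phi> :: "real \<Rightarrow> real"
  assumes X: "spectrally_negative_levy M X \<gamma> \<sigma> \<nu>"
    and q: "0 \<le> q"
    and W: "scale_function (laplace_exponent \<gamma> \<sigma> \<nu>) q W"
    and phi: "rate_function \<phi>"
    and phi_drift: "bounded_variation_case \<sigma> \<nu> \<Longrightarrow> (\<forall>x. \<phi> x < drift \<gamma> \<nu>)"
    and T: "0 < T"
  shows
    "(\<forall>x. d < x \<and> x \<le> T \<longrightarrow>
        (\<integral>\<^sup>+ y\<in>{d<..<x}. (resolvent_kernel (volterra_kernel W \<phi>) x y *
           ennreal (inverse (Xi W \<phi> x) * right_deriv W (y - d))) \<partial>lborel) < \<infinity> \<and>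
        (\<integral>\<^sup>+ y\<in>{d<..<x}. (resolvent_kernel (volterra_kernel W \<phi>) x y *
           ennreal (inverse (Xi W \<phi> y) * right_deriv W (y - d))) \<partial>lborel) < \<infinity>) \<and>
     unique_volterra_solution {d<..T} d
       (\<lambda>x. inverse (Xi W \<phi> x) * right_deriv W (x - d)) (volterra_kernel W \<phi>)
       (\<lambda>x. inverse (Xi W \<phi> x) * right_deriv W (x - d) +
          enn2real (\<integral>\<^sup>+ y\<in>{d<..<x}. (resolvent_kernel (volterra_kernel W \<phi>) x y *
            ennreal (inverse (Xi W \<phi> y) * right_deriv W (y - d))) \<partial>lborel)) \<and>
     (\<forall>x. 0 \<le> x \<and> x \<le> T \<longrightarrow>
        (\<integral>\<^sup>+ y\<in>{0<..<x}. (resolvent_kernel (volterra_kernel W \<phi>) x y *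
           ennreal (inverse (Xi W \<phi> x) * (q * W y))) \<partial>lborel) < \<infinity> \<and>
        (\<integral>\<^sup>+ y\<in>{0<..<x}. (resolvent_kernel (volterra_kernel W \<phi>) x y *
           ennreal (inverse (Xi W \<phi> y) * (q * W y))) \<partial>lborel) < \<infinity>) \<and>
     unique_volterra_solution {0..T} 0
       (\<lambda>x. inverse (Xi W \<phi> x) * (q * W x)) (volterra_kernel W \<phi>)
       (\<lambda>x. inverse (Xi W \<phi> x) * (q * W x) +
          enn2real (\<integral>\<^sup>+ y\<in>{0<..<x}. (resolvent_kernel (volterra_kernel W \<phi>) x y *
            ennreal (inverse (Xi W \<phi> y) * (q * W y))) \<partial>lborel))"
proof -
  have nu: "levy_measure \<nu>" using X by (simp add: spectrally_negative_levy_def)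
  have mono: "mono \<phi>" using phi by (simp add: rate_function_def)
  obtain d' where d': "\<And>x. x \<le> d' \<Longrightarrow> \<phi> x = 0" using phi by (auto simp: rate_function_def)
  have phi0: "0 \<le> \<phi> x" for x
    using monoD[OF mono, of "min x d'" x] d'[of "min x d'"] by simp
  \<comment> \<open>Here \<open>drift_pos\<close> is \<open>phi_drift\<close> at \<open>d'\<close>,
    where \<open>\<phi>\<close> is 0.\<close>
  interpret scale \<gamma> \<sigma> q \<nu> W
    using nu q W phi_drift d'[of d'] by unfold_locales (metis order_refl)+
  have Wphi: "W 0 * \<phi> x < 1" for x
  proof (cases "W 0 = 0")
    case False
    \<comment> \<open>A number strictly between \<open>\<phi> x\<close> and the drift turns the weak
      bound \<open>W 0 * K \<le> 1\<close> into a strict one for \<open>\<phi> x\<close>; for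
      unbounded variation any larger number serves.\<close>
    obtain K where K: "\<phi> x < K" "bounded_variation_case \<sigma> \<nu> \<Longrightarrow> K < drift \<gamma> \<nu>"
      using phi_drift dense[of "\<phi> x" "drift \<gamma> \<nu>"] gt_ex[of "\<phi> x"] by metis
    have "W 0 * \<phi> x < W 0 * K" using K(1) False W_nonneg[of 0] by (intro mult_strict_left_mono) auto
    also have "\<dots> \<le> 1" using K(2) by (rule W_0_mult_le)
    finally show ?thesis .
  qed simp
  define \<Xi> where "\<Xi> = Xi W \<phi>"
  have \<Xi>: "0 < \<Xi> x" "\<Xi> x \<le> 1" "x \<le> y \<Longrightarrow> inverse (\<Xi> x) \<le> inverse (\<Xi> y)" for x y
    using Wphi[of x] Wphi[of y] W_nonneg[of 0] phi0[of x] monoD[OF mono, of x y]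
    by (auto simp: \<Xi>_def Xi_def mult_left_mono)
  have [measurable]: "\<phi> \<in> borel_measurable borel" using mono by (rule borel_measurable_mono)
  have [measurable]: "\<Xi> \<in> borel_measurable borel" unfolding \<Xi>_def Xi_def[abs_def] by measurable
  \<comment> \<open>The factor \<open>inverse (\<Xi> y) \<ge> 1\<close> may be inserted into the
    integrand, and \<open>inverse (\<Xi> x)\<close> is constant in \<open>y\<close>.\<close>
  have swap: "(\<integral>\<^sup>+ y\<in>{a<..<x}. (resolvent_kernel (volterra_kernel W \<phi>) x y * ennreal (inverse (\<Xi> x) * f y)) \<partial>lborel) < \<infinity>"
    if f: "\<And>y. a < y \<Longrightarrow> 0 \<le> f y" and [measurable]: "f \<in> borel_measurable borel"
      and fin: "(\<integral>\<^sup>+ y\<in>{a<..<x}. (resolvent_kernel (volterra_kernel W \<phi>) x y * ennreal (inverse (\<Xi> y) * f y)) \<partial>lborel) < \<infinity>" for f a x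
  proof -
    obtain C B where "volterra (volterra_kernel W \<phi>) (right_deriv W) a x C B"
      using volterra_scale_kernel[OF mono phi0 Wphi] by metis
    then interpret volterra "volterra_kernel W \<phi>" "right_deriv W" a x C B .
    have [measurable]: "(\<lambda>y. resolvent_kernel (volterra_kernel W \<phi>) x y) \<in> borel_measurable borel"
      unfolding resolvent_kernel_def[abs_def] by measurable
    have "(\<integral>\<^sup>+ y\<in>{a<..<x}. (resolvent_kernel (volterra_kernel W \<phi>) x y * ennreal (inverse (\<Xi> x) * f y)) \<partial>lborel)
      \<le> (\<integral>\<^sup>+ y. ennreal (inverse (\<Xi> x)) * (resolvent_kernel (volterra_kernel W \<phi>) x y * ennreal (inverse (\<Xi> y) * f y) * indicator {a<..<x} y) \<partial>lborel)"
    proof (rule nn_integral_mono)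
      fix y
      show "resolvent_kernel (volterra_kernel W \<phi>) x y * ennreal (inverse (\<Xi> x) * f y) * indicator {a<..<x} y
        \<le> ennreal (inverse (\<Xi> x)) * (resolvent_kernel (volterra_kernel W \<phi>) x y * ennreal (inverse (\<Xi> y) * f y) * indicator {a<..<x} y)"
      proof (cases "y \<in> {a<..<x}")
        case True
        have "1 \<le> inverse (\<Xi> y)" using \<Xi>[of y] by (simp add: one_le_inverse_iff)
        then have "1 * f y \<le> inverse (\<Xi> y) * f y" using f True by (intro mult_right_mono) auto
        then have "inverse (\<Xi> x) * f y \<le> inverse (\<Xi> x) * (inverse (\<Xi> y) * f y)"
          using \<Xi>(1)[of x] by (intro mult_left_mono) auto
        then have "ennreal (inverse (\<Xi> x) * f y) \<le> ennreal (inverse (\<Xi> x)) * ennreal (inverse (\<Xi> y) * f y)"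
          using \<Xi>(1)[of x] \<Xi>(1)[of y] f[of y] True by (simp add: ennreal_mult[symmetric] ennreal_leI)
        then have "resolvent_kernel (volterra_kernel W \<phi>) x y * ennreal (inverse (\<Xi> x) * f y)
          \<le> resolvent_kernel (volterra_kernel W \<phi>) x y * (ennreal (inverse (\<Xi> x)) * ennreal (inverse (\<Xi> y) * f y))"
          by (rule mult_left_mono) simp
        then show ?thesis using True by (simp add: mult_ac)
      qed simp
    qed
    also have "\<dots> = ennreal (inverse (\<Xi> x)) * (\<integral>\<^sup>+ y\<in>{a<..<x}. (resolvent_kernel (volterra_kernel W \<phi>) x y * ennreal (inverse (\<Xi> y) * f y)) \<partial>lborel)"
      by (rule nn_integral_cmult) measurable
    also have "\<dots> < \<infinity>" using fin by (simp add: ennreal_mult_less_top)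
    finally show ?thesis .
  qed
  obtain B where B: "0 \<le> B" "\<And>t. 0 < t \<Longrightarrow> t \<le> max (T - d) 1 \<Longrightarrow> t^3 * right_deriv W t \<le> B"
    using right_deriv_cubic_bound[of "max (T - d) 1"] less_max_iff_disj zero_less_one by metis
  have f1_int: "(\<integral>\<^sup>+ x\<in>{d<..<T}. ennreal (inverse (\<Xi> x) * right_deriv W (x - d)) \<partial>lborel) < \<infinity>"
  proof -
    have "(\<integral>\<^sup>+ x\<in>{d<..<T}. ennreal (inverse (\<Xi> x) * right_deriv W (x - d)) \<partial>lborel)
      \<le> (\<integral>\<^sup>+ x. ennreal (inverse (\<Xi> T)) * (ennreal (right_deriv W (x - d)) * indicator {0<..<T - d} (x - d)) \<partial>lborel)"
    proof (rule nn_integral_mono)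
      fix x
      show "ennreal (inverse (\<Xi> x) * right_deriv W (x - d)) * indicator {d<..<T} x
        \<le> ennreal (inverse (\<Xi> T)) * (ennreal (right_deriv W (x - d)) * indicator {0<..<T - d} (x - d))"
        using \<Xi>(1)[of T] \<Xi>(3)[of x T] right_deriv_nonneg[of "x - d"]
        by (auto simp: indicator_def ennreal_mult[symmetric] intro!: ennreal_leI mult_right_mono)
    qed
    also have "\<dots> = ennreal (inverse (\<Xi> T)) * (\<integral>\<^sup>+ x. ennreal (right_deriv W (x - d)) * indicator {0<..<T - d} (x - d) \<partial>lborel)"
      by (rule nn_integral_cmult) measurable
    also have "(\<integral>\<^sup>+ x. ennreal (right_deriv W (x - d)) * indicator {0<..<T - d} (x - d) \<partial>lborel)
       = (\<integral>\<^sup>+ t\<in>{0<..<T - d}. ennreal (right_deriv W t) \<partial>lborel)"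
      using nn_integral_real_affine[of "\<lambda>t. ennreal (right_deriv W t) * indicator {0<..<T - d} t" 1 "- d"] by simp
    also have "ennreal (inverse (\<Xi> T)) * \<dots> < \<infinity>"
      using right_deriv_integrable[of "T - d"] by (cases "0 \<le> T - d") (auto simp: ennreal_mult_less_top)
    finally show ?thesis .
  qed
  have f1_0: "0 \<le> inverse (\<Xi> x) * right_deriv W (x - d)" if "d < x" for x
    using \<Xi>(1)[of x] right_deriv_nonneg[of "x - d"] that by simp
  have f1_S: "(x - d)^3 * (inverse (\<Xi> x) * right_deriv W (x - d)) \<le> inverse (\<Xi> T) * B" if "d < x" "x \<le> T" for x
  proof -
    have "inverse (\<Xi> x) * ((x - d)^3 * right_deriv W (x - d)) \<le> inverse (\<Xi> T) * B"
      using that \<Xi>(1)[of T] \<Xi>(3)[of x T] right_deriv_nonneg[of "x - d"] by (intro mult_mono B) auto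
    then show ?thesis by (simp add: mult_ac)
  qed
  note sol1 = unique_volterra_scale_solution[OF mono phi0 Wphi _ _ _ _ f1_0 f1_S f1_int, of "{d<..T}"]
  have f2_0: "0 \<le> inverse (\<Xi> x) * (q * W x)" for x
    using \<Xi>(1)[of x] q W_nonneg[of x] by simp
  have f2_le: "inverse (\<Xi> x) * (q * W x) \<le> inverse (\<Xi> T) * (q * W T)" if "x \<le> T" for x
    using that \<Xi>(1)[of T] \<Xi>(3)[of x T] q W_nonneg by (intro mult_mono mult_left_mono W_mono) auto
  \<comment> \<open>The second forcing term is bounded on \<open>[0, T]\<close>, so the cubic weight
    only costs a factor \<open>T^3\<close>.\<close>
  have f2_S: "(x - 0)^3 * (inverse (\<Xi> x) * (q * W x)) \<le> T^3 * (inverse (\<Xi> T) * (q * W T))" if "0 < x" "x \<le> T" for x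
    by (rule mult_mono[OF power_mono]) (use that f2_0[of x] f2_le[of x] in auto)
  have f2_int: "(\<integral>\<^sup>+ x\<in>{0<..<T}. ennreal (inverse (\<Xi> x) * (q * W x)) \<partial>lborel) < \<infinity>"
  proof -
    have "(\<integral>\<^sup>+ x\<in>{0<..<T}. ennreal (inverse (\<Xi> x) * (q * W x)) \<partial>lborel)
      \<le> (\<integral>\<^sup>+ x\<in>{0<..<T}. ennreal (inverse (\<Xi> T) * (q * W T)) \<partial>lborel)"
      using f2_le by (intro nn_integral_mono) (auto simp: indicator_def intro!: ennreal_leI)
    also have "\<dots> = ennreal (inverse (\<Xi> T) * (q * W T)) * emeasure lborel {0<..<T}"
      by (simp add: nn_integral_cmult_indicator)
    also have "\<dots> < \<infinity>" using T by (simp add: ennreal_mult_less_top)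
    finally show ?thesis .
  qed
  note sol2 = unique_volterra_scale_solution[OF mono phi0 Wphi _ _ _ _ f2_0 f2_S f2_int, of "{0..T}"]
  show ?thesis
    unfolding \<Xi>_def[symmetric]
  proof (intro conjI allI impI)
    fix x assume "d < x \<and> x \<le> T"
    then show 1: "(\<integral>\<^sup>+ y\<in>{d<..<x}. (resolvent_kernel (volterra_kernel W \<phi>) x y *
        ennreal (inverse (\<Xi> y) * right_deriv W (y - d))) \<partial>lborel) < \<infinity>"
      by (intro sol1(1)) auto
    show "(\<integral>\<^sup>+ y\<in>{d<..<x}. (resolvent_kernel (volterra_kernel W \<phi>) x y *
        ennreal (inverse (\<Xi> x) * right_deriv W (y - d))) \<partial>lborel) < \<infinity>"
      by (rule swap[OF _ _ 1]) (auto intro: right_deriv_nonneg)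
  next
    show "unique_volterra_solution {d<..T} d (\<lambda>x. inverse (\<Xi> x) * right_deriv W (x - d)) (volterra_kernel W \<phi>)
       (\<lambda>x. inverse (\<Xi> x) * right_deriv W (x - d) +
          enn2real (\<integral>\<^sup>+ y\<in>{d<..<x}. (resolvent_kernel (volterra_kernel W \<phi>) x y *
            ennreal (inverse (\<Xi> y) * right_deriv W (y - d))) \<partial>lborel))"
      by (rule sol1(2)) auto
  next
    fix x assume x: "0 \<le> x \<and> x \<le> T"
    show 2: "(\<integral>\<^sup>+ y\<in>{0<..<x}. (resolvent_kernel (volterra_kernel W \<phi>) x y *
        ennreal (inverse (\<Xi> y) * (q * W y))) \<partial>lborel) < \<infinity>"
    proof (cases "x = 0")
      case False
      then show ?thesis using x by (intro sol2(1)) auto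
    qed simp
    show "(\<integral>\<^sup>+ y\<in>{0<..<x}. (resolvent_kernel (volterra_kernel W \<phi>) x y *
        ennreal (inverse (\<Xi> x) * (q * W y))) \<partial>lborel) < \<infinity>"
      by (rule swap[OF _ _ 2]) (use q W_nonneg in auto)
  next
    show "unique_volterra_solution {0..T} 0 (\<lambda>x. inverse (\<Xi> x) * (q * W x)) (volterra_kernel W \<phi>)
       (\<lambda>x. inverse (\<Xi> x) * (q * W x) +
          enn2real (\<integral>\<^sup>+ y\<in>{0<..<x}. (resolvent_kernel (volterra_kernel W \<phi>) x y *
            ennreal (inverse (\<Xi> y) * (q * W y))) \<partial>lborel))"
      by (rule sol2(2)) auto
  qed
qed

end
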